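(* Let $P_1,\dots,P_n$ be p-values (random variables in $[0,1]$) and let $\boldsymbol\omega=(\omega_1,\dots,\omega_n)$ be non-random weights with $\omega_i>0$ and $\sum_{i=1}^n\omega_i=n$. Let $I_{\mathbf P}$ be the set of dominating signals of $\mathbf P=(P_1,\dots,P_n)$. Suppose that: (i) each $P_i$ is continuously distributed; (ii) the vector $(1-P_1,\dots,1-P_n)$ has an MRV copula; (iii) for any distinct $i,j\in I_{\mathbf P}$, $\lim_{t\downarrow0}\mathbb{P}(P_i<t)/\mathbb{P}(P_j<t)$ exists in $(0,\infty)$; and for at least one $i\in I_{\mathbf P}$ there exists $F_0\in\mathscr{R}_{-1}$ such that the distribution of $Q_{F_0}(1-P_i)$ belongs to $\mathscr{R}_{-\beta}$ for some $0<\beta\le1$. For $\gamma>0$ and $F\in\mathscr{R}^*_{-\gamma}$ consider the limiting scaled power $$\tilde q(\gamma)=\lim_{\alpha\downarrow0}\frac{\mathbb{P}\left(P_{\mathrm{comb}}^{F,\boldsymbol\omega}\le\alpha\right)}{\sum_{i=1}^n\mathbb{P}\left(P_i\le\omega_i\alpha/n\right)}.$$ Then $\tilde q(\gamma)$ depends on the transformation function $F$ only through its tail index $\gamma$, and it is non-decreasing in $\gamma$: $\tilde q(\gamma_1)\ge\tilde q(\gamma_2)$ for all $\gamma_1>\gamma_2>0$. Moreover, the inequality is strict if and only if the set $I_{\mathbf P}=\{i_1,\dots,i_S\}$ has at least two elements and the subvector $(1-P_{i_1},\dots,1-P_{i_S})$ is not asymptotically independent.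
   Context: The number $n$ of p-values is fixed; $\mathbb{P}$ is probability under the true configuration of hypotheses. For a CDF $F$, $\overline F=1-F$ and $Q_F(t)=\inf\{x\in\mathbb{R}:F(x)\ge t\}$ for $t\in(0,1)$; when the support of $F$ is $[c,\infty)$ set $Q_F(0)=c$. For $\gamma>0$, $\mathscr{R}_{-\gamma}$ is the class of CDFs $F$ with $\lim_{x\to\infty}\overline F(xy)/\overline F(x)=y^{-\gamma}$ for all $y>0$. $\mathscr{R}^*_{-\gamma}$ is the class of $F\in\mathscr{R}_{-\gamma}$ that are continuous and strictly increasing on their support, with support $[c,\infty)$ for some $c\in\mathbb{R}$. Weighted heavy-tailed combination test: for $F\in\mathscr{R}^*_{-\gamma}$, with $x^+=\max(0,x)$, $$\bar X_{n,\boldsymbol\omega}=\frac1n\sum_{i=1}^n Q_F\left((1-P_i/\omega_i)^+\right),\qquad P_{\mathrm{comb}}^{F,\boldsymbol\omega}=\min\left(1,\,n^{1-\gamma}\,\overline F(\bar X_{n,\boldsymbol\omega})\right).$$ Dominating signals: write $P_i\succ P_j$ if $\lim_{t\downarrow0}\mathbb{P}(P_i<t)/\mathbb{P}(P_j<t)=0$. Then $I_{\mathbf P}=\{i\in\{1,\dots,n\}:\text{there is no } j\in\{1,\dots,n\}\text{ with }P_i\succ P_j\}$. MRV copula: for an $n$-dimensional copula $C$ let $D(u_1,\dots,u_n)=1-C(1-u_1,\dots,1-u_n)$. $C$ is an MRV copula if for some (real-valued) function $\ell$, $\lim_{s\downarrow0}s^{-1}D(sv_1,\dots,sv_n)=\ell(v_1,\dots,v_n)$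 for all $v_1,\dots,v_n\ge0$. Equivalently, there is a copula $C^*$ (the limiting copula) with $\lim_{t\to\infty}C(u_1^{1/t},\dots,u_n^{1/t})^t=C^*(u_1,\dots,u_n)$ for all $u\in[0,1]^n$. The same definitions apply in any dimension. A random vector with continuous marginals is asymptotically independent if its copula is MRV with limiting copula equal to the product copula $u_1\cdots u_n$ (equivalently $\ell(v_1,\dots,v_n)=v_1+\dots+v_n$). *)

theory Defs
  imports "HOL-Probability.Probability"
begin

subsection \<open>Distribution functions, quantiles and regular variation\<close>

definition is_cdf :: "(real \<Rightarrow> real) \<Rightarrow> bool" where
  "is_cdf F \<longleftrightarrow> (\<exists>\<nu>. real_distribution \<nu> \<and> F = cdf \<nu>)"

text \<open>The support of the distribution with CDF \<open>F\<close>: the points all of whose neighbourhoods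
  have positive mass.\<close>

definition cdf_support :: "(real \<Rightarrow> real) \<Rightarrow> real set" where
  "cdf_support F = {x. \<forall>e>0. F (x - e) < F (x + e)}"

text \<open>At \<open>t = 0\<close> the value is \<open>c\<close> if the support is \<open>{c..}\<close>. The function is only meant for
  \<open>0 \<le> t < 1\<close>; the value at \<open>t = 1\<close> is arbitrary if \<open>F < 1\<close> everywhere.\<close>

definition Q :: "(real \<Rightarrow> real) \<Rightarrow> real \<Rightarrow> real" where
  "Q F t = (if t = 0 then Inf (cdf_support F) else Inf {x. t \<le> F x})"

text \<open>The index \<open>\<gamma>\<close> stands for tails of order \<open>-\<gamma>\<close>. The limit is positive, so it forces
  \<open>F x < 1\<close> for all \<open>x\<close>, and the quotient is never a division by zero.\<close>

definition RV :: "real \<Rightarrow> (real \<Rightarrow> real) set" where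
  "RV \<gamma> = {F. is_cdf F \<and>
     (\<forall>y>0. ((\<lambda>x. (1 - F (x * y)) / (1 - F x)) \<longlongrightarrow> y powr (- \<gamma>)) at_top)}"

definition RV_star :: "real \<Rightarrow> (real \<Rightarrow> real) set" where
  "RV_star \<gamma> = {F \<in> RV \<gamma>. (\<forall>x\<in>cdf_support F. isCont F x) \<and>
     strict_mono_on (cdf_support F) F \<and> (\<exists>c. cdf_support F = {c..})}"

subsection \<open>The weighted combination test\<close>

definition X_bar :: "nat \<Rightarrow> (nat \<Rightarrow> real) \<Rightarrow> (real \<Rightarrow> real) \<Rightarrow> (nat \<Rightarrow> 'a \<Rightarrow> real) \<Rightarrow> 'a \<Rightarrow> real" where
  "X_bar n w F P x = (1 / real n) * (\<Sum>i=1..n. Q F (max 0 (1 - P i x / w i)))"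

definition P_comb ::
  "nat \<Rightarrow> (nat \<Rightarrow> real) \<Rightarrow> real \<Rightarrow> (real \<Rightarrow> real) \<Rightarrow> (nat \<Rightarrow> 'a \<Rightarrow> real) \<Rightarrow> 'a \<Rightarrow> real" where
  "P_comb n w \<gamma> F P x = min 1 (real n powr (1 - \<gamma>) * (1 - F (X_bar n w F P x)))"

definition scaled_power ::
  "'a measure \<Rightarrow> nat \<Rightarrow> (nat \<Rightarrow> real) \<Rightarrow> (nat \<Rightarrow> 'a \<Rightarrow> real) \<Rightarrow> real \<Rightarrow> (real \<Rightarrow> real) \<Rightarrow> real \<Rightarrow> real" where
  "scaled_power M n w P \<gamma> F \<alpha> =
     \<P>(x in M. P_comb n w \<gamma> F P x \<le> \<alpha>) / (\<Sum>i=1..n. \<P>(x in M. P i x \<le> w i * \<alpha> / real n))"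

subsection \<open>Dominating signals\<close>

text \<open>Here \<open>Y \<succ> Z\<close>, i.e. \<open>Z\<close> is the stronger signal. The first conjunct says that the quotient is
  defined: without it, the convention \<open>a / 0 = 0\<close> would make \<open>Y \<succ> Z\<close> true whenever \<open>Z\<close> is
  bounded away from zero.\<close>

definition signal_succ :: "'a measure \<Rightarrow> ('a \<Rightarrow> real) \<Rightarrow> ('a \<Rightarrow> real) \<Rightarrow> bool" where
  "signal_succ M Y Z \<longleftrightarrow> (\<forall>t>0. \<P>(x in M. Z x < t) > 0) \<and>
     ((\<lambda>t. \<P>(x in M. Y x < t) / \<P>(x in M. Z x < t)) \<longlongrightarrow> 0) (at_right 0)"

definition dominating_signals :: "'a measure \<Rightarrow> nat \<Rightarrow> (nat \<Rightarrow> 'a \<Rightarrow> real) \<Rightarrow> nat set" where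
  "dominating_signals M n P = {i \<in> {1..n}. \<not> (\<exists>j\<in>{1..n}. signal_succ M (P i) (P j))}"

subsection \<open>Copulas\<close>

text \<open>The coordinates of a copula are indexed by a finite set \<open>I\<close>, so that subvectors need no
  renumbering. A copula is a function on all of \<open>nat \<Rightarrow> real\<close>, but only its values at points with
  all \<open>I\<close>-coordinates in \<open>{0..1}\<close> are significant.\<close>

definition is_copula :: "nat set \<Rightarrow> ((nat \<Rightarrow> real) \<Rightarrow> real) \<Rightarrow> bool" where
  "is_copula I C \<longleftrightarrow> (\<exists>\<nu>. prob_space \<nu> \<and> sets \<nu> = sets (Pi\<^sub>M I (\<lambda>_. borel)) \<and>
     (\<forall>i\<in>I. \<forall>t\<in>{0..1}. \<P>(x in \<nu>. x i \<le> t) = t) \<and>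
     (\<forall>u. (\<forall>i\<in>I. u i \<in> {0..1}) \<longrightarrow> C u = \<P>(x in \<nu>. \<forall>i\<in>I. x i \<le> u i)))"

text \<open>Sklar's relation; it determines \<open>C\<close> on the unit cube when the marginals are continuous.\<close>

definition is_copula_of ::
  "'a measure \<Rightarrow> nat set \<Rightarrow> (nat \<Rightarrow> 'a \<Rightarrow> real) \<Rightarrow> ((nat \<Rightarrow> real) \<Rightarrow> real) \<Rightarrow> bool" where
  "is_copula_of M I X C \<longleftrightarrow> is_copula I C \<and>
     (\<forall>y. \<P>(x in M. \<forall>i\<in>I. X i x \<le> y i) = C (\<lambda>i. \<P>(x in M. X i x \<le> y i)))"

definition copula_D :: "((nat \<Rightarrow> real) \<Rightarrow> real) \<Rightarrow> (nat \<Rightarrow> real) \<Rightarrow> real" where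
  "copula_D C u = 1 - C (\<lambda>i. 1 - u i)"

definition mrv_copula :: "nat set \<Rightarrow> ((nat \<Rightarrow> real) \<Rightarrow> real) \<Rightarrow> bool" where
  "mrv_copula I C \<longleftrightarrow> is_copula I C \<and>
     (\<exists>l :: (nat \<Rightarrow> real) \<Rightarrow> real. \<forall>v. (\<forall>i\<in>I. 0 \<le> v i) \<longrightarrow>
        ((\<lambda>s. inverse s * copula_D C (\<lambda>i. s * v i)) \<longlongrightarrow> l v) (at_right 0))"

definition limiting_copula ::
  "nat set \<Rightarrow> ((nat \<Rightarrow> real) \<Rightarrow> real) \<Rightarrow> ((nat \<Rightarrow> real) \<Rightarrow> real) \<Rightarrow> bool" where
  "limiting_copula I C C' \<longleftrightarrow> is_copula I C' \<and>
     (\<forall>u. (\<forall>i\<in>I. u i \<in> {0..1}) \<longrightarrow>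
        ((\<lambda>t::real. C (\<lambda>i. u i powr (1 / t)) powr t) \<longlongrightarrow> C' u) at_top)"

definition has_mrv_copula :: "'a measure \<Rightarrow> nat set \<Rightarrow> (nat \<Rightarrow> 'a \<Rightarrow> real) \<Rightarrow> bool" where
  "has_mrv_copula M I X \<longleftrightarrow> (\<exists>C. is_copula_of M I X C \<and> mrv_copula I C)"

definition asymp_independent :: "'a measure \<Rightarrow> nat set \<Rightarrow> (nat \<Rightarrow> 'a \<Rightarrow> real) \<Rightarrow> bool" where
  "asymp_independent M I X \<longleftrightarrow>
     (\<exists>C. is_copula_of M I X C \<and> mrv_copula I C \<and> limiting_copula I C (\<lambda>u. \<Prod>i\<in>I. u i))"

end

theory Submission
  imports Defs
begin

text \<open>
  Only the behaviour of the p-values near zero matters. Let \<open>g\<close> be the distribution function of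
  a dominating p-value for which the regular variation hypothesis holds. Undoing the quantile
  transformation shows that \<open>g\<close> varies regularly at zero with index \<open>\<beta>\<close>
  (\<open>reg_var0_of_quantile_transform\<close>). Each other distribution function is asymptotic to \<open>c\<^sub>i * g\<close>
  with \<open>c\<^sub>i \<ge> 0\<close>, and \<open>c\<^sub>i > 0\<close> exactly for the dominating signals. The MRV copula then makes
  \<open>\<P>(\<exists>i. P\<^sub>i < b\<^sub>i * t) / g t\<close> converge for all \<open>b \<ge> 0\<close>.

  \<^emph>\<open>The limit.\<close> Put \<open>t = \<alpha> / n\<close>, and let \<open>x\<close> be the point with \<open>1 - F x = n powr \<gamma> * t\<close>, so that the
  test rejects iff the mean of the transformed p-values is at least \<open>x\<close>. Since \<open>1 - F\<close> varies
  regularly with index \<open>-\<gamma>\<close>, the summand \<open>Q F (1 - P\<^sub>i / w\<^sub>i) / (n * x)\<close> is close to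
  \<open>(t * w\<^sub>i / P\<^sub>i) powr (1 / \<gamma>)\<close>, uniformly after truncation at 2
  (\<open>RV_star_quantile_power\<close>). Rejection is therefore squeezed between the events
  \<open>1 \<le> (\<Sum>i. (t' * w\<^sub>i / P\<^sub>i) powr (1 / \<gamma>))\<close> for two levels \<open>t'\<close> that differ from \<open>t\<close> by factors
  arbitrarily close to 1 (\<open>P_comb_sandwich\<close>). These events depend on \<open>F\<close> only through \<open>\<gamma>\<close>. Their
  probabilities divided by \<open>g t\<close> converge (\<open>sum_tail_convergent\<close>): rounding the summands to a
  grid turns the event into a Boolean combination of events \<open>P\<^sub>i < b * t\<close>, whose probability
  converges by inclusion and exclusion, and rounding costs only a factor in \<open>t\<close>.

  \<^emph>\<open>Monotonicity.\<close> With \<open>p = 1 / \<gamma>\<close> the event says that a vector has \<open>p\<close>-norm at least 1, and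
  \<open>p\<close>-norms decrease in \<open>p\<close>.

  \<^emph>\<open>Strictness.\<close> If any two p-values are jointly of order \<open>t\<close> only with probability \<open>o(g t)\<close>, then
  the sum can reach 1 essentially only through a single summand, and the limit is 1 for
  every \<open>\<gamma>\<close> (\<open>power_limit_tail_independent\<close>). Otherwise two coordinates are simultaneously large
  with probability of order \<open>g t\<close>, and there the two norms differ by a factor bounded away
  from 1, which yields a strict inequality (\<open>power_limit_strict_mono\<close>). Finally, a pair with a
  non-dominating member is always negligible, and for the dominating signals
  pairwise negligibility is the same as additivity of the limit function of the copula, that is,
  asymptotic independence.
\<close>

section \<open>Regular variation at zero\<close>

text \<open>Regular variation at zero from the right, with index \<open>\<beta>\<close>, of a function that is positive on
  the positive half-line.\<close>

definition reg_var0 :: "real \<Rightarrow> (real \<Rightarrow> real) \<Rightarrow> bool" where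
  "reg_var0 \<beta> g \<longleftrightarrow> (\<forall>t>0. 0 < g t) \<and>
     (\<forall>b>0. ((\<lambda>t. g (b * t) / g t) \<longlongrightarrow> b powr \<beta>) (at_right 0))"

lemma filterlim_mult_at_right_0:
  fixes b :: real
  assumes "0 < b"
  shows "filterlim (\<lambda>t. b * t) (at_right 0) (at_right 0)"
proof -
  have "((\<lambda>t. b * t) \<longlongrightarrow> 0) (at_right 0)"
    by (auto intro!: tendsto_eq_intros)
  moreover have "\<forall>\<^sub>F t in at_right 0. b * t \<in> {0<..} \<and> b * t \<noteq> 0"
    using assms by (auto simp: eventually_at_right_less intro: eventually_mono[OF eventually_at_right_less])
  ultimately show ?thesis
    by (simp add: filterlim_at)
qed

lemma reg_var0_ratio_scale:
  assumes g: "reg_var0 \<beta> g" and f: "((\<lambda>t. f t / g t) \<longlongrightarrow> L) (at_right 0)" and b: "0 < b"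
  shows "((\<lambda>t. f (b * t) / g t) \<longlongrightarrow> L * b powr \<beta>) (at_right 0)"
proof -
  have "((\<lambda>t. f (b * t) / g (b * t)) \<longlongrightarrow> L) (at_right 0)"
    using filterlim_compose[OF f filterlim_mult_at_right_0[OF b]] .
  moreover have "((\<lambda>t. g (b * t) / g t) \<longlongrightarrow> b powr \<beta>) (at_right 0)"
    using g b by (auto simp: reg_var0_def)
  ultimately have "((\<lambda>t. f (b * t) / g (b * t) * (g (b * t) / g t)) \<longlongrightarrow> L * b powr \<beta>) (at_right 0)"
    by (rule tendsto_mult)
  moreover have "\<forall>\<^sub>F t in at_right 0. f (b * t) / g (b * t) * (g (b * t) / g t) = f (b * t) / g t"
    using eventually_at_right_less
  proof eventually_elim
    case (elim t)
    then have "0 < g (b * t)"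
      using g b by (auto simp: reg_var0_def)
    then show ?case by simp
  qed
  ultimately show ?thesis
    by (rule Lim_transform_eventually)
qed

text \<open>The two bounds tend to \<open>L\<close> as \<open>\<theta>\<close> decreases to 1; the slack \<open>e\<close> lets one obtain them from
  limits.\<close>

lemma tendsto_by_factor_bounds:
  fixes h :: "'b \<Rightarrow> real"
  assumes up: "\<And>\<theta> e. 1 < \<theta> \<Longrightarrow> 0 < e \<Longrightarrow> \<forall>\<^sub>F x in F. h x \<le> L * \<theta> powr \<beta> + e"
    and lo: "\<And>\<theta> e. 1 < \<theta> \<Longrightarrow> 0 < e \<Longrightarrow> \<forall>\<^sub>F x in F. L * \<theta> powr (-\<beta>) - e \<le> h x"
  shows "(h \<longlongrightarrow> L) F"
proof (rule order_tendstoI)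
  have lim: "((\<lambda>\<theta>. L * \<theta> powr b) \<longlongrightarrow> L) (at_right 1)" for b
    by (auto intro!: tendsto_eq_intros)
  fix a assume a: "a < L"
  have "\<forall>\<^sub>F \<theta> in at_right 1. (a + L) / 2 < L * \<theta> powr (-\<beta>)"
    using a by (intro order_tendstoD[OF lim]) auto
  then have "\<forall>\<^sub>F \<theta> in at_right 1. (a + L) / 2 < L * \<theta> powr (-\<beta>) \<and> 1 < \<theta>"
    using eventually_at_right_less[of "1::real"] by eventually_elim auto
  then obtain \<theta> where \<theta>: "1 < \<theta>" "(a + L) / 2 < L * \<theta> powr (-\<beta>)"
    using eventually_happens'[of "at_right (1::real)"] by auto
  show "\<forall>\<^sub>F x in F. a < h x"
    using lo[OF \<theta>(1), of "(L - a) / 4"] a \<theta>(2) 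
    by (auto elim!: eventually_mono simp: field_simps)
next
  have lim: "((\<lambda>\<theta>. L * \<theta> powr b) \<longlongrightarrow> L) (at_right 1)" for b
    by (auto intro!: tendsto_eq_intros)
  fix a assume a: "L < a"
  have "\<forall>\<^sub>F \<theta> in at_right 1. L * \<theta> powr \<beta> < (a + L) / 2"
    using a by (intro order_tendstoD[OF lim]) auto
  then have "\<forall>\<^sub>F \<theta> in at_right 1. L * \<theta> powr \<beta> < (a + L) / 2 \<and> 1 < \<theta>"
    using eventually_at_right_less[of "1::real"] by eventually_elim auto
  then obtain \<theta> where \<theta>: "1 < \<theta>" "L * \<theta> powr \<beta> < (a + L) / 2"
    using eventually_happens'[of "at_right (1::real)"] by auto
  show "\<forall>\<^sub>F x in F. h x < a"
    using up[OF \<theta>(1), of "(a - L) / 4"] a \<theta>(2) 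
    by (auto elim!: eventually_mono simp: field_simps)
qed

text \<open>Multiplying the argument by a factor close to 1 changes a limit relative to \<open>g\<close> only by a
  factor close to 1.\<close>

lemma reg_var0_sandwich:
  assumes g: "reg_var0 \<beta> g" and A: "((\<lambda>t. A t / g t) \<longlongrightarrow> L) (at_right 0)"
    and f: "\<And>\<theta>. 1 < \<theta> \<Longrightarrow> \<forall>\<^sub>F t in at_right 0. A (inverse \<theta> * t) \<le> f t \<and> f t \<le> A (\<theta> * t)"
  shows "((\<lambda>t. f t / g t) \<longlongrightarrow> L) (at_right 0)"
proof (rule tendsto_by_factor_bounds)
  fix \<theta> e :: real assume \<theta>: "1 < \<theta>" and e: "0 < e"
  have gp: "0 < g t" if "0 < t" for t
    using g that by (auto simp: reg_var0_def)
  have "((\<lambda>t. A (\<theta> * t) / g t) \<longlongrightarrow> L * \<theta> powr \<beta>) (at_right 0)"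
    using \<theta> by (intro reg_var0_ratio_scale[OF g A]) auto
  then have "\<forall>\<^sub>F t in at_right 0. A (\<theta> * t) / g t < L * \<theta> powr \<beta> + e"
    using e by (intro order_tendstoD) auto
  then show "\<forall>\<^sub>F t in at_right 0. f t / g t \<le> L * \<theta> powr \<beta> + e"
    using f[OF \<theta>] eventually_at_right_less[of "0::real"]
  proof eventually_elim
    case (elim t)
    then have "f t / g t \<le> A (\<theta> * t) / g t"
      using gp[of t] by (intro divide_right_mono) auto
    then show ?case using elim by simp
  qed
  have "((\<lambda>t. A (inverse \<theta> * t) / g t) \<longlongrightarrow> L * inverse \<theta> powr \<beta>) (at_right 0)"
    using \<theta> by (intro reg_var0_ratio_scale[OF g A]) auto
  moreover have "inverse \<theta> powr \<beta> = \<theta> powr (-\<beta>)"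
    using \<theta> by (simp add: powr_minus inverse_powr)
  ultimately have "\<forall>\<^sub>F t in at_right 0. A (inverse \<theta> * t) / g t > L * \<theta> powr (-\<beta>) - e"
    using e by (intro order_tendstoD) auto
  then show "\<forall>\<^sub>F t in at_right 0. L * \<theta> powr (-\<beta>) - e \<le> f t / g t"
    using f[OF \<theta>] eventually_at_right_less[of "0::real"]
  proof eventually_elim
    case (elim t)
    then have "A (inverse \<theta> * t) / g t \<le> f t / g t"
      using gp[of t] by (intro divide_right_mono) auto
    then show ?case using elim by simp
  qed
qed

text \<open>A criterion for convergence when the limit is not known in advance: the limit is the infimum of
  the limits of the upper approximations \<open>B\<close>. It makes it unnecessary to construct a limit measure.\<close>

lemma reg_var0_convergence_by_approximation:
  assumes g: "reg_var0 \<beta> g"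
    and f: "\<And>\<theta>. 1 < \<theta> \<Longrightarrow> \<exists>B L. ((\<lambda>t. B t / g t) \<longlongrightarrow> L) (at_right 0) \<and>
      (\<forall>\<^sub>F t in at_right 0. 0 \<le> f t \<and> f t \<le> B t \<and> B t \<le> f (\<theta> * t))"
  shows "\<exists>L. ((\<lambda>t. f t / g t) \<longlongrightarrow> L) (at_right 0)"
proof -
  have gp: "0 < g t" if "0 < t" for t
    using g that by (auto simp: reg_var0_def)
  define R where "R \<theta> B L \<longleftrightarrow> ((\<lambda>t. B t / g t) \<longlongrightarrow> L) (at_right 0) \<and>
      (\<forall>\<^sub>F t in at_right 0. 0 \<le> f t \<and> f t \<le> B t \<and> B t \<le> f (\<theta> * t))" for \<theta> B L
  have "\<exists>B L. R \<theta> B L" if "1 < \<theta>" for \<theta>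
    using f[OF that] unfolding R_def .
  then obtain B L where R: "\<And>\<theta>. 1 < \<theta> \<Longrightarrow> R \<theta> (B \<theta>) (L \<theta>)"
    by metis
  have B: "((\<lambda>t. B \<theta> t / g t) \<longlongrightarrow> L \<theta>) (at_right 0)"
    and fB: "\<forall>\<^sub>F t in at_right 0. 0 \<le> f t \<and> f t \<le> B \<theta> t \<and> B \<theta> t \<le> f (\<theta> * t)" if "1 < \<theta>" for \<theta>
    using R[OF that] unfolding R_def by auto
  have up: "\<forall>\<^sub>F t in at_right 0. 0 \<le> f t / g t \<and> f t / g t \<le> B \<theta> t / g t" if \<theta>: "1 < \<theta>" for \<theta>
    using fB[OF \<theta>] eventually_at_right_less[of "0::real"]
  proof eventually_elim
    case (elim t)
    then show ?case
      using gp[of t] by (auto intro!: divide_right_mono)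
  qed
  have lo: "\<forall>\<^sub>F t in at_right 0. B \<theta> (inverse \<theta> * t) / g t \<le> f t / g t" if \<theta>: "1 < \<theta>" for \<theta>
  proof -
    have "\<forall>\<^sub>F t in at_right 0. B \<theta> (inverse \<theta> * t) \<le> f (\<theta> * (inverse \<theta> * t))"
      using eventually_compose_filterlim[OF fB[OF \<theta>] filterlim_mult_at_right_0[of "inverse \<theta>"]] \<theta>
      by (auto elim: eventually_mono)
    then show ?thesis
      using eventually_at_right_less[of "0::real"]
    proof eventually_elim
      case (elim t)
      moreover have "\<theta> * (inverse \<theta> * t) = t" using \<theta> by (simp add: field_simps)
      ultimately show ?case
        using gp[of t] by (auto intro!: divide_right_mono)
    qed
  qed
  have limlo: "((\<lambda>t. B \<theta> (inverse \<theta> * t) / g t) \<longlongrightarrow> L \<theta> * \<theta> powr (-\<beta>)) (at_right 0)" if \<theta>: "1 < \<theta>" for \<theta>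
  proof -
    have "inverse \<theta> powr \<beta> = \<theta> powr (-\<beta>)"
      using \<theta> by (simp add: powr_minus inverse_powr)
    then show ?thesis
      using reg_var0_ratio_scale[OF g B[OF \<theta>], of "inverse \<theta>"] \<theta> by simp
  qed
  \<comment> \<open>every lower bound for the limit inferior is below every upper bound for the limit superior\<close>
  have cross: "L \<theta> * \<theta> powr (-\<beta>) \<le> L \<eta>" if \<theta>: "1 < \<theta>" and \<eta>: "1 < \<eta>" for \<theta> \<eta>
  proof (rule tendsto_le[OF _ B[OF \<eta>] limlo[OF \<theta>]])
    show "\<forall>\<^sub>F t in at_right 0. B \<theta> (inverse \<theta> * t) / g t \<le> B \<eta> t / g t"
      using lo[OF \<theta>] up[OF \<eta>] by eventually_elim auto
  qed simp
  have pos: "0 \<le> L \<theta>" if \<theta>: "1 < \<theta>" for \<theta>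
  proof (rule tendsto_lowerbound[OF B[OF \<theta>]])
    show "\<forall>\<^sub>F t in at_right 0. 0 \<le> B \<theta> t / g t"
      using up[OF \<theta>] by eventually_elim auto
  qed simp
  define l where "l = Inf (L ` {1<..})"
  have bdd: "bdd_below (L ` {1<..})"
    using pos by (auto intro!: bdd_belowI[of _ 0])
  have l1: "l \<le> L \<theta>" if "1 < \<theta>" for \<theta>
    unfolding l_def using bdd that by (auto intro!: cInf_lower)
  have l2: "L \<theta> * \<theta> powr (-\<beta>) \<le> l" if "1 < \<theta>" for \<theta>
    unfolding l_def using cross that by (auto intro!: cInf_greatest)
  have l3: "L \<theta> \<le> l * \<theta> powr \<beta>" if "1 < \<theta>" for \<theta>
  proof -
    have "\<theta> powr (-\<beta>) * \<theta> powr \<beta> = 1"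
      using that by (simp add: powr_minus)
    then have "L \<theta> = L \<theta> * \<theta> powr (-\<beta>) * \<theta> powr \<beta>"
      by (simp only: mult.assoc)
    also have "\<dots> \<le> l * \<theta> powr \<beta>"
      by (intro mult_right_mono l2 that) simp
    finally show ?thesis .
  qed
  have "((\<lambda>t. f t / g t) \<longlongrightarrow> l) (at_right 0)"
  proof (rule tendsto_by_factor_bounds)
    fix \<theta> e :: real assume \<theta>: "1 < \<theta>" and e: "0 < e"
    have "\<forall>\<^sub>F t in at_right 0. B \<theta> t / g t < l * \<theta> powr \<beta> + e"
      using l3[OF \<theta>] e by (intro order_tendstoD[OF B[OF \<theta>]]) auto
    then show "\<forall>\<^sub>F t in at_right 0. f t / g t \<le> l * \<theta> powr \<beta> + e"
      using up[OF \<theta>] by eventually_elim auto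
    have "l * \<theta> powr (-\<beta>) \<le> L \<theta> * \<theta> powr (-\<beta>)"
      using l1[OF \<theta>] by (intro mult_right_mono) auto
    then have "\<forall>\<^sub>F t in at_right 0. l * \<theta> powr (-\<beta>) - e < B \<theta> (inverse \<theta> * t) / g t"
      using e by (intro order_tendstoD[OF limlo[OF \<theta>]]) auto
    then show "\<forall>\<^sub>F t in at_right 0. l * \<theta> powr (-\<beta>) - e \<le> f t / g t"
      using lo[OF \<theta>] by eventually_elim auto
  qed
  then show ?thesis ..
qed

section \<open>Probabilities of Boolean combinations of events\<close>

text \<open>If the probabilities of all unions converge after normalisation, then so do those of all
  Boolean combinations, by inclusion and exclusion. The condition on \<open>\<phi>\<close> excludes combinations that
  contain the common complement of the events; its normalised probability usually diverges.\<close>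

lemma (in prob_space) prob_boolean_combination_convergent:
  fixes E :: "'b \<Rightarrow> 'c \<Rightarrow> 'a set" and g :: "'c \<Rightarrow> real"
  assumes S: "finite S" and E: "\<And>k x. k \<in> S \<Longrightarrow> E k x \<in> events"
    and union: "\<And>K. K \<subseteq> S \<Longrightarrow> \<exists>L. ((\<lambda>x. prob (\<Union>k\<in>K. E k x) / g x) \<longlongrightarrow> L) F"
    and \<phi>: "\<not> \<phi> {}"
  shows "\<exists>L. ((\<lambda>x. prob {\<omega> \<in> space M. \<phi> {k \<in> S. \<omega> \<in> E k x}} / g x) \<longlongrightarrow> L) F"
proof -
  let ?cell = "\<lambda>J K x. (\<Inter>k\<in>J. E k x) - (\<Union>k\<in>K. E k x)"
  have meas: "(\<Inter>k\<in>J. E k x) \<in> events" "(\<Union>k\<in>K. E k x) \<in> events"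
    if "J \<subseteq> S" "K \<subseteq> S" "J \<noteq> {}" for J K x
    using that E finite_subset[OF _ S] by (auto intro!: sets.finite_INT sets.finite_UN)
  \<comment> \<open>induction on the set of events that occur; each step takes the difference of two cells in which fewer events occur\<close>
  have cell: "\<exists>L. ((\<lambda>x. prob (?cell J K x) / g x) \<longlongrightarrow> L) F"
    if "finite J" "J \<noteq> {}" "J \<subseteq> S" "K \<subseteq> S" for J K
    using that
  proof (induction J arbitrary: K rule: finite_ne_induct)
    case (singleton j)
    obtain L1 where L1: "((\<lambda>x. prob (\<Union>k\<in>insert j K. E k x) / g x) \<longlongrightarrow> L1) F"
      using union[of "insert j K"] singleton by auto
    obtain L2 where L2: "((\<lambda>x. prob (\<Union>k\<in>K. E k x) / g x) \<longlongrightarrow> L2) F"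
      using union[of K] singleton by auto
    have "prob (?cell {j} K x) = prob (\<Union>k\<in>insert j K. E k x) - prob (\<Union>k\<in>K. E k x)" for x
    proof -
      have "?cell {j} K x = (\<Union>k\<in>insert j K. E k x) - (\<Union>k\<in>K. E k x)" by auto
      also have "prob \<dots> = prob (\<Union>k\<in>insert j K. E k x) - prob (\<Union>k\<in>K. E k x)"
        using meas(2)[of "{j}" "insert j K" x] meas(2)[of "{j}" K x] singleton
        by (intro finite_measure_Diff) auto
      finally show ?thesis .
    qed
    then have "(\<lambda>x. prob (?cell {j} K x) / g x) =
        (\<lambda>x. prob (\<Union>k\<in>insert j K. E k x) / g x - prob (\<Union>k\<in>K. E k x) / g x)"
      by (simp add: diff_divide_distrib)
    then show ?case using tendsto_diff[OF L1 L2] by auto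
  next
    case (insert j J)
    obtain L1 where L1: "((\<lambda>x. prob (?cell J K x) / g x) \<longlongrightarrow> L1) F"
      using insert.IH[of K] insert.prems by auto
    obtain L2 where L2: "((\<lambda>x. prob (?cell J (insert j K) x) / g x) \<longlongrightarrow> L2) F"
      using insert.IH[of "insert j K"] insert.prems by auto
    have "prob (?cell (insert j J) K x) = prob (?cell J K x) - prob (?cell J (insert j K) x)" for x
    proof -
      have "?cell (insert j J) K x = ?cell J K x - ?cell J (insert j K) x" by auto
      also have "prob \<dots> = prob (?cell J K x) - prob (?cell J (insert j K) x)"
        using meas[of J K x] meas[of J "insert j K" x] insert.prems insert.hyps
        by (intro finite_measure_Diff sets.Diff) auto
      finally show ?thesis .
    qed
    then have "(\<lambda>x. prob (?cell (insert j J) K x) / g x) =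
        (\<lambda>x. prob (?cell J K x) / g x - prob (?cell J (insert j K) x) / g x)"
      by (simp add: diff_divide_distrib)
    then show ?case using tendsto_diff[OF L1 L2] by auto
  qed
  let ?T = "{T. T \<subseteq> S \<and> \<phi> T}"
  have fin: "finite ?T" using S by auto
  have Tne: "T \<noteq> {}" if "T \<in> ?T" for T using that \<phi> by auto
  define lims where "lims T L \<longleftrightarrow> ((\<lambda>x. prob (?cell T (S - T) x) / g x) \<longlongrightarrow> L) F" for T L
  have "\<exists>L. lims T L" if "T \<in> ?T" for T
    unfolding lims_def using that Tne[OF that] by (intro cell finite_subset[OF _ S]) auto
  then obtain L' where "\<And>T. T \<in> ?T \<Longrightarrow> lims T (L' T)"
    by metis
  then have L: "((\<lambda>x. prob (?cell T (S - T) x) / g x) \<longlongrightarrow> L' T) F" if "T \<in> ?T" for T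
    using that unfolding lims_def by blast
  have "prob {\<omega> \<in> space M. \<phi> {k \<in> S. \<omega> \<in> E k x}} = (\<Sum>T\<in>?T. prob (?cell T (S - T) x))" for x
  proof -
    have sub: "E k x \<subseteq> space M" if "k \<in> S" for k
      using E[OF that] sets.sets_into_space by blast
    have "{\<omega> \<in> space M. \<phi> {k \<in> S. \<omega> \<in> E k x}} = (\<Union>T\<in>?T. ?cell T (S - T) x)"
    proof safe
      fix \<omega> assume "\<phi> {k \<in> S. \<omega> \<in> E k x}"
      then show "\<omega> \<in> (\<Union>T\<in>?T. ?cell T (S - T) x)"
        by (intro UN_I[of "{k \<in> S. \<omega> \<in> E k x}"]) auto
    next
      fix \<omega> T assume "T \<subseteq> S" "\<phi> T" and \<omega>: "\<omega> \<in> (\<Inter>k\<in>T. E k x)" "\<omega> \<notin> (\<Union>k\<in>S - T. E k x)"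
      moreover have "{k \<in> S. \<omega> \<in> E k x} = T" using \<omega> \<open>T \<subseteq> S\<close> by auto
      moreover have "T \<noteq> {}" using \<open>\<phi> T\<close> \<phi> by auto
      ultimately show "\<omega> \<in> space M" "\<phi> {k \<in> S. \<omega> \<in> E k x}"
        using sub by blast+
    qed
    also have "prob \<dots> = (\<Sum>T\<in>?T. prob (?cell T (S - T) x))"
    proof (rule finite_measure_finite_Union[OF fin])
      show "(\<lambda>T. ?cell T (S - T) x) ` ?T \<subseteq> events"
        using meas Tne by (auto intro!: sets.Diff)
      show "disjoint_family_on (\<lambda>T. ?cell T (S - T) x) ?T"
        by (fastforce simp: disjoint_family_on_def)
    qed
    finally show ?thesis .
  qed
  then have "(\<lambda>x. prob {\<omega> \<in> space M. \<phi> {k \<in> S. \<omega> \<in> E k x}} / g x) =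
      (\<lambda>x. \<Sum>T\<in>?T. prob (?cell T (S - T) x) / g x)"
    by (simp add: sum_divide_distrib)
  then show ?thesis
    using tendsto_sum[of ?T "\<lambda>T x. prob (?cell T (S - T) x) / g x" L' F] L by auto
qed

text \<open>A weak form of the Bonferroni inequality, in which every unordered pair is counted twice.\<close>

lemma (in prob_space) prob_union_ge_sum_minus_pairs:
  assumes "finite I" "\<And>i. i \<in> I \<Longrightarrow> E i \<in> events"
  shows "(\<Sum>i\<in>I. prob (E i)) - (\<Sum>i\<in>I. \<Sum>j\<in>I - {i}. prob (E i \<inter> E j)) \<le> prob (\<Union>i\<in>I. E i)"
  using assms
proof (induction I rule: finite_induct)
  case empty
  then show ?case by simp
next
  case (insert k I)
  let ?U = "\<Union>i\<in>I. E i"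
  have m: "?U \<in> events" "E k \<in> events" using insert by (auto intro!: sets.finite_UN)
  have "prob (E k \<inter> ?U) = prob (\<Union>i\<in>I. E k \<inter> E i)" by (rule arg_cong[where f = prob]) blast
  also have "\<dots> \<le> (\<Sum>i\<in>I. prob (E k \<inter> E i))"
    using insert by (intro finite_measure_subadditive_finite) auto
  finally have 1: "prob (E k \<inter> ?U) \<le> (\<Sum>i\<in>I. prob (E k \<inter> E i))" .
  have 2: "prob (E k \<union> ?U) = prob (E k) + prob ?U - prob (E k \<inter> ?U)"
    using m measure_Un3[of "E k" M ?U] by (simp add: fmeasurable_eq_sets)
  have "(\<Sum>i\<in>I. \<Sum>j\<in>I - {i}. prob (E i \<inter> E j)) \<le> (\<Sum>i\<in>I. \<Sum>j\<in>insert k I - {i}. prob (E i \<inter> E j))"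
    using insert by (intro sum_mono sum_mono2) auto
  moreover have "insert k I - {k} = I" using insert by auto
  ultimately have "(\<Sum>i\<in>I. prob (E k \<inter> E i)) + (\<Sum>i\<in>I. \<Sum>j\<in>I - {i}. prob (E i \<inter> E j))
     \<le> (\<Sum>i\<in>insert k I. \<Sum>j\<in>insert k I - {i}. prob (E i \<inter> E j))"
    using insert by simp
  moreover have "(\<Sum>i\<in>I. prob (E i)) - (\<Sum>i\<in>I. \<Sum>j\<in>I - {i}. prob (E i \<inter> E j)) \<le> prob ?U"
    using insert by auto
  ultimately show ?case
    using insert 1 2 by simp
qed

section \<open>Copulas\<close>

lemma copula_lipschitz:
  assumes C: "is_copula I C" and I: "finite I"
    and u: "\<And>i. i \<in> I \<Longrightarrow> u i \<in> {0..1}" and v: "\<And>i. i \<in> I \<Longrightarrow> v i \<in> {0..1}"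
  shows "\<bar>C u - C v\<bar> \<le> (\<Sum>i\<in>I. \<bar>u i - v i\<bar>)"
proof -
  obtain \<nu> where "prob_space \<nu>" and S: "sets \<nu> = sets (Pi\<^sub>M I (\<lambda>_. borel))"
    and marg: "\<And>i t. i \<in> I \<Longrightarrow> t \<in> {0..1} \<Longrightarrow> \<P>(x in \<nu>. x i \<le> t) = t"
    and C_eq: "\<And>u. (\<forall>i\<in>I. u i \<in> {0..1}) \<Longrightarrow> C u = \<P>(x in \<nu>. \<forall>i\<in>I. x i \<le> u i)"
    using C unfolding is_copula_def by blast
  interpret prob_space \<nu> by fact
  have comp[measurable]: "(\<lambda>x. x i) \<in> borel_measurable \<nu>" if "i \<in> I" for i
    using that measurable_cong_sets[OF S refl] measurable_component_singleton[of i I "\<lambda>_. borel"] by blast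
  have ev: "{x \<in> space \<nu>. \<forall>i\<in>I. x i \<le> u i} \<in> events" for u
    using I by measurable
  have ev1: "{x \<in> space \<nu>. v i < x i \<and> x i \<le> u i} \<in> events" if "i \<in> I" for u v i
    using that by measurable
  have one: "C u \<le> C v + (\<Sum>i\<in>I. \<bar>u i - v i\<bar>)"
    if u: "\<And>i. i \<in> I \<Longrightarrow> u i \<in> {0..1}" and v: "\<And>i. i \<in> I \<Longrightarrow> v i \<in> {0..1}" for u v
  proof -
    let ?S = "\<lambda>i. {x \<in> space \<nu>. v i < x i \<and> x i \<le> u i}"
    have S: "prob (?S i) \<le> \<bar>u i - v i\<bar>" if i: "i \<in> I" for i
    proof (cases "v i \<le> u i")
      case True
      have "?S i = {x \<in> space \<nu>. x i \<le> u i} - {x \<in> space \<nu>. x i \<le> v i}" by auto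
      also have "prob \<dots> = prob {x \<in> space \<nu>. x i \<le> u i} - prob {x \<in> space \<nu>. x i \<le> v i}"
        using i True by (intro finite_measure_Diff) auto
      also have "\<dots> = u i - v i" using marg[OF i] u[OF i] v[OF i] by simp
      finally show ?thesis by simp
    next
      case False
      then have "?S i = {}" by auto
      then show ?thesis by (simp only:) simp
    qed
    have "C u = prob {x \<in> space \<nu>. \<forall>i\<in>I. x i \<le> u i}" using C_eq u by blast
    also have "\<dots> \<le> prob ({x \<in> space \<nu>. \<forall>i\<in>I. x i \<le> v i} \<union> (\<Union>i\<in>I. ?S i))"
      using ev ev1 I by (intro finite_measure_mono sets.Un sets.finite_UN) (auto simp: not_le)
    also have "\<dots> \<le> prob {x \<in> space \<nu>. \<forall>i\<in>I. x i \<le> v i} + prob (\<Union>i\<in>I. ?S i)"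
      using ev ev1 I by (intro measure_Un_le sets.finite_UN) auto
    also have "prob (\<Union>i\<in>I. ?S i) \<le> (\<Sum>i\<in>I. prob (?S i))"
      using ev1 I by (intro finite_measure_subadditive_finite) auto
    also have "\<dots> \<le> (\<Sum>i\<in>I. \<bar>u i - v i\<bar>)"
      using S by (intro sum_mono) auto
    also have "prob {x \<in> space \<nu>. \<forall>i\<in>I. x i \<le> v i} = C v" using C_eq v by simp
    finally show ?thesis by simp
  qed
  show ?thesis
    using one[of u v] one[of v u] u v by (auto simp: abs_le_iff abs_minus_commute)
qed

text \<open>A copula ignores the coordinates outside its index set, but only as long as the point lies in
  the unit cube.\<close>

lemma copula_cong:
  assumes C: "is_copula I C" and u: "\<And>i. i \<in> I \<Longrightarrow> u i \<in> {0..1}" and uv: "\<And>i. i \<in> I \<Longrightarrow> u i = v i"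
  shows "C u = C v"
proof -
  obtain \<nu> where C_eq: "\<And>u. (\<forall>i\<in>I. u i \<in> {0..1}) \<Longrightarrow> C u = \<P>(x in \<nu>. \<forall>i\<in>I. x i \<le> u i)"
    using C unfolding is_copula_def by blast
  have "(\<forall>i\<in>I. x i \<le> u i) \<longleftrightarrow> (\<forall>i\<in>I. x i \<le> v i)" for x
    using uv by auto
  moreover have "C v = \<P>(x in \<nu>. \<forall>i\<in>I. x i \<le> v i)" by (rule C_eq) (use u uv in auto)
  moreover have "C u = \<P>(x in \<nu>. \<forall>i\<in>I. x i \<le> u i)" by (rule C_eq) (use u in auto)
  ultimately show ?thesis by simp
qed

lemma copula_le_coordinate:
  assumes C: "is_copula I C" and I: "finite I"
    and u: "\<And>i. i \<in> I \<Longrightarrow> u i \<in> {0..1}" and i: "i \<in> I"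
  shows "0 \<le> C u" "C u \<le> u i"
proof -
  obtain \<nu> where "prob_space \<nu>" and S: "sets \<nu> = sets (Pi\<^sub>M I (\<lambda>_. borel))"
    and marg: "\<And>i t. i \<in> I \<Longrightarrow> t \<in> {0..1} \<Longrightarrow> \<P>(x in \<nu>. x i \<le> t) = t"
    and C_eq: "\<And>u. (\<forall>i\<in>I. u i \<in> {0..1}) \<Longrightarrow> C u = \<P>(x in \<nu>. \<forall>i\<in>I. x i \<le> u i)"
    using C unfolding is_copula_def by blast
  interpret prob_space \<nu> by fact
  have comp[measurable]: "(\<lambda>x. x i) \<in> borel_measurable \<nu>" if "i \<in> I" for i
    using that measurable_cong_sets[OF S refl] measurable_component_singleton[of i I "\<lambda>_. borel"] by blast
  have eq: "C u = prob {x \<in> space \<nu>. \<forall>i\<in>I. x i \<le> u i}" using C_eq u by blast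
  then show "0 \<le> C u" by simp
  have "C u \<le> prob {x \<in> space \<nu>. x i \<le> u i}"
    unfolding eq using i by (intro finite_measure_mono) auto
  also have "\<dots> = u i" using marg[OF i] u[OF i] by blast
  finally show "C u \<le> u i" .
qed

text \<open>In the defining limit of an MRV copula the point \<open>s * v\<close> may be replaced by one that agrees with
  it up to \<open>o(s)\<close>, since copulas are Lipschitz.\<close>

lemma copula_D_first_order:
  assumes C: "is_copula I C" and I: "finite I"
    and v: "\<And>i. i \<in> I \<Longrightarrow> 0 \<le> v i"
    and lim: "((\<lambda>s. inverse s * copula_D C (\<lambda>i. s * v i)) \<longlongrightarrow> l) (at_right 0)"
    and s: "filterlim s (at_right 0) F"
    and u01: "\<forall>\<^sub>F x in F. \<forall>i\<in>I. u x i \<in> {0..1}"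
    and u: "\<And>i. i \<in> I \<Longrightarrow> ((\<lambda>x. u x i / s x) \<longlongrightarrow> v i) F"
  shows "((\<lambda>x. copula_D C (u x) / s x) \<longlongrightarrow> l) F"
proof -
  have s0: "(s \<longlongrightarrow> 0) F" and spos: "\<forall>\<^sub>F x in F. 0 < s x"
    using s by (auto simp: filterlim_at elim: eventually_mono)
  have 1: "((\<lambda>x. inverse (s x) * copula_D C (\<lambda>i. s x * v i)) \<longlongrightarrow> l) F"
    using filterlim_compose[OF lim s] .
  have sv: "\<forall>\<^sub>F x in F. \<forall>i\<in>I. s x * v i \<in> {0..1}"
  proof (subst eventually_ball_finite_distrib[OF I], intro ballI)
    fix i assume "i \<in> I"
    have "((\<lambda>x. s x * v i) \<longlongrightarrow> 0) F" using tendsto_mult_left_zero[OF s0] .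
    then have "\<forall>\<^sub>F x in F. s x * v i < 1" by (rule order_tendstoD) simp
    then show "\<forall>\<^sub>F x in F. s x * v i \<in> {0..1}"
      using spos by eventually_elim (use v[OF \<open>i \<in> I\<close>] in auto)
  qed
  have "((\<lambda>x. \<Sum>i\<in>I. \<bar>u x i / s x - v i\<bar>) \<longlongrightarrow> (\<Sum>i\<in>I. 0)) F"
    by (intro tendsto_sum tendsto_rabs_zero LIM_zero u)
  then have 2: "((\<lambda>x. \<Sum>i\<in>I. \<bar>u x i / s x - v i\<bar>) \<longlongrightarrow> 0) F" by simp
  have "((\<lambda>x. copula_D C (u x) / s x - inverse (s x) * copula_D C (\<lambda>i. s x * v i)) \<longlongrightarrow> 0) F"
  proof (rule Lim_null_comparison[OF _ 2])
    show "\<forall>\<^sub>F x in F. norm (copula_D C (u x) / s x - inverse (s x) * copula_D C (\<lambda>i. s x * v i))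
      \<le> (\<Sum>i\<in>I. \<bar>u x i / s x - v i\<bar>)"
      using u01 sv spos
    proof eventually_elim
      case (elim x)
      have "\<bar>copula_D C (u x) - copula_D C (\<lambda>i. s x * v i)\<bar> \<le>
          (\<Sum>i\<in>I. \<bar>(1 - s x * v i) - (1 - u x i)\<bar>)"
        unfolding copula_D_def using elim
        by (intro order_trans[OF _ copula_lipschitz[OF C I]]) auto
      then have "\<bar>copula_D C (u x) - copula_D C (\<lambda>i. s x * v i)\<bar> / s x \<le>
          (\<Sum>i\<in>I. \<bar>u x i - s x * v i\<bar>) / s x"
        using elim by (intro divide_right_mono) auto
      also have "\<dots> = (\<Sum>i\<in>I. \<bar>u x i - s x * v i\<bar> / s x)"
        by (simp add: sum_divide_distrib)
      also have "\<dots> = (\<Sum>i\<in>I. \<bar>u x i / s x - v i\<bar>)"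
      proof (rule sum.cong)
        fix i
        have "u x i / s x - v i = (u x i - s x * v i) / s x" using elim by (simp add: field_simps)
        then show "\<bar>u x i - s x * v i\<bar> / s x = \<bar>u x i / s x - v i\<bar>" using elim by simp
      qed simp
      finally have *: "\<bar>copula_D C (u x) - copula_D C (\<lambda>i. s x * v i)\<bar> / s x \<le> (\<Sum>i\<in>I. \<bar>u x i / s x - v i\<bar>)" .
      have "copula_D C (u x) / s x - inverse (s x) * copula_D C (\<lambda>i. s x * v i) =
        (copula_D C (u x) - copula_D C (\<lambda>i. s x * v i)) / s x"
        by (simp add: diff_divide_distrib inverse_eq_divide)
      then show ?case using * elim by simp
    qed
  qed
  from tendsto_add[OF this 1] show ?thesis by simp
qed

text \<open>This links the two descriptions of the extremal behaviour of a copula: if \<open>l\<close> is the limit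
  function at \<open>v\<close>, then \<open>exp (- l)\<close> is the value of the limiting copula at \<open>exp (- v)\<close>.\<close>

lemma copula_powr_tendsto:
  assumes C: "is_copula I C" and I: "finite I"
    and v: "\<And>i. i \<in> I \<Longrightarrow> 0 \<le> v i"
    and lim: "((\<lambda>s. inverse s * copula_D C (\<lambda>i. s * v i)) \<longlongrightarrow> l) (at_right 0)"
  shows "((\<lambda>t. C (\<lambda>i. exp (- v i) powr (1 / t)) powr t) \<longlongrightarrow> exp (- l)) at_top"
proof -
  define u where "u t i = 1 - exp (- v i) powr (1 / t)" for t i
  define x where "x t = copula_D C (u t) / (1 / t)" for t
  have s: "filterlim (\<lambda>t::real. 1 / t) (at_right 0) at_top"
    using filterlim_inverse_at_right_top by (simp add: divide_inverse)
  have "(x \<longlongrightarrow> l) at_top"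
    unfolding x_def
  proof (rule copula_D_first_order[OF C I v lim s])
    show "\<forall>\<^sub>F t in at_top. \<forall>i\<in>I. u t i \<in> {0..1}"
      using eventually_gt_at_top[of 0]
      by eventually_elim (use v in \<open>auto simp: u_def powr_def field_simps\<close>)
    fix i assume "i \<in> I"
    have "((\<lambda>s. - exp (- s * v i)) has_real_derivative v i) (at 0)"
      by (auto intro!: derivative_eq_intros)
    then have "((\<lambda>h. (- exp (- h * v i) + 1) / h) \<longlongrightarrow> v i) (at 0)"
      by (simp add: DERIV_def)
    then have "((\<lambda>h. (- exp (- h * v i) + 1) / h) \<longlongrightarrow> v i) (at_right 0)"
      by (rule filterlim_mono[OF _ order_refl at_le]) simp
    from filterlim_compose[OF this s]
    show "((\<lambda>t. u t i / (1 / t)) \<longlongrightarrow> v i) at_top"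
      by (simp add: u_def powr_def)
  qed
  have s0: "((\<lambda>t::real. 1 / t) \<longlongrightarrow> 0) at_top"
    using s by (simp add: filterlim_at)
  have sx: "((\<lambda>t. x t * (1 / t)) \<longlongrightarrow> 0) at_top"
    using tendsto_mult[OF \<open>(x \<longlongrightarrow> l) at_top\<close> s0] by simp
  have C_eq: "C (\<lambda>i. exp (- v i) powr (1 / t)) = 1 - x t * (1 / t)" if "0 < t" for t
    using that by (simp add: x_def copula_D_def u_def)
  have small: "\<forall>\<^sub>F t in at_top. \<bar>x t * (1 / t)\<bar> < 1 / 2"
    using tendsto_rabs_zero[OF sx] by (rule order_tendstoD) simp
  have "((\<lambda>t. t * ln (1 - x t * (1 / t)) + x t) \<longlongrightarrow> 0) at_top"
  proof (rule Lim_null_comparison)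
    show "((\<lambda>t. 2 * (x t * (x t * (1 / t)))) \<longlongrightarrow> 0) at_top"
      by (rule tendsto_mult_right_zero) (use tendsto_mult[OF \<open>(x \<longlongrightarrow> l) at_top\<close> sx] in simp)
    show "\<forall>\<^sub>F t in at_top. norm (t * ln (1 - x t * (1 / t)) + x t) \<le> 2 * (x t * (x t * (1 / t)))"
      using small eventually_gt_at_top[of 0]
    proof eventually_elim
      case (elim t)
      let ?y = "- (x t * (1 / t))"
      have "\<bar>ln (1 + ?y) - ?y\<bar> \<le> 2 * ?y\<^sup>2"
        using elim by (intro abs_ln_one_plus_x_minus_x_bound) auto
      then have "t * \<bar>ln (1 + ?y) - ?y\<bar> \<le> t * (2 * ?y\<^sup>2)"
        using elim by (intro mult_left_mono) auto
      moreover have "t * \<bar>ln (1 + ?y) - ?y\<bar> = \<bar>t * ln (1 + ?y) - t * ?y\<bar>"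
        using elim by (simp only: right_diff_distrib[symmetric] abs_mult)
      ultimately show ?case using elim by (simp add: power2_eq_square)
    qed
  qed
  from tendsto_diff[OF this \<open>(x \<longlongrightarrow> l) at_top\<close>]
  have "((\<lambda>t. exp (t * ln (1 - x t * (1 / t)))) \<longlongrightarrow> exp (- l)) at_top"
    by (intro tendsto_exp) simp
  moreover have "\<forall>\<^sub>F t in at_top. exp (t * ln (1 - x t * (1 / t))) = C (\<lambda>i. exp (- v i) powr (1 / t)) powr t"
    using small eventually_gt_at_top[of 0]
  proof eventually_elim
    case (elim t)
    then show ?case using C_eq[of t] by (auto simp: powr_def)
  qed
  ultimately show ?thesis
    by (rule Lim_transform_eventually)
qed

text \<open>The product copula is the distribution function of independent uniform variables.\<close>

lemma is_copula_prod:
  assumes I: "finite I"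
  shows "is_copula I (\<lambda>u. \<Prod>i\<in>I. u i)"
proof -
  define U where "U = uniform_measure lborel {0..1::real}"
  interpret U: prob_space U unfolding U_def by (rule prob_space_uniform_measure) auto
  have [simp]: "space U = UNIV" "sets U = sets borel" by (simp_all add: U_def)
  have U: "measure U {..t} = t" if "t \<in> {0..1}" for t
  proof -
    have "{0..1} \<inter> {..t} = {0..t}" using that by auto
    then show ?thesis using that unfolding U_def by (subst measure_uniform_measure) auto
  qed
  interpret prod: product_sigma_finite "\<lambda>_. U" by standard
  interpret \<nu>: prob_space "Pi\<^sub>M I (\<lambda>_. U)" by (rule prob_space_PiM) unfold_locales
  have box: "measure (Pi\<^sub>M I (\<lambda>_. U)) {x \<in> space (Pi\<^sub>M I (\<lambda>_. U)). \<forall>i\<in>I. x i \<in> B i} = (\<Prod>i\<in>I. measure U (B i))"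
    if "\<And>i. i \<in> I \<Longrightarrow> B i \<in> sets borel" for B
  proof -
    have "{x \<in> space (Pi\<^sub>M I (\<lambda>_. U)). \<forall>i\<in>I. x i \<in> B i} = Pi\<^sub>E I B"
      by (auto simp: space_PiM PiE_def)
    moreover have "emeasure (Pi\<^sub>M I (\<lambda>_. U)) (Pi\<^sub>E I B) = ennreal (\<Prod>i\<in>I. measure U (B i))"
      using that I by (subst prod.emeasure_PiM) (auto simp: U.emeasure_eq_measure prod_ennreal)
    ultimately show ?thesis
      by (simp add: measure_def prod_nonneg)
  qed
  have joint: "measure (Pi\<^sub>M I (\<lambda>_. U)) {x \<in> space (Pi\<^sub>M I (\<lambda>_. U)). \<forall>i\<in>I. x i \<le> u i} = (\<Prod>i\<in>I. u i)"
    if "\<forall>i\<in>I. u i \<in> {0..1}" for u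
  proof -
    have "measure (Pi\<^sub>M I (\<lambda>_. U)) {x \<in> space (Pi\<^sub>M I (\<lambda>_. U)). \<forall>i\<in>I. x i \<le> u i} = (\<Prod>i\<in>I. measure U {..u i})"
      using box[of "\<lambda>i. {..u i}"] by (simp only: atMost_iff) simp
    also have "\<dots> = (\<Prod>i\<in>I. u i)" using U that by (intro prod.cong) blast+
    finally show ?thesis .
  qed
  have marg: "measure (Pi\<^sub>M I (\<lambda>_. U)) {x \<in> space (Pi\<^sub>M I (\<lambda>_. U)). x i \<le> t} = t"
    if i: "i \<in> I" and t: "t \<in> {0..1}" for i t
  proof -
    have "{x \<in> space (Pi\<^sub>M I (\<lambda>_. U)). x i \<le> t} =
        {x \<in> space (Pi\<^sub>M I (\<lambda>_. U)). \<forall>j\<in>I. x j \<in> (if j = i then {..t} else UNIV)}"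
      using i by auto
    then have "measure (Pi\<^sub>M I (\<lambda>_. U)) {x \<in> space (Pi\<^sub>M I (\<lambda>_. U)). x i \<le> t} =
        (\<Prod>j\<in>I. measure U (if j = i then {..t} else UNIV))"
      by (simp only: box) (rule box, simp)
    also have "\<dots> = (\<Prod>j\<in>I. if j = i then t else 1)"
      using U[OF t] U.prob_space by (intro prod.cong) auto
    also have "\<dots> = t" using i I by (simp add: prod.delta)
    finally show ?thesis .
  qed
  show ?thesis
    unfolding is_copula_def
  proof (intro exI conjI)
    show "prob_space (Pi\<^sub>M I (\<lambda>_. U))" by unfold_locales
    show "sets (Pi\<^sub>M I (\<lambda>_. U)) = sets (Pi\<^sub>M I (\<lambda>_. borel))" by (rule sets_PiM_cong) auto
  qed (use joint marg in auto)
qed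

lemma is_copula_restrict:
  assumes C: "is_copula J C" and J: "finite J" and I: "I \<subseteq> J"
  shows "is_copula I (\<lambda>u. C (\<lambda>i. if i \<in> I then u i else 1))"
proof -
  obtain \<nu> where "prob_space \<nu>" and S: "sets \<nu> = sets (Pi\<^sub>M J (\<lambda>_. borel))"
    and marg: "\<And>i t. i \<in> J \<Longrightarrow> t \<in> {0..1} \<Longrightarrow> \<P>(x in \<nu>. x i \<le> t) = t"
    and C_eq: "\<And>u. (\<forall>i\<in>J. u i \<in> {0..1}) \<Longrightarrow> C u = \<P>(x in \<nu>. \<forall>i\<in>J. x i \<le> u i)"
    using C unfolding is_copula_def by blast
  interpret prob_space \<nu> by fact
  have fI: "finite I" using I J finite_subset by blast
  have comp[measurable]: "(\<lambda>x. x i) \<in> borel_measurable \<nu>" if "i \<in> J" for i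
    using that measurable_cong_sets[OF S refl] measurable_component_singleton[of i J "\<lambda>_. borel"] by blast
  have r[measurable]: "(\<lambda>x. restrict x I) \<in> measurable \<nu> (Pi\<^sub>M I (\<lambda>_. borel))"
    using measurable_restrict_subset[OF I, of "\<lambda>_. borel"] measurable_cong_sets[OF S refl] by blast
  let ?\<nu> = "distr \<nu> (Pi\<^sub>M I (\<lambda>_. borel)) (\<lambda>x. restrict x I)"
  have comp'[measurable]: "(\<lambda>x. x i) \<in> borel_measurable (Pi\<^sub>M I (\<lambda>_. borel))" if "i \<in> I" for i
    using that by (rule measurable_component_singleton)
  have distr: "measure ?\<nu> {x \<in> space ?\<nu>. \<forall>i\<in>K. x i \<le> u i} = prob {x \<in> space \<nu>. \<forall>i\<in>K. x i \<le> u i}"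
    if "K \<subseteq> I" for K u
  proof -
    have K: "finite K" using that fI finite_subset by blast
    have "{x \<in> space (Pi\<^sub>M I (\<lambda>_. borel)). \<forall>i\<in>K. x i \<le> u i} \<in> sets (Pi\<^sub>M I (\<lambda>_. borel))"
      using that by (intro sets.sets_Collect_finite_All K) (auto intro!: borel_measurable_le comp')
    then have "measure ?\<nu> {x \<in> space ?\<nu>. \<forall>i\<in>K. x i \<le> u i} =
        prob ((\<lambda>x. restrict x I) -` {x \<in> space (Pi\<^sub>M I (\<lambda>_. borel)). \<forall>i\<in>K. x i \<le> u i} \<inter> space \<nu>)"
      by (subst measure_distr) auto
    also have "(\<lambda>x. restrict x I) -` {x \<in> space (Pi\<^sub>M I (\<lambda>_. borel)). \<forall>i\<in>K. x i \<le> u i} \<inter> space \<nu> =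
        {x \<in> space \<nu>. \<forall>i\<in>K. x i \<le> u i}"
      using that by (auto simp: space_PiM subset_iff)
    finally show ?thesis .
  qed
  have le1: "AE x in \<nu>. \<forall>i\<in>J. x i \<le> 1"
  proof (rule AE_finite_allI[OF J])
    fix i assume i: "i \<in> J"
    have "prob {x \<in> space \<nu>. x i \<le> 1} = 1" using marg[OF i, of 1] by simp
    then show "AE x in \<nu>. x i \<le> 1" using i by (subst (asm) prob_Collect_eq_1) auto
  qed
  show ?thesis
    unfolding is_copula_def
  proof (intro exI conjI ballI allI impI)
    show "prob_space ?\<nu>" by (rule prob_space_distr) measurable
    show "sets ?\<nu> = sets (Pi\<^sub>M I (\<lambda>_. borel))" by simp
    show "\<P>(x in ?\<nu>. x i \<le> t) = t" if "i \<in> I" "t \<in> {0..1}" for i t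
      using distr[of "{i}" "\<lambda>_. t"] marg[of i t] that I by auto
    fix u assume u: "\<forall>i\<in>I. u i \<in> {0..1::real}"
    have "C (\<lambda>i. if i \<in> I then u i else 1) = prob {x \<in> space \<nu>. \<forall>i\<in>J. x i \<le> (if i \<in> I then u i else 1)}"
      using u by (intro C_eq) auto
    also have "\<dots> = prob {x \<in> space \<nu>. \<forall>i\<in>I. x i \<le> u i}"
    proof (rule finite_measure_eq_AE)
      show "AE x in \<nu>. x \<in> {x \<in> space \<nu>. \<forall>i\<in>J. x i \<le> (if i \<in> I then u i else 1)} \<longleftrightarrow>
          x \<in> {x \<in> space \<nu>. \<forall>i\<in>I. x i \<le> u i}"
        using le1 by eventually_elim (use I in \<open>auto split: if_splits\<close>)
      show "{x \<in> space \<nu>. \<forall>i\<in>J. x i \<le> (if i \<in> I then u i else 1)} \<in> events"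
        by (intro sets.sets_Collect_finite_All J) auto
      show "{x \<in> space \<nu>. \<forall>i\<in>I. x i \<le> u i} \<in> events"
        using I by (intro sets.sets_Collect_finite_All fI) (auto intro!: borel_measurable_le comp)
    qed
    finally show "C (\<lambda>i. if i \<in> I then u i else 1) = \<P>(x in ?\<nu>. \<forall>i\<in>I. x i \<le> u i)"
      by (simp only: distr[OF order_refl])
  qed
qed

section \<open>Power sums\<close>

text \<open>The \<open>p\<close>-norm decreases in \<open>p\<close>; only the level 1 is needed, and there no root has to be taken.\<close>

lemma sum_powr_ge_1_antimono:
  fixes r :: "'i \<Rightarrow> real"
  assumes "finite I" "\<And>i. i \<in> I \<Longrightarrow> 0 \<le> r i" "0 < p" "p \<le> q" "1 \<le> (\<Sum>i\<in>I. r i powr q)"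
  shows "1 \<le> (\<Sum>i\<in>I. r i powr p)"
proof (cases "\<exists>i\<in>I. 1 \<le> r i")
  case True
  then obtain i where i: "i \<in> I" "1 \<le> r i" by auto
  have "1 \<le> r i powr p" using i assms by (intro ge_one_powr_ge_zero) auto
  also have "\<dots> \<le> (\<Sum>i\<in>I. r i powr p)"
    using i assms by (intro member_le_sum) auto
  finally show ?thesis .
next
  case False
  have "(\<Sum>i\<in>I. r i powr q) \<le> (\<Sum>i\<in>I. r i powr p)"
    using False assms by (intro sum_mono powr_mono') (auto simp: not_le intro: less_imp_le)
  then show ?thesis using assms by simp
qed

text \<open>One of \<open>y i\<close> and \<open>y j\<close> is at most 1/2, and replacing this one by its power gains at
  least the factor \<open>2 powr (1 - s)\<close>.\<close>

lemma sum_powr_concave_gap: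
  fixes y :: "'i \<Rightarrow> real"
  assumes I: "finite I" and y: "\<And>i. i \<in> I \<Longrightarrow> 0 \<le> y i" and sum: "(\<Sum>i\<in>I. y i) = 1"
    and ij: "i \<in> I" "j \<in> I" "i \<noteq> j" and \<eta>: "0 < \<eta>" "\<eta> \<le> y i" "\<eta> \<le> y j"
    and s: "0 < s" "s < 1"
  shows "1 + \<eta> * (2 powr (1 - s) - 1) \<le> (\<Sum>i\<in>I. y i powr s)"
proof -
  have le1: "y k \<le> 1" if "k \<in> I" for k
    using sum member_le_sum[OF that, of y] y I by auto
  have ge: "y k \<le> y k powr s" if "k \<in> I" for k
    using powr_mono'[of s 1 "y k"] s y[OF that] le1[OF that] by auto
  have "y i + y j \<le> 1"
  proof -
    have "(\<Sum>k\<in>{i, j}. y k) \<le> (\<Sum>k\<in>I. y k)"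
      using ij I y by (intro sum_mono2) auto
    then show ?thesis using ij sum by simp
  qed
  then obtain k where k: "k \<in> I" "\<eta> \<le> y k" "y k \<le> 1 / 2"
    using ij \<eta> by (cases "y i \<le> 1 / 2") auto
  have "2 powr (1 - s) = (1 / 2) powr (s - 1)"
    by (simp add: powr_divide powr_diff)
  also have "\<dots> \<le> y k powr (s - 1)"
    using k \<eta> s by (intro powr_mono2') auto
  finally have "2 powr (1 - s) * y k \<le> y k powr (s - 1) * y k powr 1"
    using k \<eta> by (intro mult_mono) auto
  also have "\<dots> = y k powr s"
    using k \<eta> powr_mult_base[of "y k" "s - 1"] by (simp add: mult.commute)
  finally have "y k * (2 powr (1 - s) - 1) \<le> y k powr s - y k"
    by (simp add: algebra_simps)
  moreover have "\<eta> * (2 powr (1 - s) - 1) \<le> y k * (2 powr (1 - s) - 1)"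
    using k s ge_one_powr_ge_zero[of 2 "1 - s"] by (intro mult_right_mono) auto
  ultimately have "\<eta> * (2 powr (1 - s) - 1) \<le> y k powr s - y k" by simp
  also have "\<dots> \<le> (\<Sum>k\<in>I. y k powr s - y k)"
    using k ge I by (intro member_le_sum) auto
  also have "\<dots> = (\<Sum>k\<in>I. y k powr s) - 1"
    by (simp add: sum_subtractf sum)
  finally show ?thesis by simp
qed

text \<open>A quantitative form of the strict decrease of \<open>p\<close>-norms: on vectors with two coordinates at least
  1 and with \<open>q\<close>-norm below \<open>K\<close>, the \<open>p\<close>-norm exceeds the \<open>q\<close>-norm at least by a factor \<open>\<rho> > 1\<close>
  that depends on \<open>p\<close>, \<open>q\<close> and \<open>K\<close> only.\<close>

lemma power_sum_gap:
  fixes p q K :: real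
  assumes p: "0 < p" "p < q" and K: "1 \<le> K"
  obtains \<rho> where "1 < \<rho>"
    "\<And>I (r :: 'i \<Rightarrow> real) i j. finite I \<Longrightarrow> (\<And>i. i \<in> I \<Longrightarrow> 0 \<le> r i) \<Longrightarrow> i \<in> I \<Longrightarrow> j \<in> I \<Longrightarrow> i \<noteq> j \<Longrightarrow>
       1 \<le> r i \<Longrightarrow> 1 \<le> r j \<Longrightarrow> (\<Sum>i\<in>I. r i powr q) < K powr q \<Longrightarrow>
       \<rho> powr p * (\<Sum>i\<in>I. r i powr q) powr (p / q) \<le> (\<Sum>i\<in>I. r i powr p)"
proof -
  define \<mu> where "\<mu> = 1 + K powr (- q) * (2 powr (1 - p / q) - 1)"
  have "1 < 2 powr (1 - p / q)" using p by (intro gr_one_powr) auto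
  then have \<mu>: "1 < \<mu>" using K by (auto simp: \<mu>_def)
  define \<rho> where "\<rho> = \<mu> powr (1 / p)"
  have \<rho>: "1 < \<rho>" "\<rho> powr p = \<mu>" using \<mu> p by (auto simp: \<rho>_def powr_powr intro!: gr_one_powr)
  show ?thesis
  proof
    show "1 < \<rho>" by fact
    fix I and r :: "'i \<Rightarrow> real" and i j
    assume I: "finite I" and r: "\<And>i. i \<in> I \<Longrightarrow> 0 \<le> r i" and ij: "i \<in> I" "j \<in> I" "i \<noteq> j"
      and r1: "1 \<le> r i" "1 \<le> r j" and SK: "(\<Sum>i\<in>I. r i powr q) < K powr q"
    let ?S = "\<Sum>i\<in>I. r i powr q"
    have "1 \<le> r i powr q" using r1 p by (intro ge_one_powr_ge_zero) auto
    also have "\<dots> \<le> ?S" using ij I by (intro member_le_sum) auto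
    finally have S: "1 \<le> ?S" .
    have low: "K powr (- q) \<le> r k powr q / ?S" if "1 \<le> r k" for k
    proof -
      have "1 / K powr q \<le> r k powr q / ?S"
        using S SK that p by (intro frac_le ge_one_powr_ge_zero) auto
      then show ?thesis by (simp add: powr_minus_divide)
    qed
    have "\<mu> \<le> (\<Sum>k\<in>I. (r k powr q / ?S) powr (p / q))"
      unfolding \<mu>_def
    proof (rule sum_powr_concave_gap[OF I _ _ ij])
      show "(\<Sum>k\<in>I. r k powr q / ?S) = 1"
        using S by (simp add: sum_divide_distrib[symmetric])
      show "0 < p / q" "p / q < 1" using p by auto
    qed (use S low r1 K in \<open>auto intro!: divide_nonneg_nonneg\<close>)
    also have "\<dots> = (\<Sum>k\<in>I. r k powr p / ?S powr (p / q))"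
      using S p r by (intro sum.cong) (auto simp: powr_divide powr_powr)
    also have "\<dots> = (\<Sum>k\<in>I. r k powr p) / ?S powr (p / q)"
      by (simp add: sum_divide_distrib)
    finally show "\<rho> powr p * ?S powr (p / q) \<le> (\<Sum>i\<in>I. r i powr p)"
      using S \<rho> by (simp add: pos_le_divide_eq)
  qed
qed

text \<open>The number of grid points below \<open>z\<close> determines \<open>z\<close> up to the mesh \<open>\<delta>\<close>, unless \<open>z\<close> lies beyond the
  whole grid.\<close>

lemma card_grid_below:
  fixes \<delta> z :: real and K :: nat
  assumes "0 < \<delta>" "0 < z"
  defines "N \<equiv> card {k \<in> {1..K}. real k * \<delta> < z}"
  shows "real N * \<delta> \<le> z" "z \<le> (real N + 1) * \<delta> \<or> N = K"
proof -
  define m where "m = nat (\<lceil>z / \<delta>\<rceil> - 1)"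
  have c: "1 \<le> \<lceil>z / \<delta>\<rceil>" using assms by (simp add: less_ceiling_iff[of 0, simplified] int_one_le_iff_zero_less)
  have "real k * \<delta> < z \<longleftrightarrow> k \<le> m" if "1 \<le> k" for k :: nat
  proof -
    have "real k * \<delta> < z \<longleftrightarrow> real_of_int (int k) < z / \<delta>" using assms by (simp add: pos_less_divide_eq)
    also have "\<dots> \<longleftrightarrow> int k < \<lceil>z / \<delta>\<rceil>" by (simp only: less_ceiling_iff)
    also have "\<dots> \<longleftrightarrow> k \<le> m" unfolding m_def using c by linarith
    finally show ?thesis .
  qed
  then have "{k \<in> {1..K}. real k * \<delta> < z} = {1..min K m}" by auto
  then have N: "N = min K m" by (simp add: N_def)
  have m: "real m = of_int \<lceil>z / \<delta>\<rceil> - 1" using c by (simp add: m_def)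
  have "real m \<le> z / \<delta>" "z / \<delta> \<le> real m + 1" using m by linarith+
  then have "real m * \<delta> \<le> z" "z \<le> (real m + 1) * \<delta>"
    using assms by (simp_all add: pos_le_divide_eq pos_divide_le_eq)
  moreover have "real N * \<delta> \<le> real m * \<delta>" using N assms by (intro mult_right_mono) auto
  ultimately show "real N * \<delta> \<le> z" "z \<le> (real N + 1) * \<delta> \<or> N = K"
    using N by (auto simp: min_def)
qed

section \<open>P-values with regularly varying tails and an MRV copula\<close>

text \<open>Random variables in the unit interval without atoms, whose distribution functions at zero are
  asymptotic to \<open>c i * g\<close> for a common regularly varying \<open>g\<close>, where some \<open>c i\<close> may vanish (then
  the function is \<open>o(g)\<close>), and such that the variables \<open>1 - P i\<close> have an MRV copula.\<close>

locale rv_pvalues = prob_space M for M :: "'a measure" +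
  fixes n :: nat and P :: "nat \<Rightarrow> 'a \<Rightarrow> real" and w :: "nat \<Rightarrow> real"
    and g :: "real \<Rightarrow> real" and \<beta> :: real and c :: "nat \<Rightarrow> real"
  assumes P_measurable[measurable]: "\<And>i. i \<in> {1..n} \<Longrightarrow> P i \<in> borel_measurable M"
    and P_01: "\<And>i x. i \<in> {1..n} \<Longrightarrow> x \<in> space M \<Longrightarrow> P i x \<in> {0..1}"
    and P_atomless: "\<And>i t. i \<in> {1..n} \<Longrightarrow> prob {x \<in> space M. P i x = t} = 0"
    and w_pos: "\<And>i. i \<in> {1..n} \<Longrightarrow> 0 < w i"
    and beta_pos: "0 < \<beta>"
    and g_rv: "reg_var0 \<beta> g" and g_null: "(g \<longlongrightarrow> 0) (at_right 0)"
    and tail: "\<And>i. i \<in> {1..n} \<Longrightarrow>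
      ((\<lambda>t. prob {x \<in> space M. P i x < t} / g t) \<longlongrightarrow> c i) (at_right 0)"
    and c_pos: "\<exists>i\<in>{1..n}. 0 < c i"
    and mrv: "has_mrv_copula M {1..n} (\<lambda>i x. 1 - P i x)"
begin

lemma g_pos: "0 < t \<Longrightarrow> 0 < g t"
  using g_rv by (simp add: reg_var0_def)

lemma g_filterlim: "filterlim g (at_right 0) (at_right 0)"
proof -
  have "\<forall>\<^sub>F t in at_right 0. g t \<in> {0<..} \<and> g t \<noteq> 0"
    using eventually_at_right_less[of "0::real"]
  proof eventually_elim
    case (elim t)
    then show ?case using g_pos[of t] by simp
  qed
  then show ?thesis using g_null by (simp add: filterlim_at)
qed

lemma c_nonneg: "i \<in> {1..n} \<Longrightarrow> 0 \<le> c i"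
proof (rule tendsto_lowerbound[OF tail])
  show "\<forall>\<^sub>F t in at_right 0. 0 \<le> prob {x \<in> space M. P i x < t} / g t"
    using eventually_at_right_less[of "0::real"]
  proof eventually_elim
    case (elim t)
    then show ?case using g_pos[of t] by simp
  qed
qed auto

lemma prob_le_eq_less:
  assumes "i \<in> {1..n}"
  shows "prob {x \<in> space M. P i x \<le> t} = prob {x \<in> space M. P i x < t}"
proof -
  have "{x \<in> space M. P i x \<le> t} = {x \<in> space M. P i x < t} \<union> {x \<in> space M. P i x = t}" by auto
  also have "prob \<dots> = prob {x \<in> space M. P i x < t} + prob {x \<in> space M. P i x = t}"
    using assms by (intro finite_measure_Union) auto
  finally show ?thesis using P_atomless[OF assms] by simp
qed

lemma AE_P_pos: "AE x in M. \<forall>i\<in>{1..n}. 0 < P i x"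
proof (rule AE_finite_allI)
  fix i assume i: "i \<in> {1..n}"
  have "AE x in M. x \<notin> {x \<in> space M. P i x = 0}"
    using P_atomless[OF i, of 0] i by (subst AE_iff_measurable[OF _ refl]) (auto simp: emeasure_eq_measure)
  then show "AE x in M. 0 < P i x"
    using AE_space by eventually_elim (use P_01[OF i] in \<open>auto simp: less_le\<close>)
qed simp

lemma tail_scaled:
  assumes i: "i \<in> {1..n}" and b: "0 \<le> b"
  shows "((\<lambda>t. prob {x \<in> space M. P i x < b * t} / g t) \<longlongrightarrow> c i * b powr \<beta>) (at_right 0)"
proof (cases "b = 0")
  case True
  have "{x \<in> space M. P i x < 0} = {}" using P_01[OF i] by force
  then have "prob {x \<in> space M. P i x < 0} = 0" by (simp only: measure_empty)
  then show ?thesis using True by simp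
next
  case False
  then show ?thesis using reg_var0_ratio_scale[OF g_rv tail[OF i], of b] b by simp
qed

text \<open>The event is the complement of a lower orthant for the variables \<open>1 - P i\<close>, so its
  probability is a value of \<open>copula_D\<close>.\<close>

lemma union_tail:
  assumes I: "I \<subseteq> {1..n}" and C: "is_copula_of M I (\<lambda>i x. 1 - P i x) C"
    and b: "\<And>i. i \<in> I \<Longrightarrow> 0 \<le> b i"
    and lim: "((\<lambda>s. inverse s * copula_D C (\<lambda>i. s * (c i * b i powr \<beta>))) \<longlongrightarrow> l) (at_right 0)"
  shows "((\<lambda>t. prob {x \<in> space M. \<exists>i\<in>I. P i x < b i * t} / g t) \<longlongrightarrow> l) (at_right 0)"
proof -
  have fI: "finite I" using I finite_subset by blast
  have cop: "is_copula I C" using C by (simp add: is_copula_of_def)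
  let ?u = "\<lambda>t i. prob {x \<in> space M. P i x < b i * t}"
  have ev: "{x \<in> space M. P i x < a} \<in> events" if "i \<in> I" for i a
  proof -
    have [measurable]: "P i \<in> borel_measurable M" using that I by (intro P_measurable) auto
    show ?thesis by measurable
  qed
  have "((\<lambda>t. copula_D C (?u t) / g t) \<longlongrightarrow> l) (at_right 0)"
  proof (rule copula_D_first_order[OF cop fI _ lim g_filterlim])
    show "0 \<le> c i * b i powr \<beta>" if "i \<in> I" for i using c_nonneg that I by auto
    show "((\<lambda>t. ?u t i / g t) \<longlongrightarrow> c i * b i powr \<beta>) (at_right 0)" if "i \<in> I" for i
      using tail_scaled b that I by blast
  qed auto
  moreover have "copula_D C (?u t) = prob {x \<in> space M. \<exists>i\<in>I. P i x < b i * t}" for t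
  proof -
    have compl: "prob {x \<in> space M. 1 - P i x \<le> 1 - b i * t} = 1 - ?u t i" if "i \<in> I" for i
    proof -
      have "{x \<in> space M. 1 - P i x \<le> 1 - b i * t} = space M - {x \<in> space M. P i x < b i * t}" by auto
      then show ?thesis using ev[OF that] by (simp add: prob_compl)
    qed
    have "C (\<lambda>i. 1 - ?u t i) = C (\<lambda>i. prob {x \<in> space M. 1 - P i x \<le> 1 - b i * t})"
      by (rule copula_cong[OF cop]) (use compl in auto)
    also have "\<dots> = prob {x \<in> space M. \<forall>i\<in>I. 1 - P i x \<le> 1 - b i * t}"
    proof -
      have "\<forall>y. prob {x \<in> space M. \<forall>i\<in>I. 1 - P i x \<le> y i} = C (\<lambda>i. prob {x \<in> space M. 1 - P i x \<le> y i})"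
        using C unfolding is_copula_of_def by simp
      from this[rule_format, of "\<lambda>i. 1 - b i * t"] show ?thesis by simp
    qed
    also have "{x \<in> space M. \<forall>i\<in>I. 1 - P i x \<le> 1 - b i * t} = space M - {x \<in> space M. \<exists>i\<in>I. P i x < b i * t}"
      by (auto simp: not_less)
    also have "prob \<dots> = 1 - prob {x \<in> space M. \<exists>i\<in>I. P i x < b i * t}"
    proof (rule prob_compl)
      show "{x \<in> space M. \<exists>i\<in>I. P i x < b i * t} \<in> events"
        using ev fI by (intro sets.sets_Collect_finite_Ex) auto
    qed
    finally show ?thesis by (simp add: copula_D_def)
  qed
  ultimately show ?thesis by simp
qed

text \<open>Here several thresholds for the same p-value are allowed; in a union only the largest one counts,
  and a p-value without threshold gets the threshold 0.\<close>

lemma union_convergent: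
  assumes K: "finite K" and idx: "\<And>k. k \<in> K \<Longrightarrow> idx k \<in> {1..n}" and \<tau>: "\<And>k. k \<in> K \<Longrightarrow> 0 \<le> \<tau> k"
  shows "\<exists>L. ((\<lambda>t. prob (\<Union>k\<in>K. {x \<in> space M. P (idx k) x < \<tau> k * t}) / g t) \<longlongrightarrow> L) (at_right 0)"
proof -
  obtain C l where C: "is_copula_of M {1..n} (\<lambda>i x. 1 - P i x) C" 
    and l: "\<And>v. (\<forall>i\<in>{1..n}. 0 \<le> v i) \<Longrightarrow>
        ((\<lambda>s. inverse s * copula_D C (\<lambda>i. s * v i)) \<longlongrightarrow> l v) (at_right 0)"
    using mrv unfolding has_mrv_copula_def mrv_copula_def by blast
  define b where "b i = Max (insert 0 (\<tau> ` {k \<in> K. idx k = i}))" for i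
  have b0: "0 \<le> b i" for i using K by (auto simp: b_def)
  have *: "((\<lambda>t. prob {x \<in> space M. \<exists>i\<in>{1..n}. P i x < b i * t} / g t) \<longlongrightarrow> l (\<lambda>i. c i * b i powr \<beta>)) (at_right 0)"
    using c_nonneg b0 by (intro union_tail[OF order_refl C] l) auto
  have eq: "\<forall>\<^sub>F t in at_right 0. prob {x \<in> space M. \<exists>i\<in>{1..n}. P i x < b i * t} / g t =
      prob (\<Union>k\<in>K. {x \<in> space M. P (idx k) x < \<tau> k * t}) / g t"
    using eventually_at_right_less[of "0::real"]
  proof eventually_elim
    case (elim t)
    have "{x \<in> space M. \<exists>i\<in>{1..n}. P i x < b i * t} = (\<Union>k\<in>K. {x \<in> space M. P (idx k) x < \<tau> k * t})"
    proof (safe, goal_cases)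
      case (1 x i)
      then have "0 \<le> P i x" using P_01[of i x] by auto
      then have "0 < b i" using 1 elim by (metis le_less_trans zero_less_mult_pos2)
      moreover have "b i \<in> insert 0 (\<tau> ` {k \<in> K. idx k = i})"
        unfolding b_def using K by (intro Max_in) auto
      ultimately show ?case using 1 by auto
    next
      case (2 x k)
      have "\<tau> k \<le> b (idx k)" unfolding b_def using K 2 by (intro Max_ge) auto
      then have "\<tau> k * t \<le> b (idx k) * t" using elim by (intro mult_right_mono) auto
      then show ?case using 2 idx[of k] by (intro bexI[of _ "idx k"]) auto
    qed
    then show ?case by simp
  qed
  show ?thesis using Lim_transform_eventually[OF * eq] by blast
qed

text \<open>The homogeneous functional that approximates the combination statistic, at level \<open>t\<close>. A vanishing
  p-value contributes 0, by the convention for division by zero; this happens with probability 0.\<close>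

definition ratio_sum :: "real \<Rightarrow> real \<Rightarrow> 'a \<Rightarrow> real" where
  "ratio_sum \<gamma> t x = (\<Sum>i=1..n. (t * (w i / P i x)) powr (1 / \<gamma>))"

text \<open>The probability that the homogeneous functional reaches 1; up to factors close to 1 in the
  argument, \<open>sum_tail \<gamma> t\<close> is the power of the test at level \<open>n * t\<close>.\<close>

definition sum_tail :: "real \<Rightarrow> real \<Rightarrow> real" where
  "sum_tail \<gamma> t = prob {x \<in> space M. 1 \<le> ratio_sum \<gamma> t x}"

lemma ratio_sum_measurable[measurable]: "ratio_sum \<gamma> t \<in> borel_measurable M"
  unfolding ratio_sum_def by measurable

lemma ratio_nonneg: "i \<in> {1..n} \<Longrightarrow> x \<in> space M \<Longrightarrow> 0 \<le> w i / P i x"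
  using w_pos[of i] P_01[of i x] by auto

lemma ratio_sum_scale: 
  assumes "0 \<le> b" "0 \<le> t" "x \<in> space M"
  shows "ratio_sum \<gamma> (b * t) x = b powr (1 / \<gamma>) * ratio_sum \<gamma> t x"
  unfolding ratio_sum_def sum_distrib_left
proof (rule sum.cong)
  fix i assume "i \<in> {1..n}"
  then show "(b * t * (w i / P i x)) powr (1 / \<gamma>) = b powr (1 / \<gamma>) * (t * (w i / P i x)) powr (1 / \<gamma>)"
    using ratio_nonneg[of i x] assms by (subst powr_mult[symmetric]) (auto simp: mult.assoc)
qed simp

lemma threshold_iff:
  assumes "0 < \<gamma>" "0 < t" "0 < s" "i \<in> {1..n}" "0 < P i x"
  shows "s < (t * (w i / P i x)) powr (1 / \<gamma>) \<longleftrightarrow> P i x < w i / s powr \<gamma> * t"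
    and "s \<le> (t * (w i / P i x)) powr (1 / \<gamma>) \<longleftrightarrow> P i x \<le> w i / s powr \<gamma> * t"
proof -
  let ?r = "t * (w i / P i x)"
  have r: "0 < ?r" using assms w_pos[of i] by auto
  have s: "(s powr \<gamma>) powr (1 / \<gamma>) = s" using assms by (simp add: powr_powr)
  have mono: "x powr (1 / \<gamma>) < y powr (1 / \<gamma>) \<longleftrightarrow> x < y" if "0 < x" "0 < y" for x y :: real
    using powr_less_mono2[of "1 / \<gamma>" x y] powr_mono2[of "1 / \<gamma>" y x] that assms
    by (cases "x < y") auto
  have less: "s < ?r powr (1 / \<gamma>) \<longleftrightarrow> s powr \<gamma> < ?r"
    using mono[of "s powr \<gamma>" ?r] r assms unfolding s by simp
  note less
  also have "\<dots> \<longleftrightarrow> P i x < w i / s powr \<gamma> * t" using assms by (simp add: field_simps)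
  finally show "s < ?r powr (1 / \<gamma>) \<longleftrightarrow> P i x < w i / s powr \<gamma> * t" .
  have "s \<le> ?r powr (1 / \<gamma>) \<longleftrightarrow> s powr \<gamma> \<le> ?r"
    using mono[of ?r "s powr \<gamma>"] r assms unfolding s by (simp only: not_less[symmetric]) simp
  also have "\<dots> \<longleftrightarrow> P i x \<le> w i / s powr \<gamma> * t" using assms by (simp add: field_simps)
  finally show "s \<le> ?r powr (1 / \<gamma>) \<longleftrightarrow> P i x \<le> w i / s powr \<gamma> * t" .
qed

text \<open>Each summand is rounded up to the grid with mesh \<open>\<delta>\<close>. This increases the sum by at most \<open>n * \<delta>\<close>,
  and the sum is homogeneous in \<open>t\<close>, so the rounded event at level \<open>t\<close> is contained in the original
  event at level \<open>\<theta> * t\<close>.\<close>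

lemma sum_tail_convergent:
  assumes \<gamma>: "0 < \<gamma>"
  shows "\<exists>L. ((\<lambda>t. sum_tail \<gamma> t / g t) \<longlongrightarrow> L) (at_right 0)"
proof (rule reg_var0_convergence_by_approximation[OF g_rv])
  fix \<theta> :: real assume \<theta>: "1 < \<theta>"
  have n: "0 < n" using c_pos by auto
  \<comment> \<open>the total rounding error \<open>n * \<delta>\<close> is what the passage from \<open>t\<close> to \<open>\<theta> * t\<close> makes up for\<close>
  define \<delta> where "\<delta> = (1 - \<theta> powr (- (1 / \<gamma>))) / n"
  have "\<theta> powr (- (1 / \<gamma>)) < 1" using \<theta> \<gamma> by (simp add: powr_less_one)
  then have \<delta>: "0 < \<delta>" using n by (simp add: \<delta>_def)
  have n\<delta>: "real n * \<delta> = 1 - \<theta> powr (- (1 / \<gamma>))" using n by (simp add: \<delta>_def)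
  \<comment> \<open>a summand beyond the last grid point exceeds 1 by itself\<close>
  obtain K :: nat where K: "1 \<le> real K * \<delta>" 
    using reals_Archimedean3[OF \<delta>] by (meson less_imp_le)
  define E where "E = (\<lambda>(i, k) t. {x \<in> space M. P i x < w i / (real k * \<delta>) powr \<gamma> * t})"
  define up where "up T i = \<delta> * (1 + real (card {k. (i, k) \<in> T}))" for T :: "(nat \<times> nat) set" and i
  define \<phi> where "\<phi> T \<longleftrightarrow> 1 \<le> (\<Sum>i=1..n. up T i)" for T
  define S where "S = {1..n} \<times> {1..K}"
  define B where "B t = prob {\<omega> \<in> space M. \<phi> {k \<in> S. \<omega> \<in> E k t}}" for t
  have ev: "E k t \<in> events" if kS: "k \<in> S" for k t
  proof -
    obtain i j where k: "k = (i, j)" "i \<in> {1..n}" using kS by (cases k) (auto simp: S_def)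
    then show ?thesis by (simp add: E_def)
  qed
  have "\<exists>L. ((\<lambda>t. B t / g t) \<longlongrightarrow> L) (at_right 0)"
    unfolding B_def
  proof (rule prob_boolean_combination_convergent)
    show "finite S" by (simp add: S_def)
    show "E k t \<in> events" if "k \<in> S" for k t by (rule ev[OF that])
    show "\<not> \<phi> {}" using n\<delta> \<theta> by (simp add: \<phi>_def up_def)
    fix K' assume K': "K' \<subseteq> S"
    have "\<exists>L. ((\<lambda>t. prob (\<Union>k\<in>K'. {x \<in> space M. P (fst k) x < w (fst k) / (real (snd k) * \<delta>) powr \<gamma> * t}) / g t)
       \<longlongrightarrow> L) (at_right 0)"
    proof (rule union_convergent)
      show "finite K'" using K' by (auto simp: S_def intro: finite_subset)
      show "fst k \<in> {1..n}" if "k \<in> K'" for k using that K' by (auto simp: S_def)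
      show "0 \<le> w (fst k) / (real (snd k) * \<delta>) powr \<gamma>" if "k \<in> K'" for k
        using that K' w_pos[of "fst k"] by (auto simp: S_def)
    qed
    then show "\<exists>L. ((\<lambda>t. prob (\<Union>k\<in>K'. E k t) / g t) \<longlongrightarrow> L) (at_right 0)"
      by (simp add: E_def case_prod_beta)
  qed
  then obtain L where L: "((\<lambda>t. B t / g t) \<longlongrightarrow> L) (at_right 0)" ..
  have "\<forall>\<^sub>F t in at_right 0. 0 \<le> sum_tail \<gamma> t \<and> sum_tail \<gamma> t \<le> B t \<and> B t \<le> sum_tail \<gamma> (\<theta> * t)"
    using eventually_at_right_less[of "0::real"]
  proof eventually_elim
    case (elim t)
    let ?T = "\<lambda>x. {k \<in> S. x \<in> E k t}"
    let ?z = "\<lambda>i x. (t * (w i / P i x)) powr (1 / \<gamma>)"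
    have upT: "?z i x \<le> up (?T x) i \<or> 1 \<le> up (?T x) i" "up (?T x) i \<le> ?z i x + \<delta>"
      if x: "x \<in> space M" "\<forall>i\<in>{1..n}. 0 < P i x" and i: "i \<in> {1..n}" for x i
    proof -
      let ?N = "card {k \<in> {1..K}. real k * \<delta> < ?z i x}"
      have Pi: "0 < P i x" using x i by blast
      have z: "0 < ?z i x" using elim w_pos[OF i] Pi by auto
      have "{k. (i, k) \<in> ?T x} = {k \<in> {1..K}. real k * \<delta> < ?z i x}"
        using threshold_iff(1)[OF \<gamma> elim _ i Pi] \<delta> x i by (auto simp: S_def E_def)
      then have up: "up (?T x) i = \<delta> * (1 + real ?N)" by (simp add: up_def)
      show "up (?T x) i \<le> ?z i x + \<delta>"
        using card_grid_below(1)[OF \<delta> z, of K] unfolding up by (simp add: algebra_simps)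
      show "?z i x \<le> up (?T x) i \<or> 1 \<le> up (?T x) i"
        using card_grid_below(2)[OF \<delta> z, of K] K \<delta> unfolding up by (auto simp: algebra_simps)
    qed
    have m: "{\<omega> \<in> space M. \<phi> (?T \<omega>)} \<in> events"
    proof -
      have "{\<omega> \<in> space M. \<phi> (?T \<omega>)} =
        (\<Union>T\<in>{T. T \<subseteq> S \<and> \<phi> T}. {\<omega> \<in> space M. \<forall>k\<in>S. \<omega> \<in> E k t \<longleftrightarrow> k \<in> T})"
      proof safe
        fix \<omega> assume "\<omega> \<in> space M" "\<phi> (?T \<omega>)"
        then show "\<omega> \<in> (\<Union>T\<in>{T. T \<subseteq> S \<and> \<phi> T}. {\<omega> \<in> space M. \<forall>k\<in>S. \<omega> \<in> E k t \<longleftrightarrow> k \<in> T})"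
          by (intro UN_I[of "?T \<omega>"]) auto
      next
        fix \<omega> T assume "T \<subseteq> S" "\<phi> T" "\<forall>k\<in>S. \<omega> \<in> E k t \<longleftrightarrow> k \<in> T"
        moreover from this have "?T \<omega> = T" by auto
        ultimately show "\<phi> (?T \<omega>)" by simp
      qed
      also have "\<dots> \<in> events"
      proof (intro sets.finite_UN sets.sets_Collect_finite_All)
        fix T k assume "k \<in> S"
        then have [measurable]: "E k t \<in> events" by (rule ev)
        show "{\<omega> \<in> space M. (\<omega> \<in> E k t) = (k \<in> T)} \<in> events" by measurable
      qed (auto simp: S_def)
      finally show ?thesis .
    qed
    have "sum_tail \<gamma> t \<le> B t"
      unfolding sum_tail_def B_def
    proof (rule finite_measure_mono_AE[OF _ m])
      show "AE x in M. x \<in> {x \<in> space M. 1 \<le> ratio_sum \<gamma> t x} \<longrightarrow> x \<in> {\<omega> \<in> space M. \<phi> (?T \<omega>)}"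
        using AE_P_pos AE_space
      proof eventually_elim
        case (elim x)
        note x = elim(2,1)
        have nn: "0 \<le> up (?T x) i" for i using \<delta> by (simp add: up_def)
        have "\<phi> (?T x)" if "1 \<le> ratio_sum \<gamma> t x"
        proof (cases "\<exists>i\<in>{1..n}. 1 \<le> up (?T x) i")
          case True
          then obtain i where i: "i \<in> {1..n}" "1 \<le> up (?T x) i" by auto
          have "up (?T x) i \<le> (\<Sum>i=1..n. up (?T x) i)"
            using i nn by (intro member_le_sum) auto
          then show ?thesis using i by (simp add: \<phi>_def)
        next
          case False
          have "(\<Sum>i=1..n. ?z i x) \<le> (\<Sum>i=1..n. up (?T x) i)"
            using upT(1)[OF x] False by (intro sum_mono) auto
          then show ?thesis using that by (simp add: \<phi>_def ratio_sum_def)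
        qed
        then show ?case using x by auto
      qed
    qed
    moreover have "B t \<le> sum_tail \<gamma> (\<theta> * t)"
      unfolding sum_tail_def B_def
    proof (rule finite_measure_mono_AE)
      show "AE x in M. x \<in> {\<omega> \<in> space M. \<phi> (?T \<omega>)} \<longrightarrow> x \<in> {x \<in> space M. 1 \<le> ratio_sum \<gamma> (\<theta> * t) x}"
        using AE_P_pos AE_space
      proof eventually_elim
        case (elim x)
        note x = elim(2,1)
        have "1 \<le> ratio_sum \<gamma> (\<theta> * t) x" if "\<phi> (?T x)"
        proof -
          have "1 \<le> (\<Sum>i=1..n. up (?T x) i)" using that by (simp add: \<phi>_def)
          also have "\<dots> \<le> (\<Sum>i=1..n. ?z i x + \<delta>)"
            using upT(2)[OF x] by (intro sum_mono) auto
          also have "\<dots> = ratio_sum \<gamma> t x + real n * \<delta>" by (simp add: sum.distrib ratio_sum_def)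
          finally have "\<theta> powr (- (1 / \<gamma>)) \<le> ratio_sum \<gamma> t x" using n\<delta> by simp
          then have "\<theta> powr (1 / \<gamma>) * \<theta> powr (- (1 / \<gamma>)) \<le> \<theta> powr (1 / \<gamma>) * ratio_sum \<gamma> t x"
            by (intro mult_left_mono) auto
          then show ?thesis
            using ratio_sum_scale[of \<theta> t x \<gamma>] \<theta> \<open>0 < t\<close> x by (simp add: powr_add[symmetric])
        qed
        then show ?case using x by auto
      qed
    qed measurable
    ultimately show ?case by (simp add: sum_tail_def)
  qed
  with L show "\<exists>B L. ((\<lambda>t. B t / g t) \<longlongrightarrow> L) (at_right 0) \<and>
     (\<forall>\<^sub>F t in at_right 0. 0 \<le> sum_tail \<gamma> t \<and> sum_tail \<gamma> t \<le> B t \<and> B t \<le> sum_tail \<gamma> (\<theta> * t))" by blast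
qed

section \<open>Dependence of the limit on the tail index\<close>

text \<open>The numerator of the limiting scaled power; meaningful for \<open>\<gamma> > 0\<close>, where the limit exists.\<close>

definition power_limit :: "real \<Rightarrow> real" where
  "power_limit \<gamma> = Lim (at_right 0) (\<lambda>t. sum_tail \<gamma> t / g t)"

lemma sum_tail_tendsto: "0 < \<gamma> \<Longrightarrow> ((\<lambda>t. sum_tail \<gamma> t / g t) \<longlongrightarrow> power_limit \<gamma>) (at_right 0)"
  using sum_tail_convergent[of \<gamma>] unfolding power_limit_def by (metis tendsto_Lim trivial_limit_at_right_real)

text \<open>The denominator of the scaled power at level \<open>n * t\<close>.\<close>

definition total_tail :: "real \<Rightarrow> real" where
  "total_tail t = (\<Sum>i=1..n. prob {x \<in> space M. P i x \<le> w i * t})"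

text \<open>The limit of \<open>total_tail\<close> relative to \<open>g\<close>.\<close>

definition total_limit :: real where
  "total_limit = (\<Sum>i=1..n. c i * w i powr \<beta>)"

lemma total_tail_tendsto: "((\<lambda>t. total_tail t / g t) \<longlongrightarrow> total_limit) (at_right 0)"
proof -
  have "((\<lambda>t. \<Sum>i=1..n. prob {x \<in> space M. P i x < w i * t} / g t) \<longlongrightarrow> total_limit) (at_right 0)"
    unfolding total_limit_def using w_pos by (intro tendsto_sum tail_scaled) (auto intro: less_imp_le)
  then show ?thesis by (simp add: total_tail_def sum_divide_distrib prob_le_eq_less)
qed

lemma total_limit_pos: "0 < total_limit"
proof -
  obtain i where i: "i \<in> {1..n}" "0 < c i" using c_pos by auto
  have "0 < c i * w i powr \<beta>" using i w_pos[of i] by auto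
  also have "\<dots> \<le> total_limit"
    unfolding total_limit_def using i c_nonneg by (intro member_le_sum) auto
  finally show ?thesis .
qed

lemma sum_tail_mono:
  assumes "0 < \<gamma>\<^sub>2" "\<gamma>\<^sub>2 \<le> \<gamma>\<^sub>1" "0 \<le> t"
  shows "sum_tail \<gamma>\<^sub>2 t \<le> sum_tail \<gamma>\<^sub>1 t"
  unfolding sum_tail_def
proof (rule finite_measure_mono)
  show "{x \<in> space M. 1 \<le> ratio_sum \<gamma>\<^sub>2 t x} \<subseteq> {x \<in> space M. 1 \<le> ratio_sum \<gamma>\<^sub>1 t x}"
    unfolding ratio_sum_def using assms ratio_nonneg
    by (auto intro!: sum_powr_ge_1_antimono[where p = "1 / \<gamma>\<^sub>1" and q = "1 / \<gamma>\<^sub>2"] mult_nonneg_nonneg divide_left_mono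
        simp del: times_divide_eq_right)
qed measurable

lemma power_limit_mono:
  assumes "0 < \<gamma>\<^sub>2" "\<gamma>\<^sub>2 \<le> \<gamma>\<^sub>1"
  shows "power_limit \<gamma>\<^sub>2 \<le> power_limit \<gamma>\<^sub>1"
proof (rule tendsto_le[OF _ sum_tail_tendsto sum_tail_tendsto])
  show "\<forall>\<^sub>F t in at_right 0. sum_tail \<gamma>\<^sub>2 t / g t \<le> sum_tail \<gamma>\<^sub>1 t / g t"
    using eventually_at_right_less[of "0::real"]
  proof eventually_elim
    case (elim t)
    then show ?case using sum_tail_mono[OF assms, of t] g_pos[of t] by (intro divide_right_mono) auto
  qed
qed (use assms in auto)

text \<open>The probability that two p-values are simultaneously of order \<open>t\<close>.\<close>

definition joint_tail :: "nat \<Rightarrow> nat \<Rightarrow> real \<Rightarrow> real \<Rightarrow> real \<Rightarrow> real" where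
  "joint_tail i j b b' t = prob {x \<in> space M. P i x < b * t \<and> P j x < b' * t}"

lemma joint_tail_eq:
  assumes "i \<in> {1..n}" "j \<in> {1..n}"
  shows "joint_tail i j b b' t = prob {x \<in> space M. P i x < b * t} + prob {x \<in> space M. P j x < b' * t}
     - prob ({x \<in> space M. P i x < b * t} \<union> {x \<in> space M. P j x < b' * t})"
proof -
  have [measurable]: "P i \<in> borel_measurable M" "P j \<in> borel_measurable M" using assms by auto
  have "{x \<in> space M. P i x < b * t \<and> P j x < b' * t} =
      {x \<in> space M. P i x < b * t} \<inter> {x \<in> space M. P j x < b' * t}" by auto
  moreover have "prob ({x \<in> space M. P i x < b * t} \<union> {x \<in> space M. P j x < b' * t}) =
    prob {x \<in> space M. P i x < b * t} + prob {x \<in> space M. P j x < b' * t} -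
    prob ({x \<in> space M. P i x < b * t} \<inter> {x \<in> space M. P j x < b' * t})"
    by (intro measure_Un3) (auto simp: fmeasurable_eq_sets)
  ultimately show ?thesis by (simp add: joint_tail_def)
qed

lemma joint_tail_convergent:
  assumes i: "i \<in> {1..n}" and j: "j \<in> {1..n}" and b: "0 \<le> b" "0 \<le> b'"
  shows "\<exists>L. ((\<lambda>t. joint_tail i j b b' t / g t) \<longlongrightarrow> L) (at_right 0)"
proof -
  have "\<exists>L. ((\<lambda>t. prob (\<Union>k\<in>(UNIV :: bool set).
      {x \<in> space M. P (if k then i else j) x < (if k then b else b') * t}) / g t) \<longlongrightarrow> L) (at_right 0)"
    using assms by (intro union_convergent) auto
  then obtain L where L: "((\<lambda>t. prob ({x \<in> space M. P i x < b * t} \<union> {x \<in> space M. P j x < b' * t}) / g t)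
      \<longlongrightarrow> L) (at_right 0)"
    by (auto simp: UNIV_bool Un_commute)
  show ?thesis
    using tendsto_diff[OF tendsto_add[OF tail_scaled[OF i b(1)] tail_scaled[OF j b(2)]] L]
    by (auto simp: joint_tail_eq[OF i j] add_divide_distrib diff_divide_distrib)
qed

text \<open>No two different p-values are simultaneously of order \<open>t\<close>, up to probability \<open>o(g t)\<close>.\<close>

definition tail_independent :: bool where
  "tail_independent \<longleftrightarrow> (\<forall>i\<in>{1..n}. \<forall>j\<in>{1..n}. i \<noteq> j \<longrightarrow>
     (\<forall>b>0. \<forall>b'>0. ((\<lambda>t. joint_tail i j b b' t / g t) \<longlongrightarrow> 0) (at_right 0)))"

text \<open>The principle of a single large summand: if the sum is at least 1, then either one summand is at
  least \<open>1 - \<delta>\<close>, or two summands are at least \<open>\<delta> / n\<close>, and the latter event is negligible.\<close>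

lemma power_limit_tail_independent:
  assumes ind: "tail_independent" and \<gamma>: "0 < \<gamma>"
  shows "power_limit \<gamma> = total_limit"
proof (rule antisym)
  have pm: "P i \<in> borel_measurable M" if "i \<in> {1..n}" for i using that by (rule P_measurable)
  have n: "0 < n" using c_pos by auto
  have joint: "((\<lambda>t. \<Sum>i=1..n. \<Sum>j\<in>{1..n} - {i}. joint_tail i j (b i) (b j) t / g t) \<longlongrightarrow> 0) (at_right 0)"
    if "\<And>i. i \<in> {1..n} \<Longrightarrow> 0 < b i" for b
    using ind that unfolding tail_independent_def
    by (intro tendsto_null_sum) auto
  show "total_limit \<le> power_limit \<gamma>"
  proof (rule tendsto_le[OF _ sum_tail_tendsto[OF \<gamma>]])
    show "((\<lambda>t. (\<Sum>i=1..n. prob {x \<in> space M. P i x < w i * t} / g t) -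
        (\<Sum>i=1..n. \<Sum>j\<in>{1..n} - {i}. joint_tail i j (w i) (w j) t / g t)) \<longlongrightarrow> total_limit) (at_right 0)"
    proof -
      have "((\<lambda>t. \<Sum>i=1..n. prob {x \<in> space M. P i x < w i * t} / g t) \<longlongrightarrow> total_limit) (at_right 0)"
        unfolding total_limit_def using w_pos by (intro tendsto_sum tail_scaled) (auto intro: less_imp_le)
      from tendsto_diff[OF this joint[of w]] w_pos show ?thesis by simp
    qed
    show "\<forall>\<^sub>F t in at_right 0. (\<Sum>i=1..n. prob {x \<in> space M. P i x < w i * t} / g t) -
        (\<Sum>i=1..n. \<Sum>j\<in>{1..n} - {i}. joint_tail i j (w i) (w j) t / g t) \<le> sum_tail \<gamma> t / g t"
      using eventually_at_right_less[of "0::real"]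
    proof eventually_elim
      case (elim t)
      let ?E = "\<lambda>i. {x \<in> space M. P i x < w i * t}"
      have "(\<Sum>i=1..n. prob (?E i)) - (\<Sum>i=1..n. \<Sum>j\<in>{1..n} - {i}. prob (?E i \<inter> ?E j)) \<le> prob (\<Union>i\<in>{1..n}. ?E i)"
        by (rule prob_union_ge_sum_minus_pairs) auto
      also have "\<dots> \<le> sum_tail \<gamma> t"
        unfolding sum_tail_def
      proof (rule finite_measure_mono_AE)
        show "AE x in M. x \<in> (\<Union>i\<in>{1..n}. ?E i) \<longrightarrow> x \<in> {x \<in> space M. 1 \<le> ratio_sum \<gamma> t x}"
          using AE_P_pos
        proof eventually_elim
          case (elim x)
          have "1 \<le> ratio_sum \<gamma> t x" if i: "i \<in> {1..n}" and x: "P i x < w i * t" "x \<in> space M" for i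
          proof -
            have "1 \<le> (t * (w i / P i x)) powr (1 / \<gamma>)"
              using threshold_iff(2)[OF \<gamma> \<open>0 < t\<close>, of 1 i x] i x elim by auto
            also have "\<dots> \<le> ratio_sum \<gamma> t x"
              unfolding ratio_sum_def using i by (intro member_le_sum) auto
            finally show ?thesis .
          qed
          then show ?case by auto
        qed
      qed measurable
      also have "(\<Sum>i=1..n. \<Sum>j\<in>{1..n} - {i}. prob (?E i \<inter> ?E j)) =
          (\<Sum>i=1..n. \<Sum>j\<in>{1..n} - {i}. joint_tail i j (w i) (w j) t)"
        unfolding joint_tail_def by (intro sum.cong refl arg_cong[where f = prob]) auto
      finally have "((\<Sum>i=1..n. prob (?E i)) -
          (\<Sum>i=1..n. \<Sum>j\<in>{1..n} - {i}. joint_tail i j (w i) (w j) t)) / g t \<le> sum_tail \<gamma> t / g t"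
        using g_pos[OF elim] by (intro divide_right_mono) auto
      then show ?case by (simp add: diff_divide_distrib sum_divide_distrib)
    qed
  qed simp
  have up: "power_limit \<gamma> \<le> total_limit * ((1 - \<delta>) powr (- \<gamma>)) powr \<beta>" if \<delta>: "0 < \<delta>" "\<delta> < 1" for \<delta>
  proof (rule tendsto_le[OF _ _ sum_tail_tendsto[OF \<gamma>]])
    define a where "a = (1 - \<delta>) powr \<gamma>"
    \<comment> \<open>the factor 2 only turns a weak inequality for \<open>P i\<close> into a strict one\<close>
    define b where "b i = 2 * (w i / (\<delta> / n) powr \<gamma>)" for i
    have a: "0 < a" using \<delta> by (simp add: a_def)
    have b: "0 < b i" "w i / (\<delta> / n) powr \<gamma> < b i" if "i \<in> {1..n}" for i
      using w_pos[OF that] \<delta> n by (auto simp: b_def intro!: divide_strict_right_mono)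
    have "((\<lambda>t. prob {x \<in> space M. P i x < w i / a * t} / g t) \<longlongrightarrow> c i * (w i / a) powr \<beta>) (at_right 0)"
      if "i \<in> {1..n}" for i
      using w_pos[OF that] a that by (intro tail_scaled) auto
    then have lim1: "((\<lambda>t. \<Sum>i=1..n. prob {x \<in> space M. P i x < w i / a * t} / g t) \<longlongrightarrow>
        (\<Sum>i=1..n. c i * (w i / a) powr \<beta>)) (at_right 0)"
      by (intro tendsto_sum)
    have lim_eq: "(\<Sum>i=1..n. c i * (w i / a) powr \<beta>) = total_limit * ((1 - \<delta>) powr (- \<gamma>)) powr \<beta>"
      unfolding total_limit_def sum_distrib_right
      by (intro sum.cong) (simp_all add: powr_divide powr_minus_divide a_def)
    show "((\<lambda>t. (\<Sum>i=1..n. prob {x \<in> space M. P i x < w i / a * t} / g t) +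
        (\<Sum>i=1..n. \<Sum>j\<in>{1..n} - {i}. joint_tail i j (b i) (b j) t / g t)) \<longlongrightarrow>
         total_limit * ((1 - \<delta>) powr (- \<gamma>)) powr \<beta>) (at_right 0)"
      using tendsto_add[OF lim1 joint[of b, OF b(1)]] by (simp only: lim_eq add_0_right)
    show "\<forall>\<^sub>F t in at_right 0. sum_tail \<gamma> t / g t \<le> (\<Sum>i=1..n. prob {x \<in> space M. P i x < w i / a * t} / g t) +
        (\<Sum>i=1..n. \<Sum>j\<in>{1..n} - {i}. joint_tail i j (b i) (b j) t / g t)"
      using eventually_at_right_less[of "0::real"]
    proof eventually_elim
      case (elim t)
      let ?E = "\<lambda>i. {x \<in> space M. P i x \<le> w i / a * t}"
      let ?F = "\<lambda>i j. {x \<in> space M. P i x < b i * t \<and> P j x < b j * t}"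
      have F: "?F i j \<in> events" if "i \<in> {1..n}" "j \<in> {1..n}" for i j
        using pm[OF that(1)] pm[OF that(2)] by measurable
      have "sum_tail \<gamma> t \<le> prob ((\<Union>i\<in>{1..n}. ?E i) \<union> (\<Union>i\<in>{1..n}. \<Union>j\<in>{1..n} - {i}. ?F i j))"
        unfolding sum_tail_def
      proof (rule finite_measure_mono_AE)
        show "(\<Union>i\<in>{1..n}. ?E i) \<union> (\<Union>i\<in>{1..n}. \<Union>j\<in>{1..n} - {i}. ?F i j) \<in> events"
          using F by (intro sets.Un sets.finite_UN) auto
        show "AE x in M. x \<in> {x \<in> space M. 1 \<le> ratio_sum \<gamma> t x} \<longrightarrow>
          x \<in> (\<Union>i\<in>{1..n}. ?E i) \<union> (\<Union>i\<in>{1..n}. \<Union>j\<in>{1..n} - {i}. ?F i j)"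
          using AE_P_pos
        proof eventually_elim
          case (elim x)
          let ?z = "\<lambda>i. (t * (w i / P i x)) powr (1 / \<gamma>)"
          show ?case
          proof (intro impI, rule ccontr)
            assume 1: "x \<in> {x \<in> space M. 1 \<le> ratio_sum \<gamma> t x}"
              and 2: "x \<notin> (\<Union>i\<in>{1..n}. ?E i) \<union> (\<Union>i\<in>{1..n}. \<Union>j\<in>{1..n} - {i}. ?F i j)"
            have E: "?z i < 1 - \<delta>" if i: "i \<in> {1..n}" for i
              using threshold_iff(2)[OF \<gamma> \<open>0 < t\<close>, of "1 - \<delta>" i x] i 1 2 elim \<delta> 
              by (auto simp: a_def not_less[symmetric])
            have F: "P i x < b i * t" if i: "i \<in> {1..n}" and z: "\<delta> / n \<le> ?z i" for i
            proof -
              have "P i x \<le> w i / (\<delta> / n) powr \<gamma> * t"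
                using threshold_iff(2)[OF \<gamma> \<open>0 < t\<close>, of "\<delta> / n" i x] i z elim \<delta> n by auto
              also have "\<dots> < b i * t" using b(2)[OF i] \<open>0 < t\<close> by (intro mult_strict_right_mono) auto
              finally show ?thesis .
            qed
            have "ratio_sum \<gamma> t x < 1"
            proof (cases "\<exists>i\<in>{1..n}. \<delta> / n \<le> ?z i")
              case True
              then obtain i where i: "i \<in> {1..n}" "\<delta> / n \<le> ?z i" by auto
              have oth: "?z j \<le> \<delta> / n" if "j \<in> {1..n} - {i}" for j
              proof (rule ccontr)
                assume "\<not> ?z j \<le> \<delta> / n"
                then have "P j x < b j * t" using that by (intro F) auto
                then have "x \<in> ?F i j" using F[OF i] 1 by simp
                then show False using 2 i(1) that by blast
              qed
              have "ratio_sum \<gamma> t x = ?z i + (\<Sum>j\<in>{1..n} - {i}. ?z j)"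
                unfolding ratio_sum_def using i by (intro sum.remove) auto
              also have "\<dots> \<le> ?z i + (\<Sum>j\<in>{1..n} - {i}. \<delta> / n)"
                using oth by (intro add_left_mono sum_mono) auto
              also have "\<dots> \<le> ?z i + (\<Sum>j\<in>{1..n}. \<delta> / n)"
                using \<delta> by (intro add_left_mono sum_mono2) auto
              also have "(\<Sum>j\<in>{1..n}. \<delta> / n) = \<delta>" using n by simp
              finally show ?thesis using E[OF i(1)] by simp
            next
              case False
              have "ratio_sum \<gamma> t x \<le> (\<Sum>j\<in>{1..n}. \<delta> / n)"
                unfolding ratio_sum_def using False by (intro sum_mono) (auto simp: not_le intro: less_imp_le)
              then show ?thesis using n \<delta> by simp
            qed
            then show False using 1 by simp
          qed
        qed
      qed
      also have "\<dots> \<le> prob (\<Union>i\<in>{1..n}. ?E i) + prob (\<Union>i\<in>{1..n}. \<Union>j\<in>{1..n} - {i}. ?F i j)"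
        using F by (intro measure_Un_le sets.finite_UN) auto
      also have "\<dots> \<le> (\<Sum>i=1..n. prob (?E i)) + (\<Sum>i=1..n. prob (\<Union>j\<in>{1..n} - {i}. ?F i j))"
        using F by (intro add_mono finite_measure_subadditive_finite) (auto intro!: sets.finite_UN)
      also have "\<dots> \<le> (\<Sum>i=1..n. prob (?E i)) + (\<Sum>i=1..n. \<Sum>j\<in>{1..n} - {i}. prob (?F i j))"
        using F by (intro add_left_mono sum_mono finite_measure_subadditive_finite) auto
      also have "\<dots> = (\<Sum>i=1..n. prob {x \<in> space M. P i x < w i / a * t}) +
          (\<Sum>i=1..n. \<Sum>j\<in>{1..n} - {i}. joint_tail i j (b i) (b j) t)"
        by (simp add: prob_le_eq_less joint_tail_def)
      finally have "sum_tail \<gamma> t / g t \<le> \<dots> / g t"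
        using g_pos[OF elim] by (intro divide_right_mono) auto
      then show ?case by (simp add: add_divide_distrib sum_divide_distrib)
    qed
  qed simp
  have "((\<lambda>\<delta>. total_limit * ((1 - \<delta>) powr (- \<gamma>)) powr \<beta>) \<longlongrightarrow> total_limit) (at_right 0)"
    by (auto intro!: tendsto_eq_intros)
  moreover have "\<forall>\<^sub>F \<delta> in at_right 0. power_limit \<gamma> \<le> total_limit * ((1 - \<delta>) powr (- \<gamma>)) powr \<beta>"
    using eventually_at_right_real[of 0 1] by (auto elim!: eventually_mono intro!: up)
  ultimately show "power_limit \<gamma> \<le> total_limit"
    by (rule tendsto_lowerbound) simp
qed

text \<open>Two p-values are jointly small with probability of order \<open>g t\<close>, and the \<open>q\<close>-norm of the vector of
  the \<open>t * w i / P i\<close>, where \<open>q = 1 / \<gamma>\<^sub>2\<close>, is below a large \<open>K\<close> on most of that event. There the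
  \<open>p\<close>-norm, where \<open>p = 1 / \<gamma>\<^sub>1\<close>, exceeds the \<open>q\<close>-norm by a factor \<open>\<rho> > 1\<close>, so that some power of
  \<open>\<rho>\<close> separates the two norms. Finitely many powers suffice, and each contributes a multiple of the difference of
  the two limits.\<close>

lemma power_limit_strict_mono:
  assumes nind: "\<not> tail_independent" and \<gamma>: "0 < \<gamma>\<^sub>2" "\<gamma>\<^sub>2 < \<gamma>\<^sub>1"
  shows "power_limit \<gamma>\<^sub>2 < power_limit \<gamma>\<^sub>1"
proof -
  obtain i j b b' where ij: "i \<in> {1..n}" "j \<in> {1..n}" "i \<noteq> j" and b: "0 < b" "0 < b'"
    and nlim: "\<not> ((\<lambda>t. joint_tail i j b b' t / g t) \<longlongrightarrow> 0) (at_right 0)"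
    using nind unfolding tail_independent_def by blast
  have [measurable]: "P i \<in> borel_measurable M" "P j \<in> borel_measurable M" using ij by auto
  have w: "0 < w i" "0 < w j" using w_pos ij by auto
  obtain \<kappa>' where \<kappa>': "((\<lambda>t. joint_tail i j b b' t / g t) \<longlongrightarrow> \<kappa>') (at_right 0)"
    using joint_tail_convergent[OF ij(1,2), of b b'] b by auto
  obtain \<kappa> where \<kappa>: "((\<lambda>t. joint_tail i j (w i) (w j) t / g t) \<longlongrightarrow> \<kappa>) (at_right 0)"
    using joint_tail_convergent[OF ij(1,2), of "w i" "w j"] w by auto
  have "0 \<le> \<kappa>'"
  proof (rule tendsto_lowerbound[OF \<kappa>'])
    show "\<forall>\<^sub>F t in at_right 0. 0 \<le> joint_tail i j b b' t / g t"
      using eventually_at_right_less[of "0::real"]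
    proof eventually_elim
      case (elim t)
      then show ?case using g_pos[of t] by (simp add: joint_tail_def)
    qed
  qed simp
  moreover have "\<kappa>' \<noteq> 0" using \<kappa>' nlim by auto
  ultimately have "0 < \<kappa>'" by simp
  \<comment> \<open>by homogeneity the thresholds may be taken to be \<open>w i\<close> and \<open>w j\<close>\<close>
  define B where "B = max (b / w i) (b' / w j)"
  have B: "0 < B" "b \<le> w i * B" "b' \<le> w j * B"
    using b w by (auto simp: B_def max_def field_simps)
  have "\<kappa>' \<le> \<kappa> * B powr \<beta>"
  proof (rule tendsto_le[OF _ reg_var0_ratio_scale[OF g_rv \<kappa> B(1)] \<kappa>'])
    show "\<forall>\<^sub>F t in at_right 0. joint_tail i j b b' t / g t \<le> joint_tail i j (w i) (w j) (B * t) / g t"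
      using eventually_at_right_less[of "0::real"]
    proof eventually_elim
      case (elim t)
      have "b * t \<le> w i * (B * t)" "b' * t \<le> w j * (B * t)"
        using mult_right_mono[OF B(2), of t] mult_right_mono[OF B(3), of t] elim by (auto simp: mult.assoc)
      then have "joint_tail i j b b' t \<le> joint_tail i j (w i) (w j) (B * t)"
        unfolding joint_tail_def by (intro finite_measure_mono) auto
      then show ?case using g_pos[OF elim] by (intro divide_right_mono) auto
    qed
  qed simp
  with \<open>0 < \<kappa>'\<close> have "0 < \<kappa> * B powr \<beta>" by linarith
  then have "0 < \<kappa>" using B by (simp add: zero_less_mult_iff)

  \<comment> \<open>outside the region where the \<open>q\<close>-norm is at least \<open>K\<close>, a positive part of the joint tail is left\<close>
  obtain K where K: "1 \<le> K" "power_limit \<gamma>\<^sub>2 * K powr (- \<beta>) < \<kappa>"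
  proof -
    have "((\<lambda>K. power_limit \<gamma>\<^sub>2 * K powr (- \<beta>)) \<longlongrightarrow> power_limit \<gamma>\<^sub>2 * 0) at_top"
      using beta_pos by (intro tendsto_mult tendsto_const tendsto_neg_powr filterlim_ident) auto
    then have "\<forall>\<^sub>F K in at_top. power_limit \<gamma>\<^sub>2 * K powr (- \<beta>) < \<kappa>"
      using \<open>0 < \<kappa>\<close> by (intro order_tendstoD) auto
    then have "\<forall>\<^sub>F K in at_top. power_limit \<gamma>\<^sub>2 * K powr (- \<beta>) < \<kappa> \<and> 1 \<le> K"
      using eventually_ge_at_top[of "1::real"] by eventually_elim auto
    then show ?thesis
      using that eventually_happens'[OF trivial_limit_at_top_linorder] by blast
  qed
  define p where "p = 1 / \<gamma>\<^sub>1"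
  define q where "q = 1 / \<gamma>\<^sub>2"
  have pq: "0 < p" "p < q" using \<gamma> by (auto simp: p_def q_def field_simps)
  obtain \<rho> where \<rho>: "1 < \<rho>" and gap:
    "\<And>I (r :: nat \<Rightarrow> real) i j. finite I \<Longrightarrow> (\<And>i. i \<in> I \<Longrightarrow> 0 \<le> r i) \<Longrightarrow> i \<in> I \<Longrightarrow> j \<in> I \<Longrightarrow> i \<noteq> j \<Longrightarrow>
       1 \<le> r i \<Longrightarrow> 1 \<le> r j \<Longrightarrow> (\<Sum>i\<in>I. r i powr q) < K powr q \<Longrightarrow>
       \<rho> powr p * (\<Sum>i\<in>I. r i powr q) powr (p / q) \<le> (\<Sum>i\<in>I. r i powr p)"
    using power_sum_gap[OF pq K(1), where 'i = nat] by blast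
  obtain k where k: "K < \<rho> ^ k" using real_arch_pow[OF \<rho>] by blast
  define s where "s m = inverse (\<rho> ^ Suc m)" for m
  have s: "0 < s m" for m using \<rho> by (simp add: s_def)
  have bound: "joint_tail i j (w i) (w j) t - sum_tail \<gamma>\<^sub>2 (inverse K * t) \<le>
      (\<Sum>m<k. sum_tail \<gamma>\<^sub>1 (s m * t) - sum_tail \<gamma>\<^sub>2 (s m * t))" if t: "0 < t" for t
  proof -
    let ?D = "\<lambda>m. {x \<in> space M. 1 \<le> ratio_sum \<gamma>\<^sub>1 (s m * t) x} - {x \<in> space M. 1 \<le> ratio_sum \<gamma>\<^sub>2 (s m * t) x}"
    have D: "prob (?D m) = sum_tail \<gamma>\<^sub>1 (s m * t) - sum_tail \<gamma>\<^sub>2 (s m * t)" for m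
      unfolding sum_tail_def
    proof (rule finite_measure_Diff)
      show "{x \<in> space M. 1 \<le> ratio_sum \<gamma>\<^sub>2 (s m * t) x} \<subseteq> {x \<in> space M. 1 \<le> ratio_sum \<gamma>\<^sub>1 (s m * t) x}"
        unfolding ratio_sum_def using \<gamma> s[of m] t ratio_nonneg
        by (auto intro!: sum_powr_ge_1_antimono[where p = "1 / \<gamma>\<^sub>1" and q = "1 / \<gamma>\<^sub>2"] mult_nonneg_nonneg divide_left_mono
          simp del: times_divide_eq_right)
    qed auto
    have "joint_tail i j (w i) (w j) t \<le>
        prob ({x \<in> space M. 1 \<le> ratio_sum \<gamma>\<^sub>2 (inverse K * t) x} \<union> (\<Union>m\<in>{..<k}. ?D m))"
      unfolding joint_tail_def
    proof (rule finite_measure_mono_AE)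
      show "AE x in M. x \<in> {x \<in> space M. P i x < w i * t \<and> P j x < w j * t} \<longrightarrow>
          x \<in> {x \<in> space M. 1 \<le> ratio_sum \<gamma>\<^sub>2 (inverse K * t) x} \<union> (\<Union>m\<in>{..<k}. ?D m)"
        using AE_P_pos
      proof eventually_elim
        case (elim x)
        show ?case
        proof (intro impI, rule ccontr)
          assume "x \<in> {x \<in> space M. P i x < w i * t \<and> P j x < w j * t}"
            and out: "x \<notin> {x \<in> space M. 1 \<le> ratio_sum \<gamma>\<^sub>2 (inverse K * t) x} \<union> (\<Union>m\<in>{..<k}. ?D m)"
          then have x: "x \<in> space M" "P i x < w i * t" "P j x < w j * t" by auto
          let ?r = "\<lambda>i. t * (w i / P i x)"
          let ?S = "ratio_sum \<gamma>\<^sub>2 t x"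
          define \<tau> where "\<tau> = ?S powr (1 / q)"
          have S0: "0 \<le> ?S" unfolding ratio_sum_def by (intro sum_nonneg) auto
          have r: "1 \<le> ?r i" "1 \<le> ?r j" using x elim ij by (auto simp: field_simps)
          have "1 \<le> ?r i powr q" using r pq by (intro ge_one_powr_ge_zero) auto
          also have "\<dots> \<le> ?S" unfolding ratio_sum_def q_def using ij by (intro member_le_sum) auto
          finally have S1: "1 \<le> ?S" .
          then have \<tau>1: "1 \<le> \<tau>" using pq unfolding \<tau>_def by (intro ge_one_powr_ge_zero) auto
          have \<tau>q: "\<tau> powr q = ?S" using pq S0 by (simp add: \<tau>_def powr_powr)
          have "ratio_sum \<gamma>\<^sub>2 (inverse K * t) x < 1" using out x by auto
          then have "inverse K powr q * ?S < 1"
            using ratio_sum_scale[of "inverse K" t x \<gamma>\<^sub>2] K x t by (simp add: q_def)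
          moreover have "inverse K powr q = inverse (K powr q)" "0 < K powr q"
            using K by (auto simp: inverse_powr)
          ultimately have SK: "?S < K powr q" by (simp add: field_simps)
          then have "\<tau> < (K powr q) powr (1 / q)"
            unfolding \<tau>_def using pq S0 by (intro powr_less_mono2) auto
          then have \<tau>K: "\<tau> < K" using K pq by (simp add: powr_powr)
          \<comment> \<open>the power of \<open>\<rho>\<close> that lies just above the \<open>q\<close>-norm\<close>
          define m where "m = (LEAST m. \<tau> < \<rho> ^ Suc m)"
          have "k \<noteq> 0" using k K by (cases k) auto
          then obtain k' where k': "k = Suc k'" using not0_implies_Suc by blast
          have ex: "\<tau> < \<rho> ^ Suc k'" using \<tau>K k k' by simp
          have m1: "\<tau> < \<rho> ^ Suc m" unfolding m_def by (rule LeastI[of _ k']) (rule ex)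
          have mk: "m < k" unfolding m_def k' by (rule le_imp_less_Suc, rule Least_le) (rule ex)
          have m2: "\<rho> ^ m \<le> \<tau>"
          proof (cases m)
            case 0
            then show ?thesis using \<tau>1 by simp
          next
            case (Suc m')
            have "m' < (LEAST m. \<tau> < \<rho> ^ Suc m)" using Suc unfolding m_def by linarith
            then have "\<not> \<tau> < \<rho> ^ Suc m'" by (rule not_less_Least)
            then show ?thesis using Suc by simp
          qed
          have "ratio_sum \<gamma>\<^sub>2 (s m * t) x = (s m * \<tau>) powr q"
            using ratio_sum_scale[of "s m" t x \<gamma>\<^sub>2] s[of m] t x \<tau>q by (simp add: q_def powr_mult)
          also have "s m * \<tau> < 1" using m1 \<rho> by (simp add: s_def field_simps)
          then have "(s m * \<tau>) powr q < 1 powr q"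
            using s[of m] \<tau>1 pq by (intro powr_less_mono2) auto
          finally have Z2: "ratio_sum \<gamma>\<^sub>2 (s m * t) x < 1" by simp
          have "\<rho> powr p * ?S powr (p / q) \<le> ratio_sum \<gamma>\<^sub>1 t x"
          proof -
            have "\<rho> powr p * (\<Sum>i=1..n. ?r i powr q) powr (p / q) \<le> (\<Sum>i=1..n. ?r i powr p)"
            proof (rule gap[OF _ _ ij r])
              show "(\<Sum>i=1..n. ?r i powr q) < K powr q" using SK by (simp add: ratio_sum_def q_def)
              show "0 \<le> ?r i" if "i \<in> {1..n}" for i
                using ratio_nonneg[OF that x(1)] t by (intro mult_nonneg_nonneg) auto
            qed simp
            then show ?thesis by (simp add: ratio_sum_def p_def q_def)
          qed
          moreover have "?S powr (p / q) = \<tau> powr p" by (simp add: \<tau>_def powr_powr)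
          ultimately have "(s m * (\<rho> * \<tau>)) powr p \<le> s m powr p * ratio_sum \<gamma>\<^sub>1 t x"
            by (simp add: powr_mult mult_left_mono)
          also have "s m powr p * ratio_sum \<gamma>\<^sub>1 t x = ratio_sum \<gamma>\<^sub>1 (s m * t) x"
            using ratio_sum_scale[of "s m" t x \<gamma>\<^sub>1] s[of m] t x by (simp add: p_def)
          finally have "(s m * (\<rho> * \<tau>)) powr p \<le> ratio_sum \<gamma>\<^sub>1 (s m * t) x" .
          moreover have "1 \<le> s m * (\<rho> * \<tau>)" using m2 \<rho> by (simp add: s_def field_simps)
          then have "1 \<le> (s m * (\<rho> * \<tau>)) powr p" using pq by (intro ge_one_powr_ge_zero) auto
          ultimately have "1 \<le> ratio_sum \<gamma>\<^sub>1 (s m * t) x" by simp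
          then show False using Z2 mk out x by auto
        qed
      qed
    qed measurable
    also have "\<dots> \<le> prob {x \<in> space M. 1 \<le> ratio_sum \<gamma>\<^sub>2 (inverse K * t) x} + prob (\<Union>m\<in>{..<k}. ?D m)"
      by (intro measure_Un_le) auto
    also have "\<dots> \<le> sum_tail \<gamma>\<^sub>2 (inverse K * t) + (\<Sum>m<k. prob (?D m))"
      unfolding sum_tail_def by (intro add_left_mono finite_measure_subadditive_finite) auto
    finally show ?thesis by (simp add: D)
  qed
  let ?\<Sigma> = "\<Sum>m<k. s m powr \<beta>"
  have "\<kappa> - power_limit \<gamma>\<^sub>2 * inverse K powr \<beta> \<le>
     (\<Sum>m<k. power_limit \<gamma>\<^sub>1 * s m powr \<beta> - power_limit \<gamma>\<^sub>2 * s m powr \<beta>)"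
  proof (rule tendsto_le)
    show "((\<lambda>t. joint_tail i j (w i) (w j) t / g t - sum_tail \<gamma>\<^sub>2 (inverse K * t) / g t) \<longlongrightarrow>
        \<kappa> - power_limit \<gamma>\<^sub>2 * inverse K powr \<beta>) (at_right 0)"
      using K \<gamma> by (intro tendsto_diff \<kappa> reg_var0_ratio_scale[OF g_rv] sum_tail_tendsto) auto
    show "((\<lambda>t. \<Sum>m<k. sum_tail \<gamma>\<^sub>1 (s m * t) / g t - sum_tail \<gamma>\<^sub>2 (s m * t) / g t) \<longlongrightarrow>
        (\<Sum>m<k. power_limit \<gamma>\<^sub>1 * s m powr \<beta> - power_limit \<gamma>\<^sub>2 * s m powr \<beta>)) (at_right 0)"
      using \<gamma> s by (intro tendsto_sum tendsto_diff reg_var0_ratio_scale[OF g_rv] sum_tail_tendsto) auto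
    show "\<forall>\<^sub>F t in at_right 0. joint_tail i j (w i) (w j) t / g t - sum_tail \<gamma>\<^sub>2 (inverse K * t) / g t
       \<le> (\<Sum>m<k. sum_tail \<gamma>\<^sub>1 (s m * t) / g t - sum_tail \<gamma>\<^sub>2 (s m * t) / g t)"
      using eventually_at_right_less[of "0::real"]
    proof eventually_elim
      case (elim t)
      have "(joint_tail i j (w i) (w j) t - sum_tail \<gamma>\<^sub>2 (inverse K * t)) / g t \<le>
         (\<Sum>m<k. sum_tail \<gamma>\<^sub>1 (s m * t) - sum_tail \<gamma>\<^sub>2 (s m * t)) / g t"
        using bound[OF elim] g_pos[OF elim] by (intro divide_right_mono) auto
      then show ?case by (simp add: sum_divide_distrib diff_divide_distrib)
    qed
  qed simp
  also have "\<dots> = (power_limit \<gamma>\<^sub>1 - power_limit \<gamma>\<^sub>2) * ?\<Sigma>"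
    by (simp add: sum_distrib_left left_diff_distrib)
  also have "inverse K powr \<beta> = K powr (- \<beta>)" using K by (simp add: powr_minus inverse_powr)
  finally have "0 < (power_limit \<gamma>\<^sub>1 - power_limit \<gamma>\<^sub>2) * ?\<Sigma>" using K by linarith
  moreover have "0 \<le> ?\<Sigma>" by (intro sum_nonneg) auto
  ultimately show ?thesis by (auto simp: zero_less_mult_iff)
qed

end

section \<open>Quantile functions\<close>

lemma is_cdf_facts:
  assumes "is_cdf F"
  shows "mono F" "(F \<longlongrightarrow> 1) at_top" "(F \<longlongrightarrow> 0) at_bot" "continuous (at_right x) F" "0 \<le> F x" "F x \<le> 1"
proof -
  obtain \<nu> where \<nu>: "real_distribution \<nu>" "F = cdf \<nu>" using assms by (auto simp: is_cdf_def)
  interpret real_distribution \<nu> by fact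
  show "mono F" "(F \<longlongrightarrow> 1) at_top" "(F \<longlongrightarrow> 0) at_bot" "continuous (at_right x) F" "0 \<le> F x" "F x \<le> 1"
    unfolding \<nu> using cdf_nondecreasing cdf_lim_at_top_prob cdf_lim_at_bot cdf_is_right_cont cdf_nonneg cdf_bounded_prob
    by (auto simp: mono_def)
qed

lemma Q_le_iff:
  assumes F: "is_cdf F" and t: "0 < t" "t < 1"
  shows "Q F t \<le> x \<longleftrightarrow> t \<le> F x"
proof -
  note F = is_cdf_facts[OF F]
  let ?S = "{x. t \<le> F x}"
  have Q: "Q F t = Inf ?S" using t by (simp add: Q_def)
  have "\<forall>\<^sub>F x in at_top. t < F x" using F(2) t by (intro order_tendstoD) auto
  then have ne: "?S \<noteq> {}" by (auto simp: eventually_at_top_linorder intro: less_imp_le)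
  have "\<forall>\<^sub>F x in at_bot. F x < t" using F(3) t by (intro order_tendstoD) auto
  then obtain N where N: "\<And>x. x \<le> N \<Longrightarrow> F x < t" by (auto simp: eventually_at_bot_linorder)
  have bdd: "bdd_below ?S"
  proof (rule bdd_belowI)
    fix x assume "x \<in> ?S"
    then show "N \<le> x" using N[of x] by (cases "x \<le> N") auto
  qed
  have above: "t \<le> F y" if less: "Q F t < y" for y
  proof -
    obtain z where "t \<le> F z" "z < y" using less cInf_less_iff[OF ne bdd] by (auto simp: Q)
    then show ?thesis using monoD[OF F(1), of z y] by simp
  qed
  have "t \<le> F (Q F t)"
  proof (rule tendsto_lowerbound)
    show "(F \<longlongrightarrow> F (Q F t)) (at_right (Q F t))" using F(4) by (simp add: continuous_within)
    show "\<forall>\<^sub>F y in at_right (Q F t). t \<le> F y"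
      using eventually_at_right_less[of "Q F t"] by eventually_elim (rule above)
  qed simp
  then have "Q F t \<le> x \<Longrightarrow> t \<le> F x" using monoD[OF F(1), of "Q F t" x] by simp
  moreover have "t \<le> F x \<Longrightarrow> Q F t \<le> x" unfolding Q using bdd by (intro cInf_lower) auto
  ultimately show ?thesis by blast
qed

text \<open>This property holds without continuity of \<open>F\<close>. It shows that \<open>F\<close> has no mass below its support.\<close>

lemma Q_in_support:
  assumes F: "is_cdf F" and t: "0 < t" "t < 1"
  shows "Q F t \<in> cdf_support F"
  unfolding cdf_support_def
proof (intro CollectI allI impI)
  fix e :: real assume e: "0 < e"
  have "F (Q F t - e) < t" using Q_le_iff[OF F t, of "Q F t - e"] e by auto
  also have "t \<le> F (Q F t + e)" using Q_le_iff[OF F t, of "Q F t + e"] e by auto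
  finally show "F (Q F t - e) < F (Q F t + e)" .
qed

text \<open>The two points 0 and 1, where \<open>Q F\<close> is not the usual quantile, are treated separately.\<close>

lemma Q_measurable:
  assumes F: "is_cdf F" and f[measurable]: "f \<in> borel_measurable M" and f01: "\<And>x. x \<in> space M \<Longrightarrow> f x \<in> {0..1}"
  shows "(\<lambda>x. Q F (f x)) \<in> borel_measurable M"
  unfolding borel_measurable_iff_le
proof
  fix a
  have "{x \<in> space M. Q F (f x) \<le> a} =
    {x \<in> space M. f x = 0 \<and> Q F 0 \<le> a \<or> 0 < f x \<and> f x < 1 \<and> f x \<le> F a \<or> f x = 1 \<and> Q F 1 \<le> a}"
  proof (intro Collect_cong conj_cong refl)
    fix x assume "x \<in> space M"
    then have "f x = 0 \<or> f x = 1 \<or> 0 < f x \<and> f x < 1" using f01[of x] by auto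
    then show "Q F (f x) \<le> a \<longleftrightarrow>
      f x = 0 \<and> Q F 0 \<le> a \<or> 0 < f x \<and> f x < 1 \<and> f x \<le> F a \<or> f x = 1 \<and> Q F 1 \<le> a"
      using Q_le_iff[OF F, of "f x" a] by auto
  qed
  also have "\<dots> \<in> sets M" by measurable
  finally show "{x \<in> space M. Q F (f x) \<le> a} \<in> sets M" .
qed

lemma RV_less_1:
  assumes F: "F \<in> RV \<gamma>"
  shows "F x < 1"
proof (rule ccontr)
  have cdf: "is_cdf F" and lim: "((\<lambda>x. (1 - F (x * 2)) / (1 - F x)) \<longlongrightarrow> 2 powr (- \<gamma>)) at_top"
    using F by (auto simp: RV_def)
  assume "\<not> F x < 1"
  then have one: "F y = 1" if "x \<le> y" for y
    using monoD[OF is_cdf_facts(1)[OF cdf] that] is_cdf_facts(6)[OF cdf, of y] by simp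
  have "\<forall>\<^sub>F y in at_top. (1 - F (y * 2)) / (1 - F y) = 0"
    using eventually_ge_at_top[of x] by eventually_elim (simp add: one)
  then have "((\<lambda>x. (1 - F (x * 2)) / (1 - F x)) \<longlongrightarrow> 0) at_top"
    by (rule tendsto_eventually)
  from tendsto_unique[OF _ lim this] show False by simp
qed

lemma RV_star_quantile:
  assumes F: "F \<in> RV_star \<gamma>" and supp: "cdf_support F = {c..}"
  shows "F c = 0" "strict_mono_on {c..} F"
    and "0 \<le> t \<Longrightarrow> t < 1 \<Longrightarrow> c \<le> Q F t" "0 \<le> t \<Longrightarrow> t < 1 \<Longrightarrow> F (Q F t) = t"
proof -
  have cdf: "is_cdf F" and cont: "\<And>x. c \<le> x \<Longrightarrow> isCont F x" and less1: "\<And>x. F x < 1"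
    using F supp RV_less_1 by (auto simp: RV_star_def RV_def)
  show "strict_mono_on {c..} F" using F supp by (simp add: RV_star_def)
  note Fc = is_cdf_facts[OF cdf]
  have zero: "F x = 0" if "x < c" for x
  proof (rule ccontr)
    assume "F x \<noteq> 0"
    then have t: "0 < F x" "F x < 1" using less1 Fc(5)[of x] by auto
    have "Q F (F x) \<le> x" using Q_le_iff[OF cdf t, of x] by simp
    moreover have "c \<le> Q F (F x)" using Q_in_support[OF cdf t] supp by simp
    ultimately show False using that by simp
  qed
  show c0: "F c = 0"
  proof (rule tendsto_unique)
    show "(F \<longlongrightarrow> F c) (at_left c)" using cont[of c] by (simp add: isCont_def filterlim_at_split)
    have "\<forall>\<^sub>F x in at_left c. F x = 0" using zero by (auto simp: eventually_at_filter)
    then show "(F \<longlongrightarrow> 0) (at_left c)" by (rule tendsto_eventually)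
  qed simp
  show ge: "c \<le> Q F t" if "0 \<le> t" "t < 1" for t
    using that Q_in_support[OF cdf, of t] supp by (cases "t = 0") (auto simp: Q_def)
  show "F (Q F t) = t" if t: "0 \<le> t" "t < 1" for t
  proof (cases "t = 0")
    case True
    then show ?thesis using c0 supp by (simp add: Q_def)
  next
    case False
    then have t: "0 < t" "t < 1" using t by auto
    have "F (Q F t) \<le> t"
    proof (rule tendsto_upperbound)
      show "(F \<longlongrightarrow> F (Q F t)) (at_left (Q F t))"
        using cont[OF ge] t by (simp add: isCont_def filterlim_at_split)
      have "F x \<le> t" if "x < Q F t" for x using Q_le_iff[OF cdf t, of x] that by auto
      then show "\<forall>\<^sub>F x in at_left (Q F t). F x \<le> t" by (auto simp: eventually_at_filter)
    qed simp
    then show ?thesis using Q_le_iff[OF cdf t, of "Q F t"] by simp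
  qed
qed

section \<open>Comparison of the combination statistic with power sums\<close>

text \<open>Monotone functions that converge pointwise to a continuous function on a compact interval converge
  uniformly.\<close>

lemma mono_pointwise_imp_uniform:
  fixes f :: "'b \<Rightarrow> real \<Rightarrow> real" and h :: "real \<Rightarrow> real"
  assumes h: "continuous_on {a..b} h"
    and lim: "\<And>y. y \<in> {a..b} \<Longrightarrow> ((\<lambda>x. f x y) \<longlongrightarrow> h y) F"
    and mono: "\<forall>\<^sub>F x in F. mono_on {a..b} (f x)"
    and e: "0 < e"
  shows "\<forall>\<^sub>F x in F. \<forall>y\<in>{a..b}. \<bar>f x y - h y\<bar> < e"
proof -
  have "uniformly_continuous_on {a..b} h"
    using h by (intro compact_uniformly_continuous) auto
  then obtain d where d: "0 < d" and close: "\<And>y z. y \<in> {a..b} \<Longrightarrow> z \<in> {a..b} \<Longrightarrow> \<bar>y - z\<bar> < d \<Longrightarrow> \<bar>h y - h z\<bar> < e / 2"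
    unfolding uniformly_continuous_on_def dist_real_def using e by (metis half_gt_zero)
  define \<delta> where "\<delta> = d / 2"
  have \<delta>: "0 < \<delta>" "\<delta> < d" using d by (auto simp: \<delta>_def)
  define N where "N = nat \<lceil>(b - a) / \<delta>\<rceil>"
  define G where "G = insert b ((\<lambda>k. a + real k * \<delta>) ` {..N}) \<inter> {a..b}"
  have "\<forall>\<^sub>F x in F. \<forall>s\<in>G. \<bar>f x s - h s\<bar> < e / 2"
  proof (subst eventually_ball_finite_distrib)
    show "\<forall>s\<in>G. \<forall>\<^sub>F x in F. \<bar>f x s - h s\<bar> < e / 2"
      using tendstoD[OF lim, of _ "e / 2"] e by (auto simp: G_def dist_real_def)
  qed (simp add: G_def)
  then show ?thesis
    using mono
  proof eventually_elim
    case (elim x)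
    show ?case
    proof
      fix y assume y: "y \<in> {a..b}"
      define k where "k = nat \<lfloor>(y - a) / \<delta>\<rfloor>"
      have k0: "0 \<le> (y - a) / \<delta>" using y \<delta> by auto
      have kr: "real k = of_int \<lfloor>(y - a) / \<delta>\<rfloor>" using k0 by (simp add: k_def)
      have "real k \<le> (y - a) / \<delta>" "(y - a) / \<delta> < real k + 1" unfolding kr by linarith+
      then have ky: "a + real k * \<delta> \<le> y" "y < a + real (Suc k) * \<delta>"
        using \<delta> by (auto simp: pos_le_divide_eq pos_divide_less_eq algebra_simps)
      have "(y - a) / \<delta> \<le> (b - a) / \<delta>" using y \<delta> by (intro divide_right_mono) auto
      then have "\<lfloor>(y - a) / \<delta>\<rfloor> \<le> \<lceil>(b - a) / \<delta>\<rceil>" by linarith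
      then have kN: "k \<le> N" by (simp add: k_def N_def nat_mono)
      have low: "a + real k * \<delta> \<in> G" using ky y kN \<delta> by (auto simp: G_def)
      define u where "u = min b (a + real (Suc k) * \<delta>)"
      have u: "u \<in> G" "y \<le> u" "u - y < d"
      proof -
        show "y \<le> u" using ky y by (auto simp: u_def)
        show "u - y < d" using ky \<delta> by (auto simp: u_def min_def algebra_simps)
        show "u \<in> G"
        proof (cases "a + real (Suc k) * \<delta> \<le> b")
          case True
          then have "real (Suc k) \<le> (b - a) / \<delta>" using \<delta> by (simp add: pos_le_divide_eq)
          then have "Suc k \<le> N" unfolding N_def by linarith
          then show ?thesis using True \<delta> y
            by (auto simp: u_def G_def min_def intro!: image_eqI[of _ _ "Suc k"])
        next
          case False
          then show ?thesis using y by (auto simp: u_def G_def)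
        qed
      qed
      have sub: "a + real k * \<delta> \<in> {a..b}" "u \<in> {a..b}" using low u by (auto simp: G_def)
      have "f x y \<le> f x u" using elim(2) sub y u by (auto simp: mono_on_def)
      moreover have "\<bar>f x u - h u\<bar> < e / 2" using elim(1) u by blast
      moreover have "\<bar>h u - h y\<bar> < e / 2" using sub y u by (intro close) auto
      moreover have "f x (a + real k * \<delta>) \<le> f x y" using elim(2) sub(1) y ky(1) unfolding mono_on_def by blast
      moreover have "\<bar>f x (a + real k * \<delta>) - h (a + real k * \<delta>)\<bar> < e / 2" using elim(1) low by blast
      moreover have "\<bar>h (a + real k * \<delta>) - h y\<bar> < e / 2" using sub(1) y ky \<delta> by (intro close) (auto simp: algebra_simps)
      ultimately show "\<bar>f x y - h y\<bar> < e" unfolding abs_less_iff by linarith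
    qed
  qed
qed

text \<open>With \<open>y = Q F (1 - p) / (n * x)\<close> for \<open>p \<le> 1\<close> one has \<open>1 - F (n * x * y) = p\<close>, so \<open>z\<close> is the value at \<open>y\<close>
  of the function \<open>\<psi> x\<close> below. Regular variation says that \<open>\<psi> x\<close> converges to \<open>max y 0\<close> pointwise as
  \<open>x\<close> grows, and by monotonicity the convergence is uniform on compact intervals. For \<open>p > 1\<close> both
  \<open>y\<close> and \<open>z\<close> are small.\<close>

lemma RV_star_quantile_power:
  assumes F: "F \<in> RV_star \<gamma>" and \<gamma>: "0 < \<gamma>" and \<epsilon>: "0 < \<epsilon>" and n: "0 < (n :: real)"
  shows "\<forall>\<^sub>F x in at_top. \<forall>p>0. \<forall>y z. y = Q F (max 0 (1 - p)) / (n * x) \<longrightarrow>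
     z = (n powr (- \<gamma>) * (1 - F x) / p) powr (1 / \<gamma>) \<longrightarrow>
     - \<epsilon> \<le> y \<and> \<bar>min (max y 0) 2 - min z 2\<bar> \<le> 2 * \<epsilon>"
proof -
  obtain c where supp: "cdf_support F = {c..}" using F by (auto simp: RV_star_def)
  have RV: "F \<in> RV \<gamma>" and cdf: "is_cdf F" using F by (auto simp: RV_star_def RV_def)
  note Fc = is_cdf_facts[OF cdf]
  note less1 = RV_less_1[OF RV]
  note q = RV_star_quantile[OF F supp]
  define \<psi> where "\<psi> x y = (n powr (- \<gamma>) * (1 - F x) / (1 - F (n * x * y))) powr (1 / \<gamma>)" for x y
  have F_top: "((\<lambda>x. 1 - F x) \<longlongrightarrow> 0) at_top" using tendsto_diff[OF tendsto_const Fc(2), of 1] by simp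
  have lim: "((\<lambda>x. \<psi> x y) \<longlongrightarrow> max y 0) at_top" for y
  proof (cases "0 < y")
    case True
    have "((\<lambda>x. (1 - F (x * (n * y))) / (1 - F x)) \<longlongrightarrow> (n * y) powr (- \<gamma>)) at_top"
      using RV True n by (auto simp: RV_def)
    from tendsto_inverse[OF this]
    have "((\<lambda>x. (1 - F x) / (1 - F (n * x * y))) \<longlongrightarrow> (n * y) powr \<gamma>) at_top"
      using True n by (simp add: powr_minus mult_ac)
    from tendsto_powr[OF tendsto_mult[OF tendsto_const[of "n powr (- \<gamma>)"] this] tendsto_const[of "1 / \<gamma>"]]
    have "((\<lambda>x. \<psi> x y) \<longlongrightarrow> (n powr (- \<gamma>) * (n * y) powr \<gamma>) powr (1 / \<gamma>)) at_top"
      using True n by (simp add: \<psi>_def)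
    moreover have "n powr (- \<gamma>) * (n * y) powr \<gamma> = y powr \<gamma>"
      using n by (simp add: powr_mult powr_minus)
    ultimately show ?thesis using True \<gamma> by (simp add: powr_powr)
  next
    case False
    have "((\<lambda>x. \<psi> x y) \<longlongrightarrow> 0) at_top"
    proof (rule tendsto_sandwich)
      show "\<forall>\<^sub>F x in at_top. 0 \<le> \<psi> x y" by (simp add: \<psi>_def)
      show "\<forall>\<^sub>F x in at_top. \<psi> x y \<le> (n powr (- \<gamma>) * (1 - F x) / (1 - F 0)) powr (1 / \<gamma>)"
        using eventually_ge_at_top[of 0]
      proof eventually_elim
        case (elim x)
        have "n * x * y \<le> 0" using False elim n by (intro mult_nonneg_nonpos) auto
        then have "1 - F 0 \<le> 1 - F (n * x * y)" using monoD[OF Fc(1), of "n * x * y" 0] by simp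
        then show ?case
          unfolding \<psi>_def using less1[of x] less1[of 0] less1[of "n * x * y"] \<gamma> 
          by (intro powr_mono2 divide_left_mono divide_nonneg_pos mult_nonneg_nonneg mult_pos_pos) auto
      qed
      have "((\<lambda>x. n powr (- \<gamma>) * (1 - F x) / (1 - F 0)) \<longlongrightarrow> n powr (- \<gamma>) * 0 / (1 - F 0)) at_top"
        using less1[of 0] by (intro tendsto_divide tendsto_mult tendsto_const F_top) auto
      then have "((\<lambda>x. n powr (- \<gamma>) * (1 - F x) / (1 - F 0)) \<longlongrightarrow> 0) at_top" by simp
      then show "((\<lambda>x. (n powr (- \<gamma>) * (1 - F x) / (1 - F 0)) powr (1 / \<gamma>)) \<longlongrightarrow> 0) at_top"
      proof (rule tendsto_zero_powrI[OF _ tendsto_const])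
        have "0 \<le> n powr (- \<gamma>) * (1 - F x) / (1 - F 0)" for x
          using less1[of x] less1[of 0] by (intro divide_nonneg_pos mult_nonneg_nonneg) auto
        then show "\<forall>\<^sub>F x in at_top. 0 \<le> n powr (- \<gamma>) * (1 - F x) / (1 - F 0)" by simp
      qed (use \<gamma> in auto)
    qed simp
    then show ?thesis using False by (simp add: max_def)
  qed
  have mono: "\<psi> x y \<le> \<psi> x z" if "0 \<le> x" "y \<le> z" for x y z
  proof -
    have "F (n * x * y) \<le> F (n * x * z)"
      using that n by (intro monoD[OF Fc(1)] mult_left_mono) auto
    then show ?thesis
      unfolding \<psi>_def using less1[of x] less1[of "n * x * y"] less1[of "n * x * z"] \<gamma>
      by (intro powr_mono2 divide_left_mono divide_nonneg_pos mult_nonneg_nonneg mult_pos_pos) auto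
  qed
  have unif: "\<forall>\<^sub>F x in at_top. \<forall>y\<in>{-1..2}. \<bar>\<psi> x y - max y 0\<bar> < \<epsilon>"
  proof (rule mono_pointwise_imp_uniform)
    show "continuous_on {-1..2} (\<lambda>y::real. max y 0)" by (intro continuous_intros)
    show "\<forall>\<^sub>F x in at_top. mono_on {-1..2} (\<psi> x)"
      using eventually_ge_at_top[of 0] by eventually_elim (auto simp: mono_on_def intro: mono)
  qed (use lim \<epsilon> in auto)
  define \<epsilon>' where "\<epsilon>' = min \<epsilon> 1"
  have \<epsilon>': "0 < \<epsilon>'" "\<epsilon>' \<le> \<epsilon>" "\<epsilon>' \<le> 1" using \<epsilon> by (auto simp: \<epsilon>'_def)
  have "((\<lambda>x. c / (n * x)) \<longlongrightarrow> 0) at_top"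
    using n by (intro tendsto_divide_0[OF tendsto_const] filterlim_at_top_imp_at_infinity
      filterlim_tendsto_pos_mult_at_top[OF tendsto_const] filterlim_ident) auto
  then have "\<forall>\<^sub>F x in at_top. \<bar>c / (n * x)\<bar> < \<epsilon>'"
    using \<epsilon>' by (simp add: tendsto_iff)
  with unif show ?thesis
    using eventually_gt_at_top[of 0]
  proof eventually_elim
    case (elim x)
    show ?case
    proof (intro allI impI)
      fix p y z :: real
      assume p: "0 < p" and y: "y = Q F (max 0 (1 - p)) / (n * x)"
        and z: "z = (n powr (- \<gamma>) * (1 - F x) / p) powr (1 / \<gamma>)"
      have nx: "0 < n * x" using elim n by simp
      have "c \<le> Q F (max 0 (1 - p))" using q(3)[of "max 0 (1 - p)"] p by auto
      then have "c / (n * x) \<le> y" unfolding y using nx by (intro divide_right_mono) auto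
      then have y_ge: "- \<epsilon>' \<le> y" using elim(2) by linarith
      have nxy: "n * x * y = Q F (max 0 (1 - p))" unfolding y times_divide_eq_right
        by (rule nonzero_mult_div_cancel_left) (rule less_imp_neq[OF nx, symmetric])
      show "- \<epsilon> \<le> y \<and> \<bar>min (max y 0) 2 - min z 2\<bar> \<le> 2 * \<epsilon>"
      proof (cases "p \<le> 1")
        case True
        then have "1 - F (n * x * y) = p" unfolding nxy using q(4)[of "max 0 (1 - p)"] p by simp
        then have z\<psi>: "z = \<psi> x y" by (simp add: \<psi>_def z)
        show ?thesis
        proof (cases "y \<le> 2")
          case True
          then have "\<bar>z - max y 0\<bar> < \<epsilon>" unfolding z\<psi> using elim(1) y_ge \<epsilon>' by auto
          then show ?thesis using y_ge \<epsilon>' by (auto simp: min_def max_def abs_if split: if_splits)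
        next
          case False
          have "\<bar>\<psi> x 2 - max 2 0\<bar> < \<epsilon>" using bspec[OF elim(1), of 2] by simp
          moreover have "\<psi> x 2 \<le> z" unfolding z\<psi> using mono[of x 2 y] elim False by auto
          ultimately show ?thesis using False y_ge \<epsilon>' by (auto simp: min_def max_def abs_if split: if_splits)
        qed
      next
        case False
        then have yc: "y = c / (n * x)" using supp by (simp add: y Q_def)
        have "F (n * x * y) = 0" unfolding nxy using False q(1) supp by (simp add: Q_def)
        then have "z \<le> \<psi> x y"
          unfolding z \<psi>_def using False less1[of x] \<gamma>
          by (intro powr_mono2 divide_left_mono divide_nonneg_pos mult_nonneg_nonneg) auto
        moreover have y1: "\<bar>y\<bar> < \<epsilon>'" using elim(2) yc by simp
        have "y \<in> {-1..2}" using y1 \<epsilon>'(3) by (simp add: abs_less_iff)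
        then have "\<bar>\<psi> x y - max y 0\<bar> < \<epsilon>" using elim(1) by blast
        moreover have "0 \<le> z" by (simp add: z)
        ultimately show ?thesis using y1 \<epsilon>' by (auto simp: min_def max_def abs_if split: if_splits)
      qed
    qed
  qed
qed

text \<open>For comparing sums with a level close to 1 it suffices to compare the terms truncated at 2.\<close>

lemma truncated_sum_comparison:
  fixes y z :: "'i \<Rightarrow> real"
  assumes I: "finite I" and \<epsilon>: "0 \<le> \<epsilon>" "3 * real (card I) * \<epsilon> \<le> 1"
    and y: "\<And>i. i \<in> I \<Longrightarrow> - \<epsilon> \<le> y i" and z: "\<And>i. i \<in> I \<Longrightarrow> 0 \<le> z i"
    and yz: "\<And>i. i \<in> I \<Longrightarrow> \<bar>min (max (y i) 0) 2 - min (z i) 2\<bar> \<le> 2 * \<epsilon>"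
  shows "1 \<le> (\<Sum>i\<in>I. y i) \<Longrightarrow> 1 - 2 * real (card I) * \<epsilon> \<le> (\<Sum>i\<in>I. z i)"
    and "1 + 3 * real (card I) * \<epsilon> \<le> (\<Sum>i\<in>I. z i) \<Longrightarrow> 1 \<le> (\<Sum>i\<in>I. y i)"
proof -
  have trunc: "min (\<Sum>i\<in>I. u i) 2 \<le> (\<Sum>i\<in>I. min (u i) 2)" if "\<And>i. i \<in> I \<Longrightarrow> 0 \<le> u i" for u :: "'i \<Rightarrow> real"
  proof (cases "\<exists>i\<in>I. 2 \<le> u i")
    case True
    then obtain i where i: "i \<in> I" "2 \<le> u i" by auto
    have "min (u i) 2 \<le> (\<Sum>i\<in>I. min (u i) 2)" using i I that by (intro member_le_sum) auto
    then show ?thesis using i by auto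
  next
    case False
    then have "(\<Sum>i\<in>I. min (u i) 2) = (\<Sum>i\<in>I. u i)" by (intro sum.cong) auto
    then show ?thesis by simp
  qed
  show "1 - 2 * real (card I) * \<epsilon> \<le> (\<Sum>i\<in>I. z i)" if "1 \<le> (\<Sum>i\<in>I. y i)"
  proof -
    have "(\<Sum>i\<in>I. y i) \<le> (\<Sum>i\<in>I. max (y i) 0)" by (intro sum_mono) auto
    then have "1 \<le> min (\<Sum>i\<in>I. max (y i) 0) 2" using that by simp
    also have "\<dots> \<le> (\<Sum>i\<in>I. min (max (y i) 0) 2)" by (intro trunc) auto
    also have "\<dots> \<le> (\<Sum>i\<in>I. z i + 2 * \<epsilon>)" using yz by (intro sum_mono) (fastforce simp: abs_le_iff min_le_iff_disj)
    also have "\<dots> = (\<Sum>i\<in>I. z i) + 2 * real (card I) * \<epsilon>" by (simp add: sum.distrib)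
    finally show ?thesis by simp
  qed
  show "1 \<le> (\<Sum>i\<in>I. y i)" if "1 + 3 * real (card I) * \<epsilon> \<le> (\<Sum>i\<in>I. z i)"
  proof -
    have "1 + 3 * real (card I) * \<epsilon> \<le> min (\<Sum>i\<in>I. z i) 2" using that \<epsilon> by simp
    also have "\<dots> \<le> (\<Sum>i\<in>I. min (z i) 2)" using z by (intro trunc) auto
    also have "\<dots> \<le> (\<Sum>i\<in>I. y i + 3 * \<epsilon>)"
    proof (rule sum_mono)
      fix i assume i: "i \<in> I"
      show "min (z i) 2 \<le> y i + 3 * \<epsilon>" using yz[OF i] y[OF i] \<epsilon>(1) by (auto simp: abs_le_iff min_def max_def split: if_splits)
    qed
    also have "\<dots> = (\<Sum>i\<in>I. y i) + 3 * real (card I) * \<epsilon>" by (simp add: sum.distrib)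
    finally show ?thesis by simp
  qed
qed

context rv_pvalues
begin

lemma n_pos: "0 < n"
  using c_pos by auto

text \<open>The critical value \<open>X t\<close> of the mean is chosen such that \<open>1 - F (X t) = t * n powr \<gamma>\<close>. In the
  comparison with power functions, the factor \<open>n powr \<gamma>\<close> cancels against the one from dividing the
  sum by \<open>n\<close>.\<close>

lemma P_comb_sandwich:
  assumes F: "F \<in> RV_star \<gamma>" and \<gamma>: "0 < \<gamma>" and \<theta>: "1 < \<theta>"
  shows "\<forall>\<^sub>F t in at_right 0. sum_tail \<gamma> (inverse \<theta> * t) \<le> prob {x \<in> space M. P_comb n w \<gamma> F P x \<le> real n * t} \<and>
     prob {x \<in> space M. P_comb n w \<gamma> F P x \<le> real n * t} \<le> sum_tail \<gamma> (\<theta> * t)"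
proof -
  obtain c where supp: "cdf_support F = {c..}" using F by (auto simp: RV_star_def)
  have RV: "F \<in> RV \<gamma>" and cdf: "is_cdf F" using F by (auto simp: RV_star_def RV_def)
  note Fc = is_cdf_facts[OF cdf]
  note less1 = RV_less_1[OF RV]
  note q = RV_star_quantile[OF F supp]
  have n: "0 < real n" using n_pos by simp
  \<comment> \<open>the errors allowed by the comparison of truncated sums must be covered by the factor \<open>\<theta>\<close>\<close>
  define \<epsilon> where "\<epsilon> = min (1 / (3 * n)) (min ((1 - inverse \<theta> powr (1 / \<gamma>)) / (2 * n)) ((\<theta> powr (1 / \<gamma>) - 1) / (3 * n)))"
  have \<theta>1: "inverse \<theta> powr (1 / \<gamma>) < 1" "1 < \<theta> powr (1 / \<gamma>)"
  proof -
    show *: "1 < \<theta> powr (1 / \<gamma>)" using \<theta> \<gamma> by (intro gr_one_powr) auto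
    show "inverse \<theta> powr (1 / \<gamma>) < 1" using * \<theta> by (simp add: inverse_powr inverse_less_1_iff)
  qed
  then have \<theta>_pos: "0 < \<theta> powr (1 / \<gamma>)" by linarith
  have \<epsilon>: "0 < \<epsilon>" using n \<theta>1 by (simp add: \<epsilon>_def)
  have "\<epsilon> \<le> 1 / (3 * n)" "\<epsilon> \<le> (1 - inverse \<theta> powr (1 / \<gamma>)) / (2 * n)" "\<epsilon> \<le> (\<theta> powr (1 / \<gamma>) - 1) / (3 * n)"
    by (auto simp: \<epsilon>_def)
  then have \<epsilon>n: "3 * real n * \<epsilon> \<le> 1" "inverse \<theta> powr (1 / \<gamma>) \<le> 1 - 2 * real n * \<epsilon>" "1 + 3 * real n * \<epsilon> \<le> \<theta> powr (1 / \<gamma>)"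
    using n by (simp_all add: pos_le_divide_eq algebra_simps)
  have inv: "inverse \<theta> powr (1 / \<gamma>) = inverse (\<theta> powr (1 / \<gamma>))" using \<theta> by (simp add: inverse_powr)
  define X where "X t = Q F (1 - t * real n powr \<gamma>)" for t
  have small: "\<forall>\<^sub>F t in at_right 0. t * real n powr \<gamma> < d" if "0 < d" for d
  proof (rule order_tendstoD)
    show "((\<lambda>t. t * real n powr \<gamma>) \<longlongrightarrow> 0) (at_right 0)" by (auto intro!: tendsto_eq_intros)
  qed (rule that)
  have X: "c \<le> X t" "1 - F (X t) = t * real n powr \<gamma>" if "0 < t" "t * real n powr \<gamma> < 1" for t
    using q(3,4)[of "1 - t * real n powr \<gamma>"] that n by (auto simp: X_def)
  have X_top: "filterlim X at_top (at_right 0)"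
    unfolding filterlim_at_top
  proof
    fix K
    have K: "0 < 1 - F K" using less1[of K] by simp
    show "\<forall>\<^sub>F t in at_right 0. K \<le> X t"
      using small[OF zero_less_one] small[OF K]
        eventually_at_right_less[of "0::real"]
    proof eventually_elim
      case (elim t)
      then have "F K < F (X t)" using X(2)[of t] by linarith
      then show ?case using monoD[OF Fc(1), of "X t" K] by (meson linorder_not_le order_less_imp_le)
    qed
  qed
  have Fmeas[measurable]: "F \<in> borel_measurable borel"
    using Fc(1) by (rule borel_measurable_mono)
  have Xbar_meas[measurable]: "X_bar n w F P \<in> borel_measurable M"
  proof -
    have "(\<lambda>x. Q F (max 0 (1 - P i x / w i))) \<in> borel_measurable M" if i: "i \<in> {1..n}" for i
    proof (rule Q_measurable[OF cdf])
      show "(\<lambda>x. max 0 (1 - P i x / w i)) \<in> borel_measurable M" using i by measurable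
      show "max 0 (1 - P i x / w i) \<in> {0..1}" if "x \<in> space M" for x
        using P_01[OF i that] w_pos[OF i] by auto
    qed
    then show ?thesis unfolding X_bar_def by (intro borel_measurable_times borel_measurable_sum) auto
  qed
  have meas: "{x \<in> space M. P_comb n w \<gamma> F P x \<le> a} \<in> events" for a
    unfolding P_comb_def by measurable
  have ev: "\<forall>\<^sub>F t in at_right 0. \<forall>p>0. \<forall>y z. y = Q F (max 0 (1 - p)) / (real n * X t) \<longrightarrow>
     z = (n powr (- \<gamma>) * (1 - F (X t)) / p) powr (1 / \<gamma>) \<longrightarrow>
     - \<epsilon> \<le> y \<and> \<bar>min (max y 0) 2 - min z 2\<bar> \<le> 2 * \<epsilon>"
    using eventually_compose_filterlim[OF RV_star_quantile_power[OF F \<gamma> \<epsilon> n] X_top] .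
  have X_pos: "\<forall>\<^sub>F t in at_right 0. 0 < X t"
    using X_top by (simp add: filterlim_at_top_dense)
  have t1: "\<forall>\<^sub>F t in at_right 0. real n * t < 1"
  proof (rule order_tendstoD)
    show "((\<lambda>t. real n * t) \<longlongrightarrow> 0) (at_right 0)" by (auto intro!: tendsto_eq_intros)
  qed simp
  show ?thesis
    using ev X_pos t1 small[OF zero_less_one] eventually_at_right_less[of "0::real"]
  proof eventually_elim
    case (elim t)
    note t = \<open>0 < t\<close>
    note Xt = X[OF elim(5,4)]
    let ?Y = "\<lambda>i x. Q F (max 0 (1 - P i x / w i)) / (real n * X t)"
    let ?z = "\<lambda>i x. (t * (w i / P i x)) powr (1 / \<gamma>)"
    have comb: "P_comb n w \<gamma> F P x \<le> real n * t \<longleftrightarrow> 1 \<le> (\<Sum>i=1..n. ?Y i x)"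
      if x: "x \<in> space M" "\<forall>i\<in>{1..n}. 0 < P i x" for x
    proof -
      have Y: "c \<le> Q F (max 0 (1 - P i x / w i))" if i: "i \<in> {1..n}" for i
      proof (rule q(3))
        have "0 < P i x / w i" using x(2) i w_pos[OF i] by simp
        then show "max 0 (1 - P i x / w i) < 1" by auto
      qed simp
      have "(\<Sum>i=1..n. c) \<le> (\<Sum>i=1..n. Q F (max 0 (1 - P i x / w i)))"
        using Y by (intro sum_mono) auto
      then have Xb: "c \<le> X_bar n w F P x" using n by (simp add: X_bar_def field_simps)
      have "P_comb n w \<gamma> F P x \<le> real n * t \<longleftrightarrow> real n powr (1 - \<gamma>) * (1 - F (X_bar n w F P x)) \<le> real n * t"
        using elim(3) by (auto simp: P_comb_def min_le_iff_disj)
      also have "\<dots> \<longleftrightarrow> 1 - F (X_bar n w F P x) \<le> t * real n powr \<gamma>"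
      proof -
        have "real n powr (1 - \<gamma>) * (1 - F (X_bar n w F P x)) = real n * ((1 - F (X_bar n w F P x)) / real n powr \<gamma>)"
          using n by (simp add: powr_diff)
        then show ?thesis
          using n by (simp only: mult_le_cancel_left_pos pos_divide_le_eq powr_gt_zero)
      qed
      also have "\<dots> \<longleftrightarrow> F (X t) \<le> F (X_bar n w F P x)"
        using Xt(2) by linarith
      also have "\<dots> \<longleftrightarrow> X t \<le> X_bar n w F P x"
        using strict_mono_on_less_eq[OF q(2)] Xt(1) Xb by auto
      also have "\<dots> \<longleftrightarrow> 1 \<le> (\<Sum>i=1..n. ?Y i x)"
        using n elim(2) by (simp add: X_bar_def sum_divide_distrib[symmetric] field_simps)
      finally show ?thesis .
    qed
    have cmp: "- \<epsilon> \<le> ?Y i x \<and> \<bar>min (max (?Y i x) 0) 2 - min (?z i x) 2\<bar> \<le> 2 * \<epsilon>"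
      if x: "x \<in> space M" "\<forall>i\<in>{1..n}. 0 < P i x" and i: "i \<in> {1..n}" for x i
    proof (rule elim(1)[rule_format, of "P i x / w i"])
      show "0 < P i x / w i" using x(2) i w_pos[OF i] by simp
      have "real n powr (- \<gamma>) * (1 - F (X t)) = t" using n by (simp add: Xt(2) powr_minus)
      then show "?z i x = (real n powr (- \<gamma>) * (1 - F (X t)) / (P i x / w i)) powr (1 / \<gamma>)" by simp
    qed simp
    have "sum_tail \<gamma> (inverse \<theta> * t) \<le> prob {x \<in> space M. P_comb n w \<gamma> F P x \<le> real n * t}"
      unfolding sum_tail_def
    proof (rule finite_measure_mono_AE[OF _ meas])
      show "AE x in M. x \<in> {x \<in> space M. 1 \<le> ratio_sum \<gamma> (inverse \<theta> * t) x} \<longrightarrow>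
          x \<in> {x \<in> space M. P_comb n w \<gamma> F P x \<le> real n * t}"
        using AE_P_pos AE_space
      proof eventually_elim
        case (elim x)
        note x = elim(2,1)
        have "P_comb n w \<gamma> F P x \<le> real n * t" if 1: "1 \<le> ratio_sum \<gamma> (inverse \<theta> * t) x"
        proof -
          have "1 \<le> inverse \<theta> powr (1 / \<gamma>) * ratio_sum \<gamma> t x"
            using 1 ratio_sum_scale[of "inverse \<theta>" t x \<gamma>] \<theta> t x by simp
          then have "\<theta> powr (1 / \<gamma>) \<le> ratio_sum \<gamma> t x"
            using \<theta>_pos unfolding inv by (simp add: field_simps)
          then have "1 + 3 * real (card {1..n}) * \<epsilon> \<le> (\<Sum>i=1..n. ?z i x)"
            using \<epsilon>n(3) by (simp add: ratio_sum_def)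
          then have "1 \<le> (\<Sum>i=1..n. ?Y i x)"
          proof (rule truncated_sum_comparison(2)[rotated -1])
            fix i assume i: "i \<in> {1..n}"
            show "- \<epsilon> \<le> ?Y i x" "\<bar>min (max (?Y i x) 0) 2 - min (?z i x) 2\<bar> \<le> 2 * \<epsilon>"
              using cmp[OF x i] by blast+
          qed (use \<epsilon> \<epsilon>n(1) in simp_all)
          then show ?thesis using comb[OF x] by simp
        qed
        then show ?case by auto
      qed
    qed
    moreover have "prob {x \<in> space M. P_comb n w \<gamma> F P x \<le> real n * t} \<le> sum_tail \<gamma> (\<theta> * t)"
      unfolding sum_tail_def
    proof (rule finite_measure_mono_AE)
      show "AE x in M. x \<in> {x \<in> space M. P_comb n w \<gamma> F P x \<le> real n * t} \<longrightarrow>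
          x \<in> {x \<in> space M. 1 \<le> ratio_sum \<gamma> (\<theta> * t) x}"
        using AE_P_pos AE_space
      proof eventually_elim
        case (elim x)
        note x = elim(2,1)
        have "1 \<le> ratio_sum \<gamma> (\<theta> * t) x" if 1: "P_comb n w \<gamma> F P x \<le> real n * t"
        proof -
          have "1 \<le> (\<Sum>i=1..n. ?Y i x)" using comb[OF x] 1 by simp
          then have "1 - 2 * real (card {1..n}) * \<epsilon> \<le> (\<Sum>i=1..n. ?z i x)"
          proof (rule truncated_sum_comparison(1)[rotated -1])
            fix i assume i: "i \<in> {1..n}"
            show "- \<epsilon> \<le> ?Y i x" "\<bar>min (max (?Y i x) 0) 2 - min (?z i x) 2\<bar> \<le> 2 * \<epsilon>"
              using cmp[OF x i] by blast+
          qed (use \<epsilon> \<epsilon>n(1) in simp_all)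
          then have "inverse \<theta> powr (1 / \<gamma>) \<le> ratio_sum \<gamma> t x"
            using \<epsilon>n(2) by (simp add: ratio_sum_def)
          then have "1 \<le> \<theta> powr (1 / \<gamma>) * ratio_sum \<gamma> t x"
            using \<theta>_pos unfolding inv by (simp add: field_simps)
          then show ?thesis
            using ratio_sum_scale[of \<theta> t x \<gamma>] \<theta> t x by simp
        qed
        then show ?case by auto
      qed
    qed measurable
    ultimately show ?case by blast
  qed
qed

lemma scaled_power_tendsto:
  assumes F: "F \<in> RV_star \<gamma>" and \<gamma>: "0 < \<gamma>"
  shows "((\<lambda>\<alpha>. scaled_power M n w P \<gamma> F \<alpha>) \<longlongrightarrow> power_limit \<gamma> / total_limit) (at_right 0)"
proof -
  let ?f = "\<lambda>t. prob {x \<in> space M. P_comb n w \<gamma> F P x \<le> real n * t}"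
  have "((\<lambda>t. ?f t / g t) \<longlongrightarrow> power_limit \<gamma>) (at_right 0)"
    by (rule reg_var0_sandwich[OF g_rv sum_tail_tendsto[OF \<gamma>] P_comb_sandwich[OF F \<gamma>]])
  from tendsto_divide[OF this total_tail_tendsto] total_limit_pos
  have 1: "((\<lambda>t. (?f t / g t) / (total_tail t / g t)) \<longlongrightarrow> power_limit \<gamma> / total_limit) (at_right 0)"
    by simp
  have "\<forall>\<^sub>F t in at_right 0. (?f t / g t) / (total_tail t / g t) = ?f t / total_tail t"
    using eventually_at_right_less[of "0::real"]
  proof eventually_elim
    case (elim t)
    then show ?case using g_pos[of t] by simp
  qed
  from Lim_transform_eventually[OF 1 this]
  have 2: "((\<lambda>t. ?f t / total_tail t) \<longlongrightarrow> power_limit \<gamma> / total_limit) (at_right 0)" .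
  have "filterlim (\<lambda>\<alpha>. inverse (real n) * \<alpha>) (at_right 0) (at_right 0)"
    using n_pos by (intro filterlim_mult_at_right_0) simp
  from filterlim_compose[OF 2 this]
  show ?thesis
    using n_pos by (simp add: scaled_power_def total_tail_def field_simps)
qed

end

section \<open>Asymptotic independence\<close>

context rv_pvalues
begin

text \<open>The indices whose p-values have tails of the same order as \<open>g\<close>.\<close>

definition leading :: "nat set" where
  "leading = {i \<in> {1..n}. 0 < c i}"

lemma joint_tail_null:
  assumes i: "i \<in> {1..n}" and j: "j \<in> {1..n}" and b: "0 \<le> b" "0 \<le> b'"
    and c0: "i \<notin> leading \<or> j \<notin> leading"
  shows "((\<lambda>t. joint_tail i j b b' t / g t) \<longlongrightarrow> 0) (at_right 0)"
proof -
  have [measurable]: "P i \<in> borel_measurable M" "P j \<in> borel_measurable M" using i j by auto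
  obtain k d where k: "k \<in> {1..n}" "0 \<le> d" "c k = 0"
    and le: "\<And>t. joint_tail i j b b' t \<le> prob {x \<in> space M. P k x < d * t}"
  proof (cases "i \<in> leading")
    case False
    then have "c i = 0" using c_nonneg[OF i] i by (auto simp: leading_def)
    moreover have "joint_tail i j b b' t \<le> prob {x \<in> space M. P i x < b * t}" for t
      unfolding joint_tail_def by (intro finite_measure_mono) auto
    ultimately show ?thesis using that[of i b] i b by blast
  next
    case True
    then have "c j = 0" using c_nonneg[OF j] c0 j by (auto simp: leading_def)
    moreover have "joint_tail i j b b' t \<le> prob {x \<in> space M. P j x < b' * t}" for t
      unfolding joint_tail_def by (intro finite_measure_mono) auto
    ultimately show ?thesis using that[of j b'] j b by blast
  qed
  have "((\<lambda>t. prob {x \<in> space M. P k x < d * t} / g t) \<longlongrightarrow> 0) (at_right 0)"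
    using tail_scaled[OF k(1,2)] k(3) by simp
  then show ?thesis
  proof (rule Lim_null_comparison[rotated])
    show "\<forall>\<^sub>F t in at_right 0. norm (joint_tail i j b b' t / g t) \<le> prob {x \<in> space M. P k x < d * t} / g t"
      using eventually_at_right_less[of "0::real"]
    proof eventually_elim
      case (elim t)
      then show ?case using g_pos[of t] le[of t] by (auto simp: joint_tail_def intro!: divide_right_mono)
    qed
  qed
qed

lemma tail_independent_if_card_le_1:
  assumes "card leading \<le> 1"
  shows "tail_independent"
  unfolding tail_independent_def
proof (intro ballI impI allI)
  fix i j b b' assume ij: "i \<in> {1..n}" "j \<in> {1..n}" "i \<noteq> j" and b: "(0::real) < b" "(0::real) < b'"
  have "i \<notin> leading \<or> j \<notin> leading"
    using assms ij card_le_Suc0_iff_eq[of leading] by (auto simp: leading_def)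
  then show "((\<lambda>t. joint_tail i j b b' t / g t) \<longlongrightarrow> 0) (at_right 0)"
    using ij b by (intro joint_tail_null) auto
qed

text \<open>The product as limiting copula forces the limit function of the copula to be the sum of the
  coordinates, so the probability of a union of two events \<open>P i < b * t\<close>, \<open>P j < b' * t\<close> is asymptotically
  the sum of their probabilities.\<close>

lemma tail_independent_if_asymp_independent:
  assumes "asymp_independent M leading (\<lambda>i x. 1 - P i x)"
  shows "tail_independent"
  unfolding tail_independent_def
proof (intro ballI impI allI)
  fix i j b b' assume i: "i \<in> {1..n}" and j: "j \<in> {1..n}" and ij: "i \<noteq> j" and b: "(0::real) < b" "(0::real) < b'"
  have fin: "finite leading" and sub: "leading \<subseteq> {1..n}" by (auto simp: leading_def)
  obtain C l where C: "is_copula_of M leading (\<lambda>i x. 1 - P i x) C" and cop: "is_copula leading C"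
    and l: "\<And>v. (\<forall>i\<in>leading. 0 \<le> v i) \<Longrightarrow>
        ((\<lambda>s. inverse s * copula_D C (\<lambda>i. s * v i)) \<longlongrightarrow> l v) (at_right 0)"
    and lim: "\<And>u. (\<forall>i\<in>leading. u i \<in> {0..1}) \<Longrightarrow>
        ((\<lambda>t::real. C (\<lambda>i. u i powr (1 / t)) powr t) \<longlongrightarrow> (\<Prod>i\<in>leading. u i)) at_top"
    using assms unfolding asymp_independent_def mrv_copula_def limiting_copula_def by blast
  have l_sum: "l v = (\<Sum>i\<in>leading. v i)" if v: "\<forall>i\<in>leading. 0 \<le> v i" for v
  proof -
    have "((\<lambda>t. C (\<lambda>i. exp (- v i) powr (1 / t)) powr t) \<longlongrightarrow> exp (- l v)) at_top"
      using v by (intro copula_powr_tendsto[OF cop fin _ l[OF v]]) auto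
    moreover have "((\<lambda>t. C (\<lambda>i. exp (- v i) powr (1 / t)) powr t) \<longlongrightarrow> (\<Prod>i\<in>leading. exp (- v i))) at_top"
      using v by (intro lim) auto
    ultimately have "exp (- l v) = (\<Prod>i\<in>leading. exp (- v i))"
      by (rule tendsto_unique[rotated]) simp
    also have "\<dots> = exp (- (\<Sum>i\<in>leading. v i))"
      using fin by (simp add: exp_sum sum_negf[symmetric])
    finally show ?thesis by simp
  qed
  show "((\<lambda>t. joint_tail i j b b' t / g t) \<longlongrightarrow> 0) (at_right 0)"
  proof (cases "i \<in> leading \<and> j \<in> leading")
    case False
    then show ?thesis using i j b by (intro joint_tail_null) auto
  next
    case True
    define d where "d k = (if k = i then b else if k = j then b' else 0)" for k
    have "((\<lambda>t. prob {x \<in> space M. \<exists>k\<in>leading. P k x < d k * t} / g t) \<longlongrightarrow> l (\<lambda>k. c k * d k powr \<beta>)) (at_right 0)"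
      using b c_nonneg sub by (intro union_tail[OF sub C] l) (auto simp: d_def)
    also have "l (\<lambda>k. c k * d k powr \<beta>) = (\<Sum>k\<in>leading. c k * d k powr \<beta>)"
      using c_nonneg sub by (intro l_sum) auto
    also have "\<dots> = (\<Sum>k\<in>{i, j}. c k * d k powr \<beta>)"
      using True fin by (intro sum.mono_neutral_right) (auto simp: d_def)
    also have "\<dots> = c i * b powr \<beta> + c j * b' powr \<beta>"
      using ij by (simp add: d_def)
    also have "(\<lambda>t. prob {x \<in> space M. \<exists>k\<in>leading. P k x < d k * t}) =
        (\<lambda>t. prob ({x \<in> space M. P i x < b * t} \<union> {x \<in> space M. P j x < b' * t}))"
    proof
      fix t
      have "{x \<in> space M. \<exists>k\<in>leading. P k x < d k * t} =
          {x \<in> space M. P i x < b * t} \<union> {x \<in> space M. P j x < b' * t}"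
      proof (safe, goal_cases)
        case (1 x k)
        then have "0 \<le> P k x" using P_01[of k x] sub by auto
        then show ?case using 1 by (auto simp: d_def split: if_splits)
      qed (use True ij in \<open>auto simp: d_def intro: bexI[of _ i] bexI[of _ j]\<close>)
      then show "prob {x \<in> space M. \<exists>k\<in>leading. P k x < d k * t} =
        prob ({x \<in> space M. P i x < b * t} \<union> {x \<in> space M. P j x < b' * t})" by simp
    qed
    finally have union: "((\<lambda>t. prob ({x \<in> space M. P i x < b * t} \<union> {x \<in> space M. P j x < b' * t}) / g t)
       \<longlongrightarrow> c i * b powr \<beta> + c j * b' powr \<beta>) (at_right 0)" .
    have "((\<lambda>t. prob {x \<in> space M. P i x < b * t} / g t + prob {x \<in> space M. P j x < b' * t} / g t
        - prob ({x \<in> space M. P i x < b * t} \<union> {x \<in> space M. P j x < b' * t}) / g t)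
        \<longlongrightarrow> c i * b powr \<beta> + c j * b' powr \<beta> - (c i * b powr \<beta> + c j * b' powr \<beta>)) (at_right 0)"
      using b by (intro tendsto_diff tendsto_add union tail_scaled i j) auto
    then show ?thesis
      by (simp add: joint_tail_eq[OF i j] add_divide_distrib diff_divide_distrib)
  qed
qed

lemma union_tail_sum_if_tail_independent:
  assumes ind: "tail_independent" and b: "\<And>i. i \<in> {1..n} \<Longrightarrow> 0 \<le> b i"
  shows "((\<lambda>t. prob {x \<in> space M. \<exists>i\<in>{1..n}. P i x < b i * t} / g t) \<longlongrightarrow>
     (\<Sum>i=1..n. c i * b i powr \<beta>)) (at_right 0)"
proof (rule tendsto_sandwich)
  let ?E = "\<lambda>i t. {x \<in> space M. P i x < b i * t}"
  have Un: "{x \<in> space M. \<exists>i\<in>{1..n}. P i x < b i * t} = (\<Union>i\<in>{1..n}. ?E i t)" for t by auto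
  have joint: "((\<lambda>t. joint_tail i j (b i) (b j) t / g t) \<longlongrightarrow> 0) (at_right 0)"
    if ij: "i \<in> {1..n}" "j \<in> {1..n}" "i \<noteq> j" for i j
  proof (cases "0 < b i \<and> 0 < b j")
    case True
    then show ?thesis using ind ij by (auto simp: tail_independent_def)
  next
    case False
    then have "b i = 0 \<or> b j = 0" using b[OF ij(1)] b[OF ij(2)] by auto
    then have "{x \<in> space M. P i x < b i * t \<and> P j x < b j * t} = {}" for t
      using P_01[OF ij(1)] P_01[OF ij(2)] by (auto simp: not_less)
    then have "joint_tail i j (b i) (b j) t = 0" for t unfolding joint_tail_def by (simp only: measure_empty)
    then show ?thesis by simp
  qed
  have sum: "((\<lambda>t. \<Sum>i=1..n. prob (?E i t) / g t) \<longlongrightarrow> (\<Sum>i=1..n. c i * b i powr \<beta>)) (at_right 0)"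
    using b by (intro tendsto_sum tail_scaled)
  have pairs: "((\<lambda>t. \<Sum>i=1..n. \<Sum>j\<in>{1..n} - {i}. joint_tail i j (b i) (b j) t / g t) \<longlongrightarrow> 0) (at_right 0)"
    using joint by (intro tendsto_null_sum) auto
  show "\<forall>\<^sub>F t in at_right 0. prob {x \<in> space M. \<exists>i\<in>{1..n}. P i x < b i * t} / g t \<le> (\<Sum>i=1..n. prob (?E i t) / g t)"
    using eventually_at_right_less[of "0::real"]
  proof eventually_elim
    case (elim t)
    have "prob (\<Union>i\<in>{1..n}. ?E i t) \<le> (\<Sum>i=1..n. prob (?E i t))"
      by (intro finite_measure_subadditive_finite) auto
    then show ?case
      unfolding Un sum_divide_distrib[symmetric] using g_pos[OF elim] by (intro divide_right_mono) auto
  qed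
  show "\<forall>\<^sub>F t in at_right 0. (\<Sum>i=1..n. prob (?E i t) / g t) -
      (\<Sum>i=1..n. \<Sum>j\<in>{1..n} - {i}. joint_tail i j (b i) (b j) t / g t) \<le>
      prob {x \<in> space M. \<exists>i\<in>{1..n}. P i x < b i * t} / g t"
    using eventually_at_right_less[of "0::real"]
  proof eventually_elim
    case (elim t)
    have "(\<Sum>i=1..n. prob (?E i t)) - (\<Sum>i=1..n. \<Sum>j\<in>{1..n} - {i}. prob (?E i t \<inter> ?E j t)) \<le> prob (\<Union>i\<in>{1..n}. ?E i t)"
      by (rule prob_union_ge_sum_minus_pairs) auto
    also have "(\<Sum>i=1..n. \<Sum>j\<in>{1..n} - {i}. prob (?E i t \<inter> ?E j t)) =
        (\<Sum>i=1..n. \<Sum>j\<in>{1..n} - {i}. joint_tail i j (b i) (b j) t)"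
      unfolding joint_tail_def by (intro sum.cong refl arg_cong[where f = prob]) auto
    finally show ?case
      unfolding Un sum_divide_distrib[symmetric] diff_divide_distrib[symmetric]
      using g_pos[OF elim] by (intro divide_right_mono) auto
  qed
  from tendsto_diff[OF sum pairs]
  show "((\<lambda>t. (\<Sum>i=1..n. prob (?E i t) / g t) -
      (\<Sum>i=1..n. \<Sum>j\<in>{1..n} - {i}. joint_tail i j (b i) (b j) t / g t)) \<longlongrightarrow> (\<Sum>i=1..n. c i * b i powr \<beta>)) (at_right 0)"
    by simp
  show "((\<lambda>t. \<Sum>i=1..n. prob (?E i t) / g t) \<longlongrightarrow> (\<Sum>i=1..n. c i * b i powr \<beta>)) (at_right 0)"
    by (rule sum)
qed

text \<open>The copula of the subvector is obtained by setting the other coordinates to 1. To see that its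
  limit function at \<open>v\<close> is the sum of the \<open>v i\<close>, thresholds \<open>b i\<close> are chosen with
  \<open>c i * b i powr \<beta> = v i\<close>.\<close>

lemma asymp_independent_if_tail_independent:
  assumes ind: "tail_independent"
  shows "asymp_independent M leading (\<lambda>i x. 1 - P i x)"
proof -
  have fin: "finite leading" and sub: "leading \<subseteq> {1..n}" by (auto simp: leading_def)
  obtain C l where C: "is_copula_of M {1..n} (\<lambda>i x. 1 - P i x) C"
    and l: "\<And>v. (\<forall>i\<in>{1..n}. 0 \<le> v i) \<Longrightarrow>
        ((\<lambda>s. inverse s * copula_D C (\<lambda>i. s * v i)) \<longlongrightarrow> l v) (at_right 0)"
    using mrv unfolding has_mrv_copula_def mrv_copula_def by blast
  have cop: "is_copula {1..n} C" using C by (simp add: is_copula_of_def)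
  define C' where "C' u = C (\<lambda>i. if i \<in> leading then u i else 1)" for u :: "nat \<Rightarrow> real"
  have cop': "is_copula leading C'"
    unfolding C'_def using is_copula_restrict[OF cop _ sub] by simp
  have of: "is_copula_of M leading (\<lambda>i x. 1 - P i x) C'"
    unfolding is_copula_of_def
  proof (intro conjI allI cop')
    fix y :: "nat \<Rightarrow> real"
    define y' where "y' i = (if i \<in> leading then y i else 1)" for i
    have P0: "0 \<le> P i x" if "i \<in> {1..n}" "x \<in> space M" for i x using P_01[OF that] by simp
    have "{x \<in> space M. \<forall>i\<in>leading. 1 - P i x \<le> y i} = {x \<in> space M. \<forall>i\<in>{1..n}. 1 - P i x \<le> y' i}"
    proof (intro Collect_cong conj_cong refl)
      fix x assume "x \<in> space M"
      then show "(\<forall>i\<in>leading. 1 - P i x \<le> y i) \<longleftrightarrow> (\<forall>i\<in>{1..n}. 1 - P i x \<le> y' i)"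
        using sub P0[of _ x] unfolding y'_def by (auto split: if_splits)
    qed
    then have "prob {x \<in> space M. \<forall>i\<in>leading. 1 - P i x \<le> y i} = C (\<lambda>i. prob {x \<in> space M. 1 - P i x \<le> y' i})"
      using C by (simp add: is_copula_of_def)
    also have "\<dots> = C (\<lambda>i. if i \<in> leading then prob {x \<in> space M. 1 - P i x \<le> y i} else 1)"
    proof (rule copula_cong[OF cop])
      fix i assume i: "i \<in> {1..n}"
      show "prob {x \<in> space M. 1 - P i x \<le> y' i} = (if i \<in> leading then prob {x \<in> space M. 1 - P i x \<le> y i} else 1)"
      proof (cases "i \<in> leading")
        case False
        then have "{x \<in> space M. 1 - P i x \<le> y' i} = space M" using P0[OF i] by (auto simp: y'_def)
        then show ?thesis using False prob_space by simp
      qed (simp add: y'_def)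
    qed simp
    finally show "prob {x \<in> space M. \<forall>i\<in>leading. 1 - P i x \<le> y i} = C' (\<lambda>i. prob {x \<in> space M. 1 - P i x \<le> y i})"
      by (simp add: C'_def)
  qed
  have D_lim: "((\<lambda>s. inverse s * copula_D C' (\<lambda>i. s * v i)) \<longlongrightarrow> (\<Sum>i\<in>leading. v i)) (at_right 0)"
    if v: "\<forall>i\<in>leading. 0 \<le> v i" for v
  proof -
    define v' where "v' i = (if i \<in> leading then v i else 0)" for i
    define b where "b i = (if i \<in> leading then (v i / c i) powr (1 / \<beta>) else 0)" for i
    have cb: "c i * b i powr \<beta> = v' i" for i
      using v beta_pos by (auto simp: b_def v'_def powr_powr leading_def)
    have Dv': "((\<lambda>s. inverse s * copula_D C (\<lambda>i. s * v' i)) \<longlongrightarrow> l v') (at_right 0)"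
      using v by (intro l) (auto simp: v'_def)
    have b0: "0 \<le> b i" for i by (simp add: b_def)
    have "l v' = (\<Sum>i=1..n. c i * b i powr \<beta>)"
    proof (rule tendsto_unique[OF _ union_tail[OF order_refl C] union_tail_sum_if_tail_independent[OF ind]])
      show "((\<lambda>s. inverse s * copula_D C (\<lambda>i. s * (c i * b i powr \<beta>))) \<longlongrightarrow> l v') (at_right 0)"
        using Dv' by (simp add: cb)
    qed (use b0 in auto)
    also have "\<dots> = (\<Sum>i=1..n. v' i)" by (simp add: cb)
    also have "\<dots> = (\<Sum>i\<in>leading. v i)"
      using sub by (intro sum.mono_neutral_cong_right) (auto simp: v'_def)
    finally have "l v' = (\<Sum>i\<in>leading. v i)" .
    moreover have "copula_D C' (\<lambda>i. s * v i) = copula_D C (\<lambda>i. s * v' i)" for s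
      unfolding copula_D_def C'_def v'_def by (rule arg_cong[where f = "\<lambda>u. 1 - C u"]) auto
    ultimately show ?thesis using Dv' by simp
  qed
  have mrv': "mrv_copula leading C'"
    unfolding mrv_copula_def
    by (intro conjI cop' exI[of _ "\<lambda>v. \<Sum>i\<in>leading. v i"] allI impI D_lim)
  have "limiting_copula leading C' (\<lambda>u. \<Prod>i\<in>leading. u i)"
    unfolding limiting_copula_def
  proof (intro conjI allI impI is_copula_prod[OF fin])
    fix u :: "nat \<Rightarrow> real" assume u: "\<forall>i\<in>leading. u i \<in> {0..1}"
    show "((\<lambda>t. C' (\<lambda>i. u i powr (1 / t)) powr t) \<longlongrightarrow> (\<Prod>i\<in>leading. u i)) at_top"
    proof (cases "\<exists>i\<in>leading. u i = 0")
      case True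
      then obtain i where i: "i \<in> leading" "u i = 0" by auto
      have "\<forall>\<^sub>F t in at_top. C' (\<lambda>i. u i powr (1 / t)) powr t = 0"
        using eventually_gt_at_top[of 0]
      proof eventually_elim
        case (elim t)
        have "u k powr (1 / t) \<in> {0..1}" if "k \<in> leading" for k
          using u that elim by (auto intro!: powr_le1)
        then have "0 \<le> C' (\<lambda>i. u i powr (1 / t))" "C' (\<lambda>i. u i powr (1 / t)) \<le> u i powr (1 / t)"
          using copula_le_coordinate[OF cop' fin _ i(1), of "\<lambda>i. u i powr (1 / t)"] by auto
        then show ?case using i by simp
      qed
      then have "((\<lambda>t. C' (\<lambda>i. u i powr (1 / t)) powr t) \<longlongrightarrow> 0) at_top" by (rule tendsto_eventually)
      moreover have "(\<Prod>i\<in>leading. u i) = 0" using i fin by auto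
      ultimately show ?thesis by simp
    next
      case False
      then have u_pos: "0 < u i" if "i \<in> leading" for i using u that by (metis atLeastAtMost_iff less_eq_real_def)
      define v where "v i = (if i \<in> leading then - ln (u i) else 0)" for i
      have v: "0 \<le> v i" for i using u u_pos by (auto simp: v_def)
      have "((\<lambda>t. C' (\<lambda>i. exp (- v i) powr (1 / t)) powr t) \<longlongrightarrow> exp (- (\<Sum>i\<in>leading. v i))) at_top"
        using v by (intro copula_powr_tendsto[OF cop' fin] D_lim) auto
      moreover have "exp (- (\<Sum>i\<in>leading. v i)) = (\<Prod>i\<in>leading. u i)"
        using fin u_pos by (simp add: sum_negf[symmetric] exp_sum v_def)
      moreover have "C' (\<lambda>i. exp (- v i) powr (1 / t)) = C' (\<lambda>i. u i powr (1 / t))" for t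
        unfolding C'_def using u_pos by (intro arg_cong[where f = C]) (auto simp: v_def)
      ultimately show ?thesis by simp
    qed
  qed
  then show ?thesis
    unfolding asymp_independent_def using of mrv' by blast
qed

end

section \<open>Regular variation of the leading tail\<close>

text \<open>The tail of the transformed variable at \<open>x\<close> is \<open>G (1 - F\<^sub>0 x)\<close>, where \<open>G\<close> is the distribution function
  of \<open>p\<close>. As \<open>F\<^sub>0\<close> need not be continuous, a given small \<open>t\<close> need not be a value of \<open>1 - F\<^sub>0\<close>; with
  \<open>X t\<close> the quantile at \<open>1 - t\<close>, it lies between the values of \<open>1 - F\<^sub>0\<close> at \<open>X t\<close> and at
  \<open>X t / \<rho>\<close> for each \<open>\<rho> > 1\<close>.\<close>

lemma reg_var0_of_quantile_transform:
  assumes M: "prob_space M" and p[measurable]: "p \<in> borel_measurable M"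
    and p01: "\<And>x. x \<in> space M \<Longrightarrow> p x \<in> {0..1}"
    and atomless: "\<And>t. measure M {x \<in> space M. p x = t} = 0"
    and F0: "F\<^sub>0 \<in> RV 1" and H: "cdf (distr M borel (\<lambda>x. Q F\<^sub>0 (1 - p x))) \<in> RV \<beta>"
  shows "reg_var0 \<beta> (\<lambda>t. measure M {x \<in> space M. p x < t})"
proof -
  interpret prob_space M by fact
  have cdf0: "is_cdf F\<^sub>0" using F0 by (simp add: RV_def)
  note Fc = is_cdf_facts[OF cdf0]
  note less1 = RV_less_1[OF F0]
  define G where "G t = prob {x \<in> space M. p x < t}" for t
  define \<phi> where "\<phi> x = 1 - F\<^sub>0 x" for x
  let ?H = "cdf (distr M borel (\<lambda>x. Q F\<^sub>0 (1 - p x)))"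
  have Y[measurable]: "(\<lambda>x. Q F\<^sub>0 (1 - p x)) \<in> borel_measurable M"
    using p01 by (intro Q_measurable[OF cdf0]) auto
  have ne: "AE x in M. p x \<noteq> t" for t
    using atomless[of t] by (subst AE_iff_measurable[OF _ refl]) (auto simp: emeasure_eq_measure)
  have H_eq: "1 - ?H y = G (\<phi> y)" for y
  proof -
    have "?H y = prob {x \<in> space M. Q F\<^sub>0 (1 - p x) \<le> y}"
      unfolding cdf_def by (subst measure_distr) (auto intro!: arg_cong[where f = prob])
    also have "\<dots> = prob (space M - {x \<in> space M. p x < \<phi> y})"
    proof (rule finite_measure_eq_AE)
      show "AE x in M. x \<in> {x \<in> space M. Q F\<^sub>0 (1 - p x) \<le> y} \<longleftrightarrow> x \<in> space M - {x \<in> space M. p x < \<phi> y}"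
        using ne[of 0] ne[of 1] AE_space
      proof eventually_elim
        case (elim x)
        then have "0 < 1 - p x" "1 - p x < 1" using p01[of x] by auto
        then show ?case using Q_le_iff[OF cdf0, of "1 - p x" y] elim(3) by (auto simp: \<phi>_def)
      qed
    qed measurable
    also have "\<dots> = 1 - G (\<phi> y)" unfolding G_def by (rule prob_compl) measurable
    finally show ?thesis by simp
  qed
  have G_mono: "G s \<le> G t" if "s \<le> t" for s t
    unfolding G_def using that by (intro finite_measure_mono) auto
  have \<phi>_pos: "0 < \<phi> x" for x using less1[of x] by (simp add: \<phi>_def)
  have \<phi>_0: "(\<phi> \<longlongrightarrow> 0) at_top" unfolding \<phi>_def using tendsto_diff[OF tendsto_const Fc(2), of 1] by simp
  have G\<phi>_pos: "0 < G (\<phi> x)" for x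
    using RV_less_1[OF H, of x] H_eq[of x] by simp
  have G_pos: "0 < G t" if "0 < t" for t
  proof -
    have "\<forall>\<^sub>F x in at_top. \<phi> x < t" using \<phi>_0 that by (rule order_tendstoD)
    then obtain x where "\<phi> x < t" using eventually_happens'[OF trivial_limit_at_top_linorder] by blast
    then show ?thesis using G\<phi>_pos[of x] G_mono[of "\<phi> x" t] by simp
  qed
  have \<phi>_lim: "((\<lambda>x. \<phi> (x * y) / \<phi> x) \<longlongrightarrow> 1 / y) at_top" if "0 < y" for y
    using F0 that by (auto simp: RV_def \<phi>_def powr_minus_divide)
  have G_lim: "((\<lambda>x. G (\<phi> (x * y)) / G (\<phi> x)) \<longlongrightarrow> y powr (- \<beta>)) at_top" if "0 < y" for y
    using H that by (auto simp: RV_def H_eq)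
  define X where "X t = Q F\<^sub>0 (1 - t)" for t
  have X: "\<phi> (X t) \<le> t" "\<And>y. y < X t \<Longrightarrow> t < \<phi> y" if "0 < t" "t < 1" for t
  proof -
    have *: "X t \<le> y \<longleftrightarrow> \<phi> y \<le> t" for y
      unfolding X_def using Q_le_iff[OF cdf0, of "1 - t" y] that by (auto simp: \<phi>_def)
    show "\<phi> (X t) \<le> t" using *[of "X t"] by simp
    show "\<And>y. y < X t \<Longrightarrow> t < \<phi> y" using * by (simp add: not_le[symmetric])
  qed
  have t1: "\<forall>\<^sub>F t::real in at_right 0. 0 < t \<and> t < 1"
    using eventually_at_right_real[of 0 1] by (auto elim: eventually_mono)
  have X_top: "filterlim X at_top (at_right 0)"
    unfolding filterlim_at_top
  proof
    fix K
    have "\<forall>\<^sub>F t in at_right 0. t < \<phi> K"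
      using \<phi>_pos[of K] eventually_at_right_real[of 0 "\<phi> K"] by (auto elim: eventually_mono)
    then show "\<forall>\<^sub>F t in at_right 0. K \<le> X t"
      using t1
    proof eventually_elim
      case (elim t)
      have "\<phi> (X t) < \<phi> K" using X(1)[of t] elim by simp
      then have "F\<^sub>0 K < F\<^sub>0 (X t)" by (simp add: \<phi>_def)
      then show ?case using monoD[OF Fc(1), of "X t" K] by (meson linorder_not_le order_less_imp_le)
    qed
  qed
  have X_pos: "\<forall>\<^sub>F t in at_right 0. 0 < X t"
    using X_top by (simp add: filterlim_at_top_dense)
  have "((\<lambda>t. G (b * t) / G t) \<longlongrightarrow> b powr \<beta>) (at_right 0)" if b: "0 < b" for b
  proof (rule tendsto_by_factor_bounds)
    fix \<theta> e :: real assume \<theta>: "1 < \<theta>" and e: "0 < e"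
    define \<rho> where "\<rho> = sqrt \<theta>"
    have \<rho>: "1 < \<rho>" "\<theta> = \<rho> * \<rho>" using \<theta> by (auto simp: \<rho>_def)
    have z_top: "filterlim (\<lambda>t. X t / \<rho>) at_top (at_right 0)"
      using filterlim_tendsto_pos_mult_at_top[OF tendsto_const[of "1 / \<rho>"] _ X_top] \<rho> by simp
    have "\<forall>\<^sub>F z in at_top. b < \<phi> (z * (1 / (b * \<rho>))) / \<phi> z"
      using b \<rho> by (intro order_tendstoD[OF \<phi>_lim]) auto
    from eventually_compose_filterlim[OF this z_top]
    have ev1: "\<forall>\<^sub>F t in at_right 0. b < \<phi> (X t / \<rho> * (1 / (b * \<rho>))) / \<phi> (X t / \<rho>)" .
    have "\<forall>\<^sub>F x in at_top. G (\<phi> (x * (1 / (b * \<theta>)))) / G (\<phi> x) < (1 / (b * \<theta>)) powr (- \<beta>) + e"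
      using b \<theta> e by (intro order_tendstoD[OF G_lim]) auto
    from eventually_compose_filterlim[OF this X_top]
    have ev2: "\<forall>\<^sub>F t in at_right 0. G (\<phi> (X t * (1 / (b * \<theta>)))) / G (\<phi> (X t)) < (1 / (b * \<theta>)) powr (- \<beta>) + e" .
    have lim_eq: "(1 / (b * \<theta>)) powr (- \<beta>) = b powr \<beta> * \<theta> powr \<beta>"
      using b \<theta> by (simp add: powr_minus powr_divide powr_mult)
    show "\<forall>\<^sub>F t in at_right 0. G (b * t) / G t \<le> b powr \<beta> * \<theta> powr \<beta> + e"
      using ev1 ev2 X_pos t1
    proof eventually_elim
      case (elim t)
      have "X t / \<rho> < X t" using elim \<rho> by (simp add: pos_divide_less_eq)
      then have "t < \<phi> (X t / \<rho>)" using X(2) elim by blast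
      then have "b * t \<le> b * \<phi> (X t / \<rho>)" using b by simp
      also have "\<dots> \<le> \<phi> (X t / \<rho> * (1 / (b * \<rho>)))"
        using elim(1) \<phi>_pos[of "X t / \<rho>"] by (simp add: pos_less_divide_eq)
      also have "X t / \<rho> * (1 / (b * \<rho>)) = X t * (1 / (b * \<theta>))" by (simp add: \<rho>)
      finally have "G (b * t) / G t \<le> G (\<phi> (X t * (1 / (b * \<theta>)))) / G (\<phi> (X t))"
        using G\<phi>_pos[of "X t"] X(1)[of t] elim G_pos[of t] b
        by (intro frac_le G_mono) (auto simp: G_def)
      then show ?case using elim(2) lim_eq by simp
    qed
    have "\<forall>\<^sub>F x in at_top. \<phi> (x * (\<rho> / b)) / \<phi> x < b"
      using b \<rho> by (intro order_tendstoD[OF \<phi>_lim]) (auto simp: field_simps)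
    from eventually_compose_filterlim[OF this X_top]
    have ev3: "\<forall>\<^sub>F t in at_right 0. \<phi> (X t * (\<rho> / b)) / \<phi> (X t) < b" .
    have "\<forall>\<^sub>F z in at_top. (\<theta> / b) powr (- \<beta>) - e < G (\<phi> (z * (\<theta> / b))) / G (\<phi> z)"
      using b \<theta> e by (intro order_tendstoD[OF G_lim]) auto
    from eventually_compose_filterlim[OF this z_top]
    have ev4: "\<forall>\<^sub>F t in at_right 0. (\<theta> / b) powr (- \<beta>) - e < G (\<phi> (X t / \<rho> * (\<theta> / b))) / G (\<phi> (X t / \<rho>))" .
    have lim_eq': "(\<theta> / b) powr (- \<beta>) = b powr \<beta> * \<theta> powr (- \<beta>)"
      by (simp add: powr_minus_divide powr_divide)
    show "\<forall>\<^sub>F t in at_right 0. b powr \<beta> * \<theta> powr (- \<beta>) - e \<le> G (b * t) / G t"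
      using ev3 ev4 X_pos t1
    proof eventually_elim
      case (elim t)
      have "X t / \<rho> < X t" using elim \<rho> by (simp add: pos_divide_less_eq)
      then have less: "t < \<phi> (X t / \<rho>)" using X(2) elim by blast
      have "\<phi> (X t * (\<rho> / b)) \<le> b * \<phi> (X t)"
        using elim(1) \<phi>_pos[of "X t"] by (simp add: pos_divide_less_eq)
      also have "\<dots> \<le> b * t" using X(1)[of t] elim b by simp
      also have "X t * (\<rho> / b) = X t / \<rho> * (\<theta> / b)" using \<rho> by simp
      finally have "G (\<phi> (X t / \<rho> * (\<theta> / b))) / G (\<phi> (X t / \<rho>)) \<le> G (b * t) / G t"
        using less G_pos[of t] elim by (intro frac_le G_mono) (auto simp: G_def)
      then show ?case using elim(2) lim_eq' by simp
    qed
  qed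
  then show ?thesis using G_pos unfolding reg_var0_def G_def by blast
qed

section \<open>Dominating signals\<close>

lemma signal_succ_irrefl: "\<not> signal_succ M Y Y"
proof
  let ?f = "\<lambda>t. measure M {x \<in> space M. Y x < t}"
  assume "signal_succ M Y Y"
  then have pos: "\<And>t. 0 < t \<Longrightarrow> 0 < ?f t" and lim: "((\<lambda>t. ?f t / ?f t) \<longlongrightarrow> 0) (at_right 0)"
    by (auto simp: signal_succ_def)
  have "\<forall>\<^sub>F t in at_right 0. ?f t / ?f t = 1"
    using eventually_at_right_less[of "0::real"]
  proof eventually_elim
    case (elim t)
    then show ?case using pos[of t] by simp
  qed
  then have "((\<lambda>t. ?f t / ?f t) \<longlongrightarrow> 1) (at_right 0)" by (rule tendsto_eventually)
  from tendsto_unique[OF _ lim this] show False by simp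
qed

lemma signal_succ_trans:
  assumes "signal_succ M X Y" "signal_succ M Y Z"
  shows "signal_succ M X Z"
proof -
  let ?f = "\<lambda>X t. measure M {x \<in> space M. X x < t}"
  have "((\<lambda>t. ?f X t / ?f Y t * (?f Y t / ?f Z t)) \<longlongrightarrow> 0 * 0) (at_right 0)"
    using assms unfolding signal_succ_def by (intro tendsto_mult) auto
  moreover have "\<forall>\<^sub>F t in at_right 0. ?f X t / ?f Y t * (?f Y t / ?f Z t) = ?f X t / ?f Z t"
    using eventually_at_right_less[of "0::real"]
  proof eventually_elim
    case (elim t)
    then have "0 < ?f Y t" using assms(1) by (simp add: signal_succ_def)
    then show ?case by simp
  qed
  ultimately have "((\<lambda>t. ?f X t / ?f Z t) \<longlongrightarrow> 0 * 0) (at_right 0)"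
    by (rule Lim_transform_eventually)
  then show ?thesis using assms by (simp add: signal_succ_def)
qed

text \<open>A strongest signal among those that are stronger than \<open>i\<close>; it exists because the relation is a strict
  order on a finite set.\<close>

lemma ex_dominating_signal:
  assumes i: "i \<in> {1..n}" "i \<notin> dominating_signals M n P"
  shows "\<exists>k\<in>dominating_signals M n P. signal_succ M (P i) (P k)"
proof -
  let ?S = "{k \<in> {1..n}. signal_succ M (P i) (P k)}"
  have "\<exists>m\<in>?S. \<forall>k\<in>?S. k \<noteq> m \<longrightarrow> \<not> signal_succ M (P m) (P k)"
  proof (rule Finite_Set.bex_min_element)
    show "?S \<noteq> {}" using i by (auto simp: dominating_signals_def)
    show "asymp_on ?S (\<lambda>k m. signal_succ M (P m) (P k))"
      by (rule asymp_onI) (use signal_succ_trans signal_succ_irrefl in blast)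
    show "transp_on ?S (\<lambda>k m. signal_succ M (P m) (P k))"
      by (rule transp_onI) (use signal_succ_trans in blast)
  qed simp
  then obtain m where m: "m \<in> ?S" and min: "\<And>k. k \<in> ?S \<Longrightarrow> k \<noteq> m \<Longrightarrow> \<not> signal_succ M (P m) (P k)"
    by blast
  have "m \<in> dominating_signals M n P"
  proof (rule ccontr)
    assume "m \<notin> dominating_signals M n P"
    then obtain k where k: "k \<in> {1..n}" "signal_succ M (P m) (P k)"
      using m by (auto simp: dominating_signals_def)
    then have "k \<in> ?S" using m signal_succ_trans by blast
    moreover have "k \<noteq> m" using k signal_succ_irrefl by blast
    ultimately show False using min k by blast
  qed
  then show ?thesis using m by blast
qed

theorem theorem4p3:
  fixes M :: "'a measure" and n :: nat and P :: "nat \<Rightarrow> 'a \<Rightarrow> real" and w :: "nat \<Rightarrow> real"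
  assumes "prob_space M"
    and "\<And>i. i \<in> {1..n} \<Longrightarrow> P i \<in> borel_measurable M"
    and "\<And>i x. i \<in> {1..n} \<Longrightarrow> x \<in> space M \<Longrightarrow> P i x \<in> {0..1}"
    and "\<And>i. i \<in> {1..n} \<Longrightarrow> 0 < w i"
    and "(\<Sum>i=1..n. w i) = real n"
    and "\<And>i. i \<in> {1..n} \<Longrightarrow> continuous_on UNIV (cdf (distr M borel (P i)))"
    and "has_mrv_copula M {1..n} (\<lambda>i x. 1 - P i x)"
    and "\<And>i j. i \<in> dominating_signals M n P \<Longrightarrow> j \<in> dominating_signals M n P \<Longrightarrow> i \<noteq> j \<Longrightarrow>
      \<exists>L>0. ((\<lambda>t. \<P>(x in M. P i x < t) / \<P>(x in M. P j x < t)) \<longlongrightarrow> L) (at_right 0)"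
    and "\<exists>i\<in>dominating_signals M n P. \<exists>F\<^sub>0\<in>RV 1. \<exists>\<beta>. 0 < \<beta> \<and> \<beta> \<le> 1 \<and>
      cdf (distr M borel (\<lambda>x. Q F\<^sub>0 (1 - P i x))) \<in> RV \<beta>"
  shows "\<exists>q :: real \<Rightarrow> real.
    (\<forall>\<gamma>>0. \<forall>F\<in>RV_star \<gamma>. ((\<lambda>\<alpha>. scaled_power M n w P \<gamma> F \<alpha>) \<longlongrightarrow> q \<gamma>) (at_right 0)) \<and>
    (\<forall>\<gamma>\<^sub>1 \<gamma>\<^sub>2. \<gamma>\<^sub>1 > \<gamma>\<^sub>2 \<and> \<gamma>\<^sub>2 > 0 \<longrightarrow> q \<gamma>\<^sub>1 \<ge> q \<gamma>\<^sub>2) \<and>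
    (\<forall>\<gamma>\<^sub>1 \<gamma>\<^sub>2. \<gamma>\<^sub>1 > \<gamma>\<^sub>2 \<and> \<gamma>\<^sub>2 > 0 \<longrightarrow>
       (q \<gamma>\<^sub>1 > q \<gamma>\<^sub>2 \<longleftrightarrow>
          card (dominating_signals M n P) \<ge> 2 \<and>
          \<not> asymp_independent M (dominating_signals M n P) (\<lambda>i x. 1 - P i x)))"
proof -
  interpret prob_space M by fact
  note meas = assms(2)
  let ?I = "dominating_signals M n P"
  let ?G = "\<lambda>i t. prob {x \<in> space M. P i x < t}"
  obtain k F\<^sub>0 \<beta> where k: "k \<in> ?I" and F0: "F\<^sub>0 \<in> RV 1" and \<beta>: "0 < \<beta>"
    and H: "cdf (distr M borel (\<lambda>x. Q F\<^sub>0 (1 - P k x))) \<in> RV \<beta>"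
    using assms(9) by blast
  have kn: "k \<in> {1..n}" using k by (simp add: dominating_signals_def)
  have atomless: "prob {x \<in> space M. P i x = t} = 0" if i: "i \<in> {1..n}" for i t
  proof -
    interpret D: real_distribution "distr M borel (P i)"
      using meas[OF i] by (rule real_distribution_distr)
    have "measure (distr M borel (P i)) {t} = 0"
      using assms(6)[OF i] D.isCont_cdf[of t] by (simp add: continuous_on_eq_continuous_at)
    then show ?thesis
      using meas[OF i] by (subst (asm) measure_distr) (auto simp: vimage_def Int_def conj_commute)
  qed
  have g: "reg_var0 \<beta> (?G k)"
    using assms(3) kn by (intro reg_var0_of_quantile_transform[OF _ meas[OF kn] _ atomless F0 H]) (auto intro: prob_space_axioms)
  have Gk: "0 < ?G k t" if "0 < t" for t using g that by (simp add: reg_var0_def)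
  have g0: "(?G k \<longlongrightarrow> 0) (at_right 0)"
  proof -
    interpret D: real_distribution "distr M borel (P k)"
      using meas[OF kn] by (rule real_distribution_distr)
    let ?F = "cdf (distr M borel (P k))"
    have F: "?F t = prob {x \<in> space M. P k x \<le> t}" for t
      using meas[OF kn] unfolding cdf_def by (subst measure_distr) (auto intro!: arg_cong[where f = prob])
    have "{x \<in> space M. P k x \<le> 0} = {x \<in> space M. P k x = 0}"
      using assms(3)[OF kn] by force
    then have "?F 0 = 0" unfolding F using atomless[OF kn, of 0] by simp
    moreover have "(?F \<longlongrightarrow> ?F 0) (at_right 0)"
      using D.cdf_is_right_cont[of 0] by (simp add: continuous_within)
    ultimately have F0: "(?F \<longlongrightarrow> 0) (at_right 0)" by simp
    show ?thesis
    proof (rule Lim_null_comparison[OF _ F0])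
      have "?G k t \<le> ?F t" for t
        unfolding F using meas[OF kn] by (intro finite_measure_mono) auto
      then show "\<forall>\<^sub>F t in at_right 0. norm (?G k t) \<le> ?F t" by simp
    qed
  qed
  have lim_dom: "\<exists>L>0. ((\<lambda>t. ?G i t / ?G k t) \<longlongrightarrow> L) (at_right 0)" if i: "i \<in> ?I" for i
  proof (cases "i = k")
    case True
    have "\<forall>\<^sub>F t in at_right 0. ?G k t / ?G k t = 1"
      using eventually_at_right_less[of "0::real"]
    proof eventually_elim
      case (elim t)
      then show ?case using Gk[of t] by simp
    qed
    then show ?thesis unfolding True by (intro exI[of _ 1]) (auto intro: tendsto_eventually)
  next
    case False
    then show ?thesis using assms(8)[OF i k] by simp
  qed
  have lim_nondom: "((\<lambda>t. ?G i t / ?G k t) \<longlongrightarrow> 0) (at_right 0)" if i: "i \<in> {1..n}" "i \<notin> ?I" for i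
  proof -
    obtain j where j: "j \<in> ?I" "signal_succ M (P i) (P j)" using ex_dominating_signal[OF i] by blast
    obtain L where L: "((\<lambda>t. ?G j t / ?G k t) \<longlongrightarrow> L) (at_right 0)" using lim_dom[OF j(1)] by blast
    have "((\<lambda>t. ?G i t / ?G j t * (?G j t / ?G k t)) \<longlongrightarrow> 0 * L) (at_right 0)"
      using j(2) by (intro tendsto_mult L) (simp add: signal_succ_def)
    moreover have "\<forall>\<^sub>F t in at_right 0. ?G i t / ?G j t * (?G j t / ?G k t) = ?G i t / ?G k t"
      using eventually_at_right_less[of "0::real"]
    proof eventually_elim
      case (elim t)
      then have "0 < ?G j t" using j(2) by (simp add: signal_succ_def)
      then show ?case by simp
    qed
    ultimately have "((\<lambda>t. ?G i t / ?G k t) \<longlongrightarrow> 0 * L) (at_right 0)" by (rule Lim_transform_eventually)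
    then show ?thesis by simp
  qed
  \<comment> \<open>every tail is asymptotic to a multiple of the leading one, with factor 0 for the non-dominating signals\<close>
  define c where "c i = Lim (at_right 0) (\<lambda>t. ?G i t / ?G k t)" for i
  have c_dom: "0 < c i \<and> ((\<lambda>t. ?G i t / ?G k t) \<longlongrightarrow> c i) (at_right 0)" if i: "i \<in> ?I" for i
  proof -
    obtain L where L: "0 < L" "((\<lambda>t. ?G i t / ?G k t) \<longlongrightarrow> L) (at_right 0)" using lim_dom[OF i] by blast
    then have "c i = L" unfolding c_def by (intro tendsto_Lim) auto
    then show ?thesis using L by simp
  qed
  have c_nondom: "c i = 0" if "i \<in> {1..n}" "i \<notin> ?I" for i
    unfolding c_def using lim_nondom[OF that] by (intro tendsto_Lim) auto
  interpret rv_pvalues M n P w "?G k" \<beta> c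
  proof
    show "((\<lambda>t. ?G i t / ?G k t) \<longlongrightarrow> c i) (at_right 0)" if "i \<in> {1..n}" for i
      using c_dom lim_nondom[OF that] c_nondom[OF that] by (cases "i \<in> ?I") auto
    show "\<exists>i\<in>{1..n}. 0 < c i" using c_dom[OF k] kn by blast
  qed (use assms atomless \<beta> g g0 in auto)
  have lead: "leading = ?I"
  proof (rule set_eqI)
    fix i
    have "i \<in> {1..n}" if "i \<in> ?I" using that by (simp add: dominating_signals_def)
    then show "i \<in> leading \<longleftrightarrow> i \<in> ?I"
      using c_dom[of i] c_nondom[of i] by (cases "i \<in> ?I") (auto simp: leading_def)
  qed
  define q where "q \<gamma> = power_limit \<gamma> / total_limit" for \<gamma>
  have strict: "q \<gamma>\<^sub>1 > q \<gamma>\<^sub>2 \<longleftrightarrow> \<not> tail_independent" if "\<gamma>\<^sub>1 > \<gamma>\<^sub>2" "\<gamma>\<^sub>2 > 0" for \<gamma>\<^sub>1 \<gamma>\<^sub>2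
  proof
    assume "\<not> tail_independent"
    then show "q \<gamma>\<^sub>1 > q \<gamma>\<^sub>2"
      using power_limit_strict_mono[of \<gamma>\<^sub>2 \<gamma>\<^sub>1] that total_limit_pos by (simp add: q_def divide_strict_right_mono)
  next
    assume "q \<gamma>\<^sub>1 > q \<gamma>\<^sub>2"
    then show "\<not> tail_independent"
      using power_limit_tail_independent[of \<gamma>\<^sub>1] power_limit_tail_independent[of \<gamma>\<^sub>2] that by (auto simp: q_def)
  qed
  have ind: "\<not> tail_independent \<longleftrightarrow> card ?I \<ge> 2 \<and> \<not> asymp_independent M ?I (\<lambda>i x. 1 - P i x)"
    using tail_independent_if_card_le_1 tail_independent_if_asymp_independent
      asymp_independent_if_tail_independent unfolding lead by fastforce
  show ?thesis
  proof (intro exI[of _ q] conjI allI impI ballI)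
    show "((\<lambda>\<alpha>. scaled_power M n w P \<gamma> F \<alpha>) \<longlongrightarrow> q \<gamma>) (at_right 0)"
      if "0 < \<gamma>" "F \<in> RV_star \<gamma>" for \<gamma> F
      unfolding q_def using that by (intro scaled_power_tendsto)
    show "q \<gamma>\<^sub>1 \<ge> q \<gamma>\<^sub>2" if "\<gamma>\<^sub>1 > \<gamma>\<^sub>2 \<and> \<gamma>\<^sub>2 > 0" for \<gamma>\<^sub>1 \<gamma>\<^sub>2
      unfolding q_def using that total_limit_pos by (intro divide_right_mono power_limit_mono) auto
    show "q \<gamma>\<^sub>1 > q \<gamma>\<^sub>2 \<longleftrightarrow> card ?I \<ge> 2 \<and> \<not> asymp_independent M ?I (\<lambda>i x. 1 - P i x)"
      if "\<gamma>\<^sub>1 > \<gamma>\<^sub>2 \<and> \<gamma>\<^sub>2 > 0" for \<gamma>\<^sub>1 \<gamma>\<^sub>2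
      using strict[of \<gamma>\<^sub>2 \<gamma>\<^sub>1] that ind by blast
  qed
qed

end
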